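(* Let $\mathsf{C}$ be a category with covers (satisfying the axioms (A1)–(A4) of the context), let $n\in\mathbb N\cup\{\infty\}$ and let $k$ be an integer with $0<k\le n$. If $f\colon X_\bullet\to Y_\bullet$ is an $n$-stack, then the relative higher morphism space $P^{\ge k}(f)_\bullet$ is a Lie $(n-k)$-groupoid.
   Context: **Categories with covers.** $\mathsf{C}$ is a category with a subcategory of morphisms called covers such that: (A1) $\mathsf{C}$ has a terminal object $\ast$ and $X\to\ast$ is a cover for every $X$; (A2) pullbacks of covers along arbitrary maps exist and are covers; (A3) if $g,f$ are composable and $f\circ g$ and $g$ are covers, then $f$ is a cover; (A4) every cover is an effective epimorphism (the coequalizer of its kernel pair). **Simplicial notation.** $\mathsf{sC}$ is the category of simplicial objects in $\mathsf{C}$; objects of $\mathsf{C}$ are viewed as constant simplicial objects. For $X_\bullet\in\mathsf{sC}$ and a simplicial set $S$, $\hom(S,X):=\lim_{\Delta^k\to S}X_k$, if it exists. Expressions such as $\hom(S,X)\times_{\hom(S,Y)}\hom(T,Y)$ denote a single limit in $\mathsf{C}$ (the object, if it exists, representing the corresponding functor of points; individual factors need not exist). $\Lambda^k_i\subset\partial\Delta^k$ is the horn omitting the $i$-th face. For $f\colon X_\bullet\to Y_\bullet$, $\Lambda^k_i(f)=\hom(\Lambda^k_i,X)\times_{\hom(\Lambda^k_i,Y)}Y_k$, with induced map $\lambda^k_i(f)\colon X_k\to\Lambda^k_i(f)$. When $Y=\ast$ write $\Lambda^k_i(X),\lambda^k_i(X)$. **Lie $n$-groupoids and stacks.** For $n\in\mathbb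 N\cup\{\infty\}$: a Lie $n$-groupoid is $X_\bullet\in\mathsf{sC}$ such that for all $k>0$, $0\le i\le k$, $\Lambda^k_i(X)$ exists and $\lambda^k_i(X)$ is a cover, and is an isomorphism for $k>n$. A map $f$ of Lie $\infty$-groupoids is an $n$-stack if for all $k>0$, $0\le i\le k$, $\Lambda^k_i(f)$ exists and $\lambda^k_i(f)$ is a cover, and is an isomorphism for $k>n$. **Higher morphism spaces.** $S\star T$ is the join of simplicial sets ($\Delta^a\star\Delta^b=\Delta^{a+b+1}$, $\emptyset\star T=T$). For a finite simplicial set $S$, $X^{S\star}_\bullet$ has $\ell$-simplices $\hom(S\star\Delta^\ell,X)$, with faces and degeneracies given by $1\star d_i$, $1\star s_i$; e.g. $X^{\Delta^{k-1}\star}_\ell=X_{k+\ell}$. For an $\infty$-stack $f\colon X_\bullet\to Y_\bullet$ and $k>0$, let $B_\bullet:=X_\bullet^{\partial\Delta^{k-1}\star}\times_{Y_\bullet^{\partial\Delta^{k-1}\star}}Y_\bullet^{\Delta^{k-1}\star}$, whose $\ell$-simplices are the limits $\hom(\partial\Delta^{k-1}\star\Delta^\ell,X)\times_{\hom(\partial\Delta^{k-1}\star\Delta^\ell,Y)}Y_{k+\ell}$ (these exist); its $0$-simplices are $\Lambda^k_k(f)$. The relative higher morphism space $P^{\ge k}(f)_\bullet$ is the pullback of the natural map $f^{\partial\Delta^{k-1}\star}\colon X^{\Delta^{k-1}\star}_\bullet\to B_\bullet$ along the map $\Lambda^k_k(f)\to B_\bullet$ from the constant simplicial object on the vertices of $B_\bullet$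 given by iterated degeneracies. (By convention $\infty-k=\infty$.) *)

theory Defs
  imports "HOL-Library.Extended_Nat"
begin

section \<open>Categories\<close>

text \<open>
  Hom-sets of distinct pairs of objects are not required to be disjoint; every predicate on
  arrows therefore carries the source and the target explicitly.
\<close>

record ('o, 'm) cat =
  Ob :: "'o set"
  Hom :: "'o \<Rightarrow> 'o \<Rightarrow> 'm set"
  Id :: "'o \<Rightarrow> 'm"
  Comp :: "'m \<Rightarrow> 'm \<Rightarrow> 'm"  (infixl "\<cdot>\<index>" 70)

locale category =
  fixes C :: "('o, 'm) cat" (structure)
  assumes Id_in_Hom: "X \<in> Ob C \<Longrightarrow> Id C X \<in> Hom C X X"
    and Comp_in_Hom:
      "\<lbrakk>X \<in> Ob C; Y \<in> Ob C; Z \<in> Ob C; f \<in> Hom C X Y; g \<in> Hom C Y Z\<rbrakk>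
        \<Longrightarrow> g \<cdot> f \<in> Hom C X Z"
    and Comp_Id: "\<lbrakk>X \<in> Ob C; Y \<in> Ob C; f \<in> Hom C X Y\<rbrakk> \<Longrightarrow> f \<cdot> Id C X = f"
    and Id_Comp: "\<lbrakk>X \<in> Ob C; Y \<in> Ob C; f \<in> Hom C X Y\<rbrakk> \<Longrightarrow> Id C Y \<cdot> f = f"
    and Comp_assoc:
      "\<lbrakk>W \<in> Ob C; X \<in> Ob C; Y \<in> Ob C; Z \<in> Ob C;
        f \<in> Hom C W X; g \<in> Hom C X Y; h \<in> Hom C Y Z\<rbrakk>
        \<Longrightarrow> (h \<cdot> g) \<cdot> f = h \<cdot> (g \<cdot> f)"

definition is_terminal :: "('o, 'm) cat \<Rightarrow> 'o \<Rightarrow> bool" where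
  "is_terminal C T \<longleftrightarrow> T \<in> Ob C \<and> (\<forall>X \<in> Ob C. \<exists>!h. h \<in> Hom C X T)"

definition is_iso :: "('o, 'm) cat \<Rightarrow> 'o \<Rightarrow> 'o \<Rightarrow> 'm \<Rightarrow> bool" where
  "is_iso C X Y f \<longleftrightarrow> f \<in> Hom C X Y \<and>
     (\<exists>g \<in> Hom C Y X. g \<cdot>\<^bsub>C\<^esub> f = Id C X \<and> f \<cdot>\<^bsub>C\<^esub> g = Id C Y)"

text \<open>\<open>is_pullback C A B D f g P p q\<close>: \<open>P\<close> with projections \<open>p\<close>, \<open>q\<close> is a pullback of
  \<open>f : A \<rightarrow> D\<close> and \<open>g : B \<rightarrow> D\<close>.\<close>

definition is_pullback ::
  "('o, 'm) cat \<Rightarrow> 'o \<Rightarrow> 'o \<Rightarrow> 'o \<Rightarrow> 'm \<Rightarrow> 'm \<Rightarrow> 'o \<Rightarrow> 'm \<Rightarrow> 'm \<Rightarrow> bool" where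
  "is_pullback C A B D f g P p q \<longleftrightarrow>
     A \<in> Ob C \<and> B \<in> Ob C \<and> D \<in> Ob C \<and> P \<in> Ob C \<and>
     f \<in> Hom C A D \<and> g \<in> Hom C B D \<and> p \<in> Hom C P A \<and> q \<in> Hom C P B \<and>
     f \<cdot>\<^bsub>C\<^esub> p = g \<cdot>\<^bsub>C\<^esub> q \<and>
     (\<forall>U \<in> Ob C. \<forall>a \<in> Hom C U A. \<forall>b \<in> Hom C U B. f \<cdot>\<^bsub>C\<^esub> a = g \<cdot>\<^bsub>C\<^esub> b \<longrightarrow>
        (\<exists>!u. u \<in> Hom C U P \<and> p \<cdot>\<^bsub>C\<^esub> u = a \<and> q \<cdot>\<^bsub>C\<^esub> u = b))"

text \<open>\<open>is_coequalizer C R A D p q f\<close>: \<open>f : A \<rightarrow> D\<close> is a coequalizer of \<open>p, q : R \<rightarrow> A\<close>.\<close>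

definition is_coequalizer ::
  "('o, 'm) cat \<Rightarrow> 'o \<Rightarrow> 'o \<Rightarrow> 'o \<Rightarrow> 'm \<Rightarrow> 'm \<Rightarrow> 'm \<Rightarrow> bool" where
  "is_coequalizer C R A D p q f \<longleftrightarrow>
     R \<in> Ob C \<and> A \<in> Ob C \<and> D \<in> Ob C \<and>
     p \<in> Hom C R A \<and> q \<in> Hom C R A \<and> f \<in> Hom C A D \<and> f \<cdot>\<^bsub>C\<^esub> p = f \<cdot>\<^bsub>C\<^esub> q \<and>
     (\<forall>Z \<in> Ob C. \<forall>h \<in> Hom C A Z. h \<cdot>\<^bsub>C\<^esub> p = h \<cdot>\<^bsub>C\<^esub> q \<longrightarrow>
        (\<exists>!u. u \<in> Hom C D Z \<and> u \<cdot>\<^bsub>C\<^esub> f = h))"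

definition effective_epi :: "('o, 'm) cat \<Rightarrow> 'o \<Rightarrow> 'o \<Rightarrow> 'm \<Rightarrow> bool" where
  "effective_epi C A D f \<longleftrightarrow>
     (\<exists>R p q. is_pullback C A A D f f R p q \<and> is_coequalizer C R A D p q f)"

text \<open>
  \<open>Cov X Y\<close> is the set of covers from \<open>X\<close> to \<open>Y\<close>. The subcategory of covers contains every
  object because every \<open>X \<rightarrow> *\<close> is a cover, hence it contains all identities.
\<close>

locale category_with_covers = category C
  for C :: "('o, 'm) cat" (structure) +
  fixes Cov :: "'o \<Rightarrow> 'o \<Rightarrow> 'm set"
  assumes Cov_subset: "\<lbrakk>X \<in> Ob C; Y \<in> Ob C\<rbrakk> \<Longrightarrow> Cov X Y \<subseteq> Hom C X Y"
    and Cov_Id: "X \<in> Ob C \<Longrightarrow> Id C X \<in> Cov X X"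
    and Cov_Comp:
      "\<lbrakk>X \<in> Ob C; Y \<in> Ob C; Z \<in> Ob C; f \<in> Cov X Y; g \<in> Cov Y Z\<rbrakk> \<Longrightarrow> g \<cdot> f \<in> Cov X Z"
    and A1: "\<exists>T. is_terminal C T \<and> (\<forall>X \<in> Ob C. \<forall>h \<in> Hom C X T. h \<in> Cov X T)"
    and A2_exists:
      "\<lbrakk>A \<in> Ob C; B \<in> Ob C; D \<in> Ob C; f \<in> Cov A D; g \<in> Hom C B D\<rbrakk>
        \<Longrightarrow> \<exists>P p q. is_pullback C A B D f g P p q"
    and A2_cover: "\<lbrakk>is_pullback C A B D f g P p q; f \<in> Cov A D\<rbrakk> \<Longrightarrow> q \<in> Cov P B"
    and A3:
      "\<lbrakk>X \<in> Ob C; Y \<in> Ob C; Z \<in> Ob C; g \<in> Hom C X Y; f \<in> Hom C Y Z;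
        f \<cdot> g \<in> Cov X Z; g \<in> Cov X Y\<rbrakk> \<Longrightarrow> f \<in> Cov Y Z"
    and A4: "\<lbrakk>X \<in> Ob C; Y \<in> Ob C; f \<in> Cov X Y\<rbrakk> \<Longrightarrow> effective_epi C X Y f"

section \<open>Simplicial objects\<close>

text \<open>
  A monotone map \<open>\<theta> : [m] \<rightarrow> [n]\<close> is represented by the list \<open>[\<theta> 0, \<dots>, \<theta> m]\<close> of its values.
\<close>

definition ops :: "nat \<Rightarrow> nat \<Rightarrow> nat list set" where
  "ops m n = {\<theta>. length \<theta> = Suc m \<and> sorted \<theta> \<and> set \<theta> \<subseteq> {..n}}"

text \<open>\<open>op_comp \<theta> \<phi>\<close> is \<open>\<theta> \<circ> \<phi>\<close>.\<close>

definition op_comp :: "nat list \<Rightarrow> nat list \<Rightarrow> nat list" where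
  "op_comp \<theta> \<phi> = map (\<lambda>j. \<theta> ! j) \<phi>"

text \<open>
  \<open>act X n \<theta>\<close> is the structure map \<open>X\<^sub>n \<rightarrow> X\<^sub>m\<close> of \<open>\<theta> : [m] \<rightarrow> [n]\<close>. The argument \<open>n\<close> is needed
  because the list \<open>\<theta>\<close> does not determine the target \<open>[n]\<close>.
\<close>

record ('o, 'm) sobj =
  lev :: "nat \<Rightarrow> 'o"
  act :: "nat \<Rightarrow> nat list \<Rightarrow> 'm"

definition simplicial_object :: "('o, 'm) cat \<Rightarrow> ('o, 'm) sobj \<Rightarrow> bool" where
  "simplicial_object C X \<longleftrightarrow>
     (\<forall>n. lev X n \<in> Ob C) \<and>
     (\<forall>m n. \<forall>\<theta> \<in> ops m n. act X n \<theta> \<in> Hom C (lev X n) (lev X m)) \<and>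
     (\<forall>n. act X n [0..<Suc n] = Id C (lev X n)) \<and>
     (\<forall>l m n. \<forall>\<theta> \<in> ops m n. \<forall>\<phi> \<in> ops l m.
        act X n (op_comp \<theta> \<phi>) = act X m \<phi> \<cdot>\<^bsub>C\<^esub> act X n \<theta>)"

definition simplicial_maps ::
  "('o, 'm) cat \<Rightarrow> ('o, 'm) sobj \<Rightarrow> ('o, 'm) sobj \<Rightarrow> (nat \<Rightarrow> 'm) set" where
  "simplicial_maps C X Y =
     {f. (\<forall>n. f n \<in> Hom C (lev X n) (lev Y n)) \<and>
         (\<forall>m n. \<forall>\<theta> \<in> ops m n. act Y n \<theta> \<cdot>\<^bsub>C\<^esub> f n = f m \<cdot>\<^bsub>C\<^esub> act X n \<theta>)}"

definition sCat :: "('o, 'm) cat \<Rightarrow> (('o, 'm) sobj, nat \<Rightarrow> 'm) cat" where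
  "sCat C = \<lparr>Ob = {X. simplicial_object C X}, Hom = simplicial_maps C,
             Id = (\<lambda>X n. Id C (lev X n)), Comp = (\<lambda>g f n. g n \<cdot>\<^bsub>C\<^esub> f n)\<rparr>"

lemma category_sCat:
  fixes C (structure)
  assumes "category C"
  shows "category (sCat C)"
proof -
  interpret category C by fact
  have ob: "lev X n \<in> Ob C" if "X \<in> Ob (sCat C)" for X n
    using that by (simp add: sCat_def simplicial_object_def)
  have hom: "f n \<in> Hom C (lev X n) (lev Y n)" if "f \<in> Hom (sCat C) X Y" for f X Y n
    using that by (simp add: sCat_def simplicial_maps_def)
  have act: "act X n \<theta> \<in> Hom C (lev X n) (lev X m)"
    if "X \<in> Ob (sCat C)" "\<theta> \<in> ops m n" for X m n \<theta>
    using that by (simp add: sCat_def simplicial_object_def)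
  have nat: "act Y n \<theta> \<cdot> f n = f m \<cdot> act X n \<theta>"
    if "f \<in> Hom (sCat C) X Y" "\<theta> \<in> ops m n" for f X Y m n \<theta>
    using that by (simp add: sCat_def simplicial_maps_def)
  have memI: "f \<in> Hom (sCat C) X Y"
    if "\<And>n. f n \<in> Hom C (lev X n) (lev Y n)"
      "\<And>m n \<theta>. \<theta> \<in> ops m n \<Longrightarrow> act Y n \<theta> \<cdot> f n = f m \<cdot> act X n \<theta>" for f X Y
    using that by (simp add: sCat_def simplicial_maps_def)
  have id: "Id (sCat C) X n = Id C (lev X n)" for X n by (simp add: sCat_def)
  have comp: "(g \<cdot>\<^bsub>sCat C\<^esub> f) n = g n \<cdot> f n" for f g n by (simp add: sCat_def)
  show ?thesis
  proof
    show "Id (sCat C) X \<in> Hom (sCat C) X X" if "X \<in> Ob (sCat C)" for X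
      by (rule memI, unfold id)
        (use that in \<open>simp_all add: Id_in_Hom ob Comp_Id[OF ob ob act] Id_Comp[OF ob ob act]\<close>)
  next
    fix X Y Z f g
    assume *: "X \<in> Ob (sCat C)" "Y \<in> Ob (sCat C)" "Z \<in> Ob (sCat C)"
      "f \<in> Hom (sCat C) X Y" "g \<in> Hom (sCat C) Y Z"
    show "g \<cdot>\<^bsub>sCat C\<^esub> f \<in> Hom (sCat C) X Z"
    proof (rule memI, unfold comp)
      show "g n \<cdot> f n \<in> Hom C (lev X n) (lev Z n)" for n
        by (rule Comp_in_Hom[OF ob ob ob hom hom]) (rule *)+
      fix m n \<theta> assume t: "\<theta> \<in> ops m n"
      have "act Z n \<theta> \<cdot> (g n \<cdot> f n) = (act Z n \<theta> \<cdot> g n) \<cdot> f n"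
        by (rule Comp_assoc[symmetric, OF ob ob ob ob hom hom act[OF _ t]]) (rule *)+
      also have "\<dots> = (g m \<cdot> act Y n \<theta>) \<cdot> f n" by (simp only: nat[OF *(5) t])
      also have "\<dots> = g m \<cdot> (act Y n \<theta> \<cdot> f n)"
        by (rule Comp_assoc[OF ob ob ob ob hom act[OF _ t] hom]) (rule *)+
      also have "\<dots> = g m \<cdot> (f m \<cdot> act X n \<theta>)" by (simp only: nat[OF *(4) t])
      also have "\<dots> = (g m \<cdot> f m) \<cdot> act X n \<theta>"
        by (rule Comp_assoc[symmetric, OF ob ob ob ob act[OF _ t] hom hom]) (rule *)+
      finally show "act Z n \<theta> \<cdot> (g n \<cdot> f n) = (g m \<cdot> f m) \<cdot> act X n \<theta>" .
    qed
  next
    fix X Y f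
    assume "X \<in> Ob (sCat C)" "Y \<in> Ob (sCat C)" "f \<in> Hom (sCat C) X Y"
    then show "f \<cdot>\<^bsub>sCat C\<^esub> Id (sCat C) X = f" and "Id (sCat C) Y \<cdot>\<^bsub>sCat C\<^esub> f = f"
      by (auto simp: fun_eq_iff comp id Comp_Id[OF ob ob hom] Id_Comp[OF ob ob hom])
  next
    fix W X Y Z f g h
    assume "W \<in> Ob (sCat C)" "X \<in> Ob (sCat C)" "Y \<in> Ob (sCat C)" "Z \<in> Ob (sCat C)"
      "f \<in> Hom (sCat C) W X" "g \<in> Hom (sCat C) X Y" "h \<in> Hom (sCat C) Y Z"
    then show "(h \<cdot>\<^bsub>sCat C\<^esub> g) \<cdot>\<^bsub>sCat C\<^esub> f = h \<cdot>\<^bsub>sCat C\<^esub> (g \<cdot>\<^bsub>sCat C\<^esub> f)"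
      by (intro ext, unfold comp) (rule Comp_assoc[OF ob ob ob ob hom hom hom])
  qed
qed

definition const_sobj :: "('o, 'm) cat \<Rightarrow> 'o \<Rightarrow> ('o, 'm) sobj" where
  "const_sobj C A = \<lparr>lev = (\<lambda>_. A), act = (\<lambda>_ _. Id C A)\<rparr>"

section \<open>Subcomplexes of standard simplices\<close>

text \<open>
  An \<open>m\<close>-simplex of \<open>\<Delta>\<^sup>N\<close> is a monotone map \<open>[m] \<rightarrow> [N]\<close>, i.e. the list of its vertices; a
  simplicial subset of \<open>\<Delta>\<^sup>N\<close> is the set of its simplices of all dimensions. The operator
  \<open>\<theta>\<close> sends the simplex \<open>\<sigma>\<close> to \<open>op_comp \<sigma> \<theta>\<close>.
\<close>

definition sdim :: "nat list \<Rightarrow> nat" where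
  "sdim \<sigma> = length \<sigma> - 1"

definition simplex :: "nat \<Rightarrow> nat list set" where
  "simplex N = (\<Union>m. ops m N)"

definition simplex_boundary :: "nat \<Rightarrow> nat list set" where
  "simplex_boundary N = {\<sigma> \<in> simplex N. \<exists>j \<le> N. j \<notin> set \<sigma>}"

text \<open>A simplex lies on the \<open>j\<close>-th face iff it omits the vertex \<open>j\<close>.\<close>

definition horn :: "nat \<Rightarrow> nat \<Rightarrow> nat list set" where
  "horn k i = {\<sigma> \<in> simplex k. \<exists>j \<le> k. j \<noteq> i \<and> j \<notin> set \<sigma>}"

text \<open>
  The join of \<open>S \<subseteq> \<Delta>\<^sup>a\<close> and \<open>T \<subseteq> \<Delta>\<^sup>b\<close>, as a subcomplex of \<open>\<Delta>\<^sup>a \<star> \<Delta>\<^sup>b = \<Delta>\<^sup>a\<^sup>+\<^sup>b\<^sup>+\<^sup>1\<close>: its simplices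
  are those of \<open>S\<close>, those of \<open>T\<close>, and the pairs consisting of one of each; \<open>T\<close> sits on the
  vertices \<open>a + 1, \<dots>, a + b + 1\<close>.
\<close>

definition join :: "nat \<Rightarrow> nat list set \<Rightarrow> nat list set \<Rightarrow> nat list set" where
  "join a S T =
     {\<sigma> @ map (\<lambda>j. Suc a + j) \<tau> | \<sigma> \<tau>.
        \<sigma> \<in> insert [] S \<and> \<tau> \<in> insert [] T \<and> (\<sigma> \<noteq> [] \<or> \<tau> \<noteq> [])}"

text \<open>For \<open>\<theta> : [m] \<rightarrow> [l]\<close>, the map \<open>1 \<star> \<theta> : \<Delta>\<^sup>a \<star> \<Delta>\<^sup>m \<rightarrow> \<Delta>\<^sup>a \<star> \<Delta>\<^sup>l\<close>.\<close>

definition id_join :: "nat \<Rightarrow> nat list \<Rightarrow> nat list" where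
  "id_join a \<theta> = [0..<Suc a] @ map (\<lambda>j. Suc a + j) \<theta>"

lemma join_simplex_simplex: "join a (simplex a) (simplex b) = simplex (a + b + 1)"
proof (intro set_eqI iffI)
  fix \<rho> assume "\<rho> \<in> join a (simplex a) (simplex b)"
  then obtain \<sigma> \<tau> where r: "\<rho> = \<sigma> @ map (\<lambda>j. Suc a + j) \<tau>"
    and s: "\<sigma> \<in> insert [] (simplex a)" and t: "\<tau> \<in> insert [] (simplex b)"
    and ne: "\<sigma> \<noteq> [] \<or> \<tau> \<noteq> []"
    unfolding join_def by blast
  have s': "sorted \<sigma>" "set \<sigma> \<subseteq> {..a}" and t': "sorted \<tau>" "set \<tau> \<subseteq> {..b}"
    using s t by (auto simp: simplex_def ops_def)
  have so: "sorted (map (\<lambda>j. Suc a + j) \<tau>)"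
    using t'(1) by (simp add: sorted_map)
  have "length \<rho> = Suc (length \<rho> - 1)" using r ne by (cases \<rho>) auto
  then have "\<rho> \<in> ops (length \<rho> - 1) (a + b + 1)"
    unfolding ops_def r using s' t' by (auto simp: sorted_append so)
  then show "\<rho> \<in> simplex (a + b + 1)" unfolding simplex_def by blast
next
  fix \<rho> assume "\<rho> \<in> simplex (a + b + 1)"
  then have r: "\<rho> \<noteq> []" "sorted \<rho>" "set \<rho> \<subseteq> {..a + b + 1}"
    by (auto simp: simplex_def ops_def)
  define \<sigma> where "\<sigma> = takeWhile (\<lambda>j. j \<le> a) \<rho>"
  define \<nu> where "\<nu> = dropWhile (\<lambda>j. j \<le> a) \<rho>"
  define \<tau> where "\<tau> = map (\<lambda>j. j - Suc a) \<nu>"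
  have split: "\<rho> = \<sigma> @ \<nu>" unfolding \<sigma>_def \<nu>_def by simp
  have sn: "sorted \<nu>" using r(2) split by (simp add: sorted_append)
  have big: "j > a" if "j \<in> set \<nu>" for j
  proof -
    have "\<nu> \<noteq> []" using that by auto
    then have "a < hd \<nu>" unfolding \<nu>_def using hd_dropWhile not_le by blast
    moreover have "hd \<nu> \<le> j" using sn that \<open>\<nu> \<noteq> []\<close> by (cases \<nu>) auto
    ultimately show ?thesis by linarith
  qed
  have nu: "map (\<lambda>j. Suc a + j) \<tau> = \<nu>"
    unfolding \<tau>_def by (auto dest!: big intro!: map_idI)
  have "sorted \<tau>" unfolding \<tau>_def sorted_map
    by (rule sorted_wrt_mono_rel[OF _ sn]) auto
  moreover have "set \<tau> \<subseteq> {..b}"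
  proof
    fix j assume "j \<in> set \<tau>"
    then obtain i where "i \<in> set \<nu>" "j = i - Suc a" unfolding \<tau>_def by auto
    moreover have "i \<le> a + b + 1" using r(3) split calculation(1) by auto
    ultimately show "j \<in> {..b}" by auto
  qed
  ultimately have t: "\<tau> \<in> insert [] (simplex b)"
    by (cases \<tau>) (auto simp: simplex_def ops_def)
  have "sorted \<sigma>" using r(2) split by (simp add: sorted_append)
  moreover have "set \<sigma> \<subseteq> {..a}" unfolding \<sigma>_def by (auto dest: set_takeWhileD)
  ultimately have s: "\<sigma> \<in> insert [] (simplex a)"
    by (cases \<sigma>) (auto simp: simplex_def ops_def)
  have "\<sigma> \<noteq> [] \<or> \<tau> \<noteq> []" using r(1) split \<tau>_def by auto
  then show "\<rho> \<in> join a (simplex a) (simplex b)"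
    unfolding join_def using s t nu split by blast
qed

section \<open>Limits indexed by simplicial sets\<close>

text \<open>
  \<open>hom_points C S X U\<close> consists of the cones with vertex \<open>U\<close> over the diagram of all
  \<open>X\<^sub>k\<close> indexed by the simplices \<open>\<Delta>\<^sup>k \<rightarrow> S\<close>, i.e. of the \<open>U\<close>-valued points of \<open>hom(S, X)\<close>. The
  values of a cone outside \<open>S\<close> are irrelevant.
\<close>

definition hom_points ::
  "('o, 'm) cat \<Rightarrow> nat list set \<Rightarrow> ('o, 'm) sobj \<Rightarrow> 'o \<Rightarrow> (nat list \<Rightarrow> 'm) set" where
  "hom_points C S X U =
     {x. (\<forall>\<sigma> \<in> S. x \<sigma> \<in> Hom C U (lev X (sdim \<sigma>))) \<and>
         (\<forall>\<sigma> \<in> S. \<forall>m. \<forall>\<theta> \<in> ops m (sdim \<sigma>).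
            x (op_comp \<sigma> \<theta>) = act X (sdim \<sigma>) \<theta> \<cdot>\<^bsub>C\<^esub> x \<sigma>)}"

text \<open>\<open>L\<close> with universal cone \<open>\<xi>\<close> is the limit \<open>hom(S, X)\<close>.\<close>

definition is_hom ::
  "('o, 'm) cat \<Rightarrow> nat list set \<Rightarrow> ('o, 'm) sobj \<Rightarrow> 'o \<Rightarrow> (nat list \<Rightarrow> 'm) \<Rightarrow> bool" where
  "is_hom C S X L \<xi> \<longleftrightarrow>
     L \<in> Ob C \<and> \<xi> \<in> hom_points C S X L \<and>
     (\<forall>U \<in> Ob C. \<forall>x \<in> hom_points C S X U.
        \<exists>!u. u \<in> Hom C U L \<and> (\<forall>\<sigma> \<in> S. \<xi> \<sigma> \<cdot>\<^bsub>C\<^esub> u = x \<sigma>))"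

text \<open>
  For \<open>S \<subseteq> \<Delta>\<^sup>N\<close> and \<open>f : X \<rightarrow> Y\<close>, the \<open>U\<close>-valued points \<open>(x, y)\<close> of the limit of
  \<open>hom(S, X) \<rightarrow> hom(S, Y) \<leftarrow> Y\<^sub>N\<close>. A simplex \<open>\<sigma>\<close> of \<open>S\<close> is also an operator
  \<open>[sdim \<sigma>] \<rightarrow> [N]\<close>, and \<open>act Y N \<sigma>\<close> is the \<open>\<sigma>\<close>-component of \<open>Y\<^sub>N \<rightarrow> hom(S, Y)\<close>.
\<close>

definition rel_hom_points ::
  "('o, 'm) cat \<Rightarrow> nat list set \<Rightarrow> nat \<Rightarrow> ('o, 'm) sobj \<Rightarrow> ('o, 'm) sobj \<Rightarrow> (nat \<Rightarrow> 'm) \<Rightarrow>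
   'o \<Rightarrow> ((nat list \<Rightarrow> 'm) \<times> 'm) set" where
  "rel_hom_points C S N X Y f U =
     {(x, y). x \<in> hom_points C S X U \<and> y \<in> Hom C U (lev Y N) \<and>
        (\<forall>\<sigma> \<in> S. f (sdim \<sigma>) \<cdot>\<^bsub>C\<^esub> x \<sigma> = act Y N \<sigma> \<cdot>\<^bsub>C\<^esub> y)}"

text \<open>\<open>L\<close> with universal point \<open>(\<xi>, \<eta>)\<close> is the single limit \<open>hom(S, X) \<times>\<^bsub>hom(S, Y)\<^esub> Y\<^sub>N\<close>;
  neither \<open>hom(S, X)\<close> nor \<open>hom(S, Y)\<close> is required to exist.\<close>

definition is_rel_hom ::
  "('o, 'm) cat \<Rightarrow> nat list set \<Rightarrow> nat \<Rightarrow> ('o, 'm) sobj \<Rightarrow> ('o, 'm) sobj \<Rightarrow> (nat \<Rightarrow> 'm) \<Rightarrow>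
   'o \<Rightarrow> (nat list \<Rightarrow> 'm) \<Rightarrow> 'm \<Rightarrow> bool" where
  "is_rel_hom C S N X Y f L \<xi> \<eta> \<longleftrightarrow>
     L \<in> Ob C \<and> (\<xi>, \<eta>) \<in> rel_hom_points C S N X Y f L \<and>
     (\<forall>U \<in> Ob C. \<forall>(x, y) \<in> rel_hom_points C S N X Y f U.
        \<exists>!u. u \<in> Hom C U L \<and> (\<forall>\<sigma> \<in> S. \<xi> \<sigma> \<cdot>\<^bsub>C\<^esub> u = x \<sigma>) \<and> \<eta> \<cdot>\<^bsub>C\<^esub> u = y)"

text \<open>The canonical maps \<open>X\<^sub>N \<rightarrow> hom(S, X)\<close> and \<open>X\<^sub>N \<rightarrow> hom(S, X) \<times>\<^bsub>hom(S, Y)\<^esub> Y\<^sub>N\<close>, for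
  \<open>S \<subseteq> \<Delta>\<^sup>N\<close>.\<close>

definition is_restriction ::
  "('o, 'm) cat \<Rightarrow> nat list set \<Rightarrow> nat \<Rightarrow> ('o, 'm) sobj \<Rightarrow> 'o \<Rightarrow> (nat list \<Rightarrow> 'm) \<Rightarrow>
   'm \<Rightarrow> bool" where
  "is_restriction C S N X L \<xi> r \<longleftrightarrow>
     r \<in> Hom C (lev X N) L \<and> (\<forall>\<sigma> \<in> S. \<xi> \<sigma> \<cdot>\<^bsub>C\<^esub> r = act X N \<sigma>)"

definition is_rel_restriction ::
  "('o, 'm) cat \<Rightarrow> nat list set \<Rightarrow> nat \<Rightarrow> ('o, 'm) sobj \<Rightarrow> (nat \<Rightarrow> 'm) \<Rightarrow>
   'o \<Rightarrow> (nat list \<Rightarrow> 'm) \<Rightarrow> 'm \<Rightarrow> 'm \<Rightarrow> bool" where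
  "is_rel_restriction C S N X f L \<xi> \<eta> r \<longleftrightarrow>
     is_restriction C S N X L \<xi> r \<and> \<eta> \<cdot>\<^bsub>C\<^esub> r = f N"

section \<open>Lie \<open>n\<close>-groupoids and \<open>n\<close>-stacks\<close>

text \<open>For \<open>Y = *\<close> the limit \<open>hom(\<Lambda>, X) \<times>\<^bsub>hom(\<Lambda>, Y)\<^esub> Y\<^sub>k\<close> is \<open>hom(\<Lambda>, X)\<close>. The limits are determined
  up to isomorphism, and covers are stable under composition with isomorphisms, so it does not
  matter which limit is chosen.\<close>

definition lie_groupoid ::
  "('o, 'm) cat \<Rightarrow> ('o \<Rightarrow> 'o \<Rightarrow> 'm set) \<Rightarrow> enat \<Rightarrow> ('o, 'm) sobj \<Rightarrow> bool" where
  "lie_groupoid C Cov n X \<longleftrightarrow>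
     simplicial_object C X \<and>
     (\<forall>k > 0. \<forall>i \<le> k. \<exists>L \<xi> r.
        is_hom C (horn k i) X L \<xi> \<and> is_restriction C (horn k i) k X L \<xi> r \<and>
        r \<in> Cov (lev X k) L \<and> (n < enat k \<longrightarrow> is_iso C (lev X k) L r))"

definition n_stack ::
  "('o, 'm) cat \<Rightarrow> ('o \<Rightarrow> 'o \<Rightarrow> 'm set) \<Rightarrow> enat \<Rightarrow>
   ('o, 'm) sobj \<Rightarrow> ('o, 'm) sobj \<Rightarrow> (nat \<Rightarrow> 'm) \<Rightarrow> bool" where
  "n_stack C Cov n X Y f \<longleftrightarrow>
     lie_groupoid C Cov \<infinity> X \<and> lie_groupoid C Cov \<infinity> Y \<and> f \<in> simplicial_maps C X Y \<and>
     (\<forall>k > 0. \<forall>i \<le> k. \<exists>L \<xi> \<eta> r.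
        is_rel_hom C (horn k i) k X Y f L \<xi> \<eta> \<and>
        is_rel_restriction C (horn k i) k X f L \<xi> \<eta> r \<and>
        r \<in> Cov (lev X k) L \<and> (n < enat k \<longrightarrow> is_iso C (lev X k) L r))"

section \<open>Higher morphism spaces\<close>

text \<open>\<open>X\<^bsup>\<Delta>\<^esup>\<^sup>\<star>\<close> for \<open>\<Delta> = \<Delta>\<^sup>a\<close>, with \<open>l\<close>-simplices \<open>hom(\<Delta>\<^sup>a \<star> \<Delta>\<^sup>l, X) = X\<^bsub>a+1+l\<^esub>\<close>.\<close>

definition join_power :: "nat \<Rightarrow> ('o, 'm) sobj \<Rightarrow> ('o, 'm) sobj" where
  "join_power a X =
     \<lparr>lev = (\<lambda>l. lev X (Suc a + l)), act = (\<lambda>l \<theta>. act X (Suc a + l) (id_join a \<theta>))\<rparr>"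

text \<open>
  For \<open>S \<subseteq> \<Delta>\<^sup>a\<close>, the simplicial object \<open>B\<close> with \<open>l\<close>-simplices
  \<open>hom(S \<star> \<Delta>\<^sup>l, X) \<times>\<^bsub>hom(S \<star> \<Delta>\<^sup>l, Y)\<^esub> Y\<^bsub>a+1+l\<^esub>\<close>, universal points \<open>(\<xi> l, \<eta> l)\<close>, and structure maps
  induced by the maps \<open>1 \<star> \<theta>\<close>.
\<close>

definition is_rel_join_power ::
  "('o, 'm) cat \<Rightarrow> nat \<Rightarrow> nat list set \<Rightarrow> ('o, 'm) sobj \<Rightarrow> ('o, 'm) sobj \<Rightarrow> (nat \<Rightarrow> 'm) \<Rightarrow>
   ('o, 'm) sobj \<Rightarrow> (nat \<Rightarrow> nat list \<Rightarrow> 'm) \<Rightarrow> (nat \<Rightarrow> 'm) \<Rightarrow> bool" where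
  "is_rel_join_power C a S X Y f B \<xi> \<eta> \<longleftrightarrow>
     simplicial_object C B \<and>
     (\<forall>l. is_rel_hom C (join a S (simplex l)) (Suc a + l) X Y f (lev B l) (\<xi> l) (\<eta> l)) \<and>
     (\<forall>m l. \<forall>\<theta> \<in> ops m l.
        (\<forall>\<sigma> \<in> join a S (simplex m).
           \<xi> m \<sigma> \<cdot>\<^bsub>C\<^esub> act B l \<theta> = \<xi> l (op_comp (id_join a \<theta>) \<sigma>)) \<and>
        \<eta> m \<cdot>\<^bsub>C\<^esub> act B l \<theta> = act Y (Suc a + l) (id_join a \<theta>) \<cdot>\<^bsub>C\<^esub> \<eta> l)"

text \<open>
  \<open>P\<close> is a relative higher morphism space of \<open>f\<close> for \<open>k > 0\<close>. Here \<open>\<partial>\<Delta>\<^bsup>k-1\<^esup> \<star> \<Delta>\<^sup>0\<close> is the horn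
  omitting the \<open>k\<close>-th face of \<open>\<Delta>\<^sup>k\<close> (see \<open>join_boundary_vertex\<close> below), \<open>\<phi>\<close> is the natural map from
  \<open>join_power (k - 1) X\<close> to \<open>B\<close>, and \<open>replicate (Suc l) 0\<close> is the operator \<open>[l] \<rightarrow> [0]\<close>, which acts on
  \<open>B\<close> as the iterated degeneracy. The pullback is formed in the category of simplicial objects.
\<close>

definition is_higher_morphism_space ::
  "('o, 'm) cat \<Rightarrow> nat \<Rightarrow> ('o, 'm) sobj \<Rightarrow> ('o, 'm) sobj \<Rightarrow> (nat \<Rightarrow> 'm) \<Rightarrow>
   ('o, 'm) sobj \<Rightarrow> bool" where
  "is_higher_morphism_space C k X Y f P \<longleftrightarrow>
     (\<exists>B \<xi> \<eta> \<phi> p q.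
        is_rel_join_power C (k - 1) (simplex_boundary (k - 1)) X Y f B \<xi> \<eta> \<and>
        (\<forall>l. is_rel_restriction C (join (k - 1) (simplex_boundary (k - 1)) (simplex l))
               (k + l) X f (lev B l) (\<xi> l) (\<eta> l) (\<phi> l)) \<and>
        is_pullback (sCat C) (join_power (k - 1) X) (const_sobj C (lev B 0)) B
          \<phi> (\<lambda>l. act B 0 (replicate (Suc l) 0)) P p q)"

lemma join_boundary_vertex:
  assumes "k > 0"
  shows "join (k - 1) (simplex_boundary (k - 1)) (simplex 0) = horn k k"
proof -
  obtain a where k: "k = Suc a" using assms by (cases k) auto
  show ?thesis unfolding k diff_Suc_1
  proof (intro set_eqI iffI)
    fix \<rho> assume *: "\<rho> \<in> join a (simplex_boundary a) (simplex 0)"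
    then have "\<rho> \<in> join a (simplex a) (simplex 0)"
      unfolding join_def simplex_boundary_def by blast
    then have r: "\<rho> \<in> simplex (Suc a)" using join_simplex_simplex[of a 0] by simp
    from * obtain \<sigma> \<tau> where rho: "\<rho> = \<sigma> @ map (\<lambda>j. Suc a + j) \<tau>"
      and s: "\<sigma> \<in> insert [] (simplex_boundary a)" unfolding join_def by blast
    obtain j where "j \<le> a" "j \<notin> set \<sigma>" using s by (fastforce simp: simplex_boundary_def)
    then show "\<rho> \<in> horn (Suc a) (Suc a)"
      unfolding horn_def using r rho by (auto intro!: exI[of _ j])
  next
    fix \<rho> assume "\<rho> \<in> horn (Suc a) (Suc a)"
    then obtain j where "\<rho> \<in> simplex (Suc a)" and j: "j \<le> a" "j \<notin> set \<rho>"
      unfolding horn_def by (auto simp: le_Suc_eq)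
    then have "\<rho> \<in> join a (simplex a) (simplex 0)" using join_simplex_simplex[of a 0] by simp
    then obtain \<sigma> \<tau> where rho: "\<rho> = \<sigma> @ map (\<lambda>j. Suc a + j) \<tau>"
      and s: "\<sigma> \<in> insert [] (simplex a)" and t: "\<tau> \<in> insert [] (simplex 0)"
      and ne: "\<sigma> \<noteq> [] \<or> \<tau> \<noteq> []"
      unfolding join_def by blast
    have "\<sigma> \<in> insert [] (simplex_boundary a)"
      using s j rho by (auto simp: simplex_boundary_def)
    then show "\<rho> \<in> join a (simplex_boundary a) (simplex 0)"
      unfolding join_def using rho t ne by blast
  qed
qed

end

theory Submission
  imports Defs
begin

text \<open>
  Everything is read through functors of points. For a subcomplex \<open>S\<close> of \<open>\<Delta>\<^sup>N\<close> the limit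
  \<open>hom(S, X) \<times>\<^bsub>hom(S, Y)\<^esub> Y\<^sub>N\<close> has points whether or not it exists, so the relation "\<open>hom(S', X)\<close>
  maps to \<open>hom(S, X)\<close> by a cover" makes sense without any existence assumption: an inclusion
  \<open>S \<subseteq> S'\<close> is \<^emph>\<open>covering\<close> for \<open>f\<close> if, for every point on \<open>S\<close> over an object \<open>W\<close>, its extensions
  to \<open>S'\<close> are represented by an object whose projection to \<open>W\<close> is a cover. Covering inclusions
  compose and are stable under pushout (\<open>covering_trans\<close>, \<open>covering_pushout\<close>). They carry existence
  of limits from \<open>S\<close> to \<open>S'\<close> (\<open>representable_extend\<close>), and where the limit on \<open>S\<close> exists, the
  inclusion \<open>S \<subseteq> \<Delta>\<^sup>N\<close> is covering iff the restriction map from \<open>X\<^sub>N\<close> is a cover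
  (\<open>covering_of_restriction\<close>, \<open>restriction_of_covering\<close>). All of this works for any class of arrows
  that contains the isomorphisms and is stable under composition and pullback; covers and
  isomorphisms are the two classes that matter.

  For an \<open>n\<close>-stack all horn inclusions are covering. A union of some, but not all, of the faces of
  \<open>\<Delta>\<^sup>N\<close> grows to a horn by adding one face at a time, and each such step is a pushout of an inclusion
  of the same kind in dimension \<open>N - 1\<close>. Hence all these inclusions are covering
  (\<open>covering_faces\<close>) and the limits over these unions exist (\<open>representable_faces\<close>). Now
  \<open>\<partial>\<Delta>\<^bsup>k-1\<^esup> \<star> \<Delta>\<^sup>l\<close> is the union of the faces of \<open>\<Delta>\<^bsup>k+l\<^esup>\<close> opposite to the vertices below \<open>k\<close>. So \<open>B\<close> exists,
  \<open>X\<^bsub>k+l\<^esub> \<rightarrow> B\<^sub>l\<close> is a cover, and the pullback \<open>P\<close> exists and is formed levelwise.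

  A point of \<open>P\<^sub>l\<close> is therefore a \<open>(k+l)\<close>-simplex of \<open>X\<close> together with a point of \<open>\<Lambda>\<^sup>k\<^sub>k(f)\<close> that
  determines its restriction to \<open>\<partial>\<Delta>\<^bsup>k-1\<^esup> \<star> \<Delta>\<^sup>l\<close> and its image in \<open>Y\<close> by pulling back along the
  collapse \<open>\<Delta>\<^bsup>k-1\<^esup> \<star> \<Delta>\<^sup>l \<rightarrow> \<Delta>\<^bsup>k-1\<^esup> \<star> \<Delta>\<^sup>0\<close>. Because horns are connected, a point of \<open>P\<close> on \<open>\<Lambda>\<^sup>m\<^sub>i\<close>
  involves a single point of \<open>\<Lambda>\<^sup>k\<^sub>k(f)\<close>; it amounts to a point of \<open>X\<close> on \<open>\<Delta>\<^bsup>k-1\<^esup> \<star> \<Lambda>\<^sup>m\<^sub>i\<close> that agrees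
  with the prescribed values on \<open>\<partial>\<Delta>\<^bsup>k-1\<^esup> \<star> \<Lambda>\<^sup>m\<^sub>i\<close>. Gluing in the prescribed values on all of
  \<open>\<partial>\<Delta>\<^bsup>k-1\<^esup> \<star> \<Delta>\<^sup>m\<close> gives a point on the union of both complexes, and this union is the horn
  \<open>\<Lambda>\<^bsup>k+m\<^esup>\<^bsub>k+i\<^esub>\<close>. So filling \<open>\<Lambda>\<^sup>m\<^sub>i\<close> in \<open>P\<close> is the same as filling \<open>\<Lambda>\<^bsup>k+m\<^esup>\<^bsub>k+i\<^esub>\<close> relative to \<open>f\<close>
  (\<open>covering_horn\<close>): the fillings are covering, and unique when \<open>k + m > n\<close>. The horn limits of \<open>P\<close>
  exist by the same argument about unions of faces, applied to the map from \<open>P\<close> to the terminal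
  object.
\<close>

section \<open>Unions of faces of the standard simplex\<close>

\<comment> \<open>The list \<open>[0..<Suc n]\<close> is the identity operator of \<open>[n]\<close> and must not be unfolded.\<close>
declare upt_Suc [simp del]

lemma ops_iff: "\<theta> \<in> ops m n \<longleftrightarrow> length \<theta> = Suc m \<and> sorted \<theta> \<and> (\<forall>j \<in> set \<theta>. j \<le> n)"
  unfolding ops_def by auto

lemma simplex_iff: "\<sigma> \<in> simplex N \<longleftrightarrow> \<sigma> \<noteq> [] \<and> sorted \<sigma> \<and> (\<forall>j \<in> set \<sigma>. j \<le> N)"
  unfolding simplex_def by (cases \<sigma>) (auto simp: ops_iff)

lemma simplex_ops: "\<sigma> \<in> simplex N \<Longrightarrow> \<sigma> \<in> ops (sdim \<sigma>) N"
  by (cases \<sigma>) (auto simp: simplex_iff ops_iff sdim_def)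

lemma ops_simplex: "\<theta> \<in> ops m N \<Longrightarrow> \<theta> \<in> simplex N"
  unfolding simplex_def by auto

lemma sdim_ops: "\<theta> \<in> ops m n \<Longrightarrow> sdim \<theta> = m"
  by (simp add: ops_iff sdim_def)

lemma id_ops [simp]: "[0..<Suc n] \<in> ops n n"
  by (auto simp: ops_iff)

lemma id_simplex [simp]: "[0..<Suc n] \<in> simplex n"
  by (rule ops_simplex[OF id_ops])

lemma sdim_id [simp]: "sdim [0..<Suc n] = n"
  by (simp add: sdim_def)

lemma sdim_op_comp [simp]: "sdim (op_comp \<tau> \<theta>) = sdim \<theta>"
  by (simp add: sdim_def op_comp_def)

lemma sdim_map [simp]: "sdim (map g \<sigma>) = sdim \<sigma>"
  by (simp add: sdim_def)

lemma set_op_comp: "set (op_comp \<tau> \<theta>) = (!) \<tau> ` set \<theta>"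
  by (simp add: op_comp_def)

lemma op_comp_ops: "\<theta> \<in> ops m n \<Longrightarrow> \<phi> \<in> ops l m \<Longrightarrow> op_comp \<theta> \<phi> \<in> ops l n"
  by (auto simp: ops_iff op_comp_def sorted_map intro!: sorted_wrt_mono_rel[of \<phi> "(\<le>)"] sorted_nth_mono)

lemma op_comp_simplex: "\<tau> \<in> ops r N \<Longrightarrow> \<theta> \<in> simplex r \<Longrightarrow> op_comp \<tau> \<theta> \<in> simplex N"
  by (meson op_comp_ops ops_simplex simplex_ops)

lemma op_comp_assoc:
  "\<phi> \<in> ops l m \<Longrightarrow> \<psi> \<in> ops h l \<Longrightarrow> op_comp (op_comp \<theta> \<phi>) \<psi> = op_comp \<theta> (op_comp \<phi> \<psi>)"
  by (auto simp: ops_iff op_comp_def)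

lemma op_comp_id_left: "\<phi> \<in> ops m n \<Longrightarrow> op_comp [0..<Suc n] \<phi> = \<phi>"
  by (auto simp: ops_iff op_comp_def nth_upt le_imp_less_Suc simp del: upt_Suc intro!: map_idI)

lemma op_comp_id_right: "\<theta> \<in> ops m n \<Longrightarrow> op_comp \<theta> [0..<Suc m] = \<theta>"
  unfolding ops_iff op_comp_def by (metis map_nth)

definition subcomplex :: "nat \<Rightarrow> nat list set \<Rightarrow> bool" where
  "subcomplex N S \<longleftrightarrow> S \<subseteq> simplex N \<and> (\<forall>\<sigma> \<in> S. \<forall>m. \<forall>\<theta> \<in> ops m (sdim \<sigma>). op_comp \<sigma> \<theta> \<in> S)"

lemma subcomplexD:
  assumes "subcomplex N S" "\<sigma> \<in> S"
  shows "\<sigma> \<in> simplex N" "\<sigma> \<in> ops (sdim \<sigma>) N" "\<theta> \<in> ops m (sdim \<sigma>) \<Longrightarrow> op_comp \<sigma> \<theta> \<in> S"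
  using assms simplex_ops unfolding subcomplex_def by auto

text \<open>
  Unions of faces are indexed by the sets \<open>J\<close> of opposite vertices. Horns, boundaries joined with a
  simplex, and all intermediate stages of the induction on \<open>J\<close> are of this form.
\<close>

definition faces :: "nat \<Rightarrow> nat set \<Rightarrow> nat list set" where
  "faces N J = {\<sigma> \<in> simplex N. \<exists>j \<in> J. j \<notin> set \<sigma>}"

lemma horn_eq_faces: "horn k i = faces k ({..k} - {i})"
  unfolding horn_def faces_def by auto

lemma set_op_comp_subset: "\<sigma> \<in> simplex N \<Longrightarrow> \<theta> \<in> ops m (sdim \<sigma>) \<Longrightarrow> set (op_comp \<sigma> \<theta>) \<subseteq> set \<sigma>"
  by (cases "length \<sigma>") (auto simp: set_op_comp ops_iff sdim_def simplex_iff less_Suc_eq_le intro!: nth_mem)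

lemma faces_subset: "faces N J \<subseteq> simplex N"
  unfolding faces_def by blast

lemma horn_subset: "horn k i \<subseteq> simplex k"
  unfolding horn_def by blast

lemma subcomplex_simplex: "subcomplex N (simplex N)"
  unfolding subcomplex_def using op_comp_ops ops_simplex simplex_ops by blast

lemma subcomplex_faces: "subcomplex N (faces N J)"
  unfolding subcomplex_def faces_def
  using subcomplexD(3)[OF subcomplex_simplex] set_op_comp_subset by (safe; blast)

lemma subcomplex_horn: "subcomplex m (horn m i)"
  unfolding horn_eq_faces by (rule subcomplex_faces)

definition coface :: "nat \<Rightarrow> nat \<Rightarrow> nat list" where
  "coface M j = map (\<lambda>i. if i < j then i else Suc i) [0..<Suc M]"

lemma nth_coface: "i \<le> M \<Longrightarrow> coface M j ! i = (if i < j then i else Suc i)"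
  by (simp add: coface_def nth_append)

lemma coface_ops: "coface M j \<in> ops M (Suc M)"
  by (auto simp: ops_iff coface_def sorted_iff_nth_mono)

lemma distinct_coface: "distinct (coface M j)"
  by (auto simp: coface_def distinct_map inj_on_def split: if_splits)

lemma image_coface:
  assumes "j \<le> Suc M"
  shows "op_comp (coface M j) ` simplex M = {\<sigma> \<in> simplex (Suc M). j \<notin> set \<sigma>}"
proof (intro set_eqI iffI)
  fix \<sigma> assume "\<sigma> \<in> op_comp (coface M j) ` simplex M"
  then obtain \<theta> where t: "\<theta> \<in> simplex M" "\<sigma> = op_comp (coface M j) \<theta>" by auto
  have "j \<notin> set \<sigma>"
  proof
    assume "j \<in> set \<sigma>"
    then obtain i where "i \<in> set \<theta>" "coface M j ! i = j" using t by (auto simp: set_op_comp)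
    moreover have "i \<le> M" using t calculation by (auto simp: simplex_iff)
    ultimately show False by (auto simp: nth_coface split: if_splits)
  qed
  then show "\<sigma> \<in> {\<sigma> \<in> simplex (Suc M). j \<notin> set \<sigma>}"
    using t op_comp_simplex[OF coface_ops] by auto
next
  fix \<sigma> assume s: "\<sigma> \<in> {\<sigma> \<in> simplex (Suc M). j \<notin> set \<sigma>}"
  define \<theta> where "\<theta> = map (\<lambda>i. if i < j then i else i - 1) \<sigma>"
  have "\<theta> \<in> simplex M"
    using s assms unfolding \<theta>_def
    by (auto simp: simplex_iff sorted_map intro!: sorted_wrt_mono_rel[of \<sigma> "(\<le>)"])
  moreover have "op_comp (coface M j) \<theta> = \<sigma>"
  proof -
    have "coface M j ! (if i < j then i else i - 1) = i" if "i \<in> set \<sigma>" for i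
    proof -
      have "i \<noteq> j" "i \<le> Suc M" using that s by (auto simp: simplex_iff)
      then show ?thesis using assms by (auto simp: nth_coface)
    qed
    then show ?thesis unfolding op_comp_def \<theta>_def by (auto simp: map_idI)
  qed
  ultimately show "\<sigma> \<in> op_comp (coface M j) ` simplex M" by force
qed

lemma faces_insert:
  "j \<le> Suc M \<Longrightarrow> faces (Suc M) (insert j J) = faces (Suc M) J \<union> op_comp (coface M j) ` simplex M"
  unfolding image_coface faces_def by auto

lemma faces_empty: "faces N {} = {}"
  by (simp add: faces_def)

text \<open>
  The face opposite to \<open>j\<close>, identified with \<open>\<Delta>\<^sup>M\<close>, meets a union of other faces again in a union of
  faces. This makes adding a face a pushout along an inclusion one dimension lower.
\<close>

lemma coface_faces_iff:
  assumes "\<theta> \<in> simplex M"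
    and "J \<subseteq> {..Suc M}" "j \<notin> J" "j \<le> Suc M"
  shows "op_comp (coface M j) \<theta> \<in> faces (Suc M) J \<longleftrightarrow> \<theta> \<in> faces M {i. i \<le> M \<and> coface M j ! i \<in> J}"
proof -
  have t: "\<And>i. i \<in> set \<theta> \<Longrightarrow> i \<le> M" using assms by (auto simp: simplex_iff)
  have inj: "coface M j ! i = coface M j ! i' \<longleftrightarrow> i = i'" if "i \<le> M" "i' \<le> M" for i i'
    using that by (auto simp: nth_coface)
  have sur: "\<exists>i' \<le> M. i = coface M j ! i'" if "i \<in> J" for i
  proof -
    have "i \<noteq> j" "i \<le> Suc M" using that assms by auto
    then show ?thesis using assms
      by (intro exI[of _ "if i < j then i else i - 1"]) (auto simp: nth_coface)
  qed
  have "(\<exists>i \<in> J. i \<notin> set (op_comp (coface M j) \<theta>)) \<longleftrightarrow>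
      (\<exists>i' \<in> {i. i \<le> M \<and> coface M j ! i \<in> J}. i' \<notin> set \<theta>)"
    unfolding set_op_comp using sur inj t
    by (smt (verit, del_insts) image_iff mem_Collect_eq)
  then show ?thesis
    unfolding faces_def using assms op_comp_simplex[OF coface_ops] by auto
qed

text \<open>
  The index set of that intersection is again neither empty nor everything, so that the induction
  hypothesis on \<open>M\<close> applies to it.
\<close>

lemma coface_preimage_proper:
  assumes "J \<subseteq> {..Suc M}" "j \<notin> J" "j \<le> Suc M" "J \<noteq> {}" "insert j J \<noteq> {..Suc M}"
  shows "{i. i \<le> M \<and> coface M j ! i \<in> J} \<noteq> {}" "{i. i \<le> M \<and> coface M j ! i \<in> J} \<noteq> {..M}"
proof -
  have sur: "\<exists>i' \<le> M. i = coface M j ! i'" if "i \<le> Suc M" "i \<noteq> j" for i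
    using that assms(3)
    by (intro exI[of _ "if i < j then i else i - 1"]) (auto simp: nth_coface)
  obtain i where "i \<in> J" using assms by auto
  then obtain i' where "i' \<le> M" "coface M j ! i' \<in> J" using sur[of i] assms by force
  then show "{i. i \<le> M \<and> coface M j ! i \<in> J} \<noteq> {}" by auto
  obtain h where "h \<le> Suc M" "h \<noteq> j" "h \<notin> J" using assms by auto
  then obtain h' where "h' \<le> M" "coface M j ! h' \<notin> J" using sur[of h] by force
  then show "{i. i \<le> M \<and> coface M j ! i \<in> J} \<noteq> {..M}" by auto
qed

section \<open>Points and their extensions\<close>

context category
begin

text \<open>
  The rules of a category with the arrows before the objects, so that arrows already known
  determine the objects when a rule is instantiated with \<open>OF\<close>.
\<close>

lemma comp_hom:
  "\<lbrakk>f \<in> Hom C X Y; g \<in> Hom C Y Z; X \<in> Ob C; Y \<in> Ob C; Z \<in> Ob C\<rbrakk> \<Longrightarrow> g \<cdot> f \<in> Hom C X Z"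
  by (rule Comp_in_Hom)

lemma assoc:
  "\<lbrakk>f \<in> Hom C W X; g \<in> Hom C X Y; h \<in> Hom C Y Z; W \<in> Ob C; X \<in> Ob C; Y \<in> Ob C; Z \<in> Ob C\<rbrakk>
    \<Longrightarrow> (h \<cdot> g) \<cdot> f = h \<cdot> (g \<cdot> f)"
  by (rule Comp_assoc)

lemma is_pullbackD:
  assumes "is_pullback C A B D f g P p q"
  shows "A \<in> Ob C" "B \<in> Ob C" "D \<in> Ob C" "P \<in> Ob C"
    "f \<in> Hom C A D" "g \<in> Hom C B D" "p \<in> Hom C P A" "q \<in> Hom C P B" "f \<cdot> p = g \<cdot> q"
    "\<lbrakk>U \<in> Ob C; a \<in> Hom C U A; b \<in> Hom C U B; f \<cdot> a = g \<cdot> b\<rbrakk>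
      \<Longrightarrow> \<exists>!u. u \<in> Hom C U P \<and> p \<cdot> u = a \<and> q \<cdot> u = b"
  using assms unfolding is_pullback_def by blast+

lemma pullback_eqI:
  assumes "is_pullback C A B D f g P p q" "U \<in> Ob C" "u \<in> Hom C U P" "v \<in> Hom C U P"
    and "p \<cdot> u = p \<cdot> v" "q \<cdot> u = q \<cdot> v"
  shows "u = v"
proof -
  note pb = is_pullbackD[OF assms(1)]
  have "f \<cdot> (p \<cdot> v) = g \<cdot> (q \<cdot> v)"
    using assoc[OF assms(4) pb(7,5)] assoc[OF assms(4) pb(8,6)] pb(1-4,9) assms(2) by simp
  moreover have "p \<cdot> v \<in> Hom C U A" "q \<cdot> v \<in> Hom C U B"
    using comp_hom[OF assms(4) pb(7)] comp_hom[OF assms(4) pb(8)] pb(1-4) assms(2) by auto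
  ultimately show ?thesis using pb(10)[of U "p \<cdot> v" "q \<cdot> v"] assms by metis
qed

end

text \<open>
  Structure maps are used through their action on \<open>U\<close>-valued points \<open>x : U \<rightarrow> X\<^sub>n\<close>; \<open>act_act\<close> is the
  functoriality and \<open>act_pre\<close> the naturality in \<open>U\<close> of this action.
\<close>

locale simplicial_obj = category C for C :: "('o, 'm) cat" (structure) +
  fixes X :: "('o, 'm) sobj"
  assumes simplicial_object: "simplicial_object C X"
begin

lemma lev_Ob [simp]: "lev X n \<in> Ob C"
  using simplicial_object unfolding simplicial_object_def by blast

lemma act_hom: "\<theta> \<in> ops m n \<Longrightarrow> act X n \<theta> \<in> Hom C (lev X n) (lev X m)"
  using simplicial_object unfolding simplicial_object_def by blast

lemma act_pt: "\<lbrakk>\<theta> \<in> ops m n; x \<in> Hom C U (lev X n); U \<in> Ob C\<rbrakk> \<Longrightarrow> act X n \<theta> \<cdot> x \<in> Hom C U (lev X m)"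
  by (rule comp_hom[where Y = "lev X n"]) (simp_all add: act_hom)

lemma act_pre:
  "\<lbrakk>\<theta> \<in> ops m n; x \<in> Hom C U (lev X n); u \<in> Hom C V U; U \<in> Ob C; V \<in> Ob C\<rbrakk>
    \<Longrightarrow> (act X n \<theta> \<cdot> x) \<cdot> u = act X n \<theta> \<cdot> (x \<cdot> u)"
  by (rule assoc[where W = V and X = U and Y = "lev X n" and Z = "lev X m"]) (simp_all add: act_hom)

lemma act_act:
  assumes "\<theta> \<in> ops m n" "\<phi> \<in> ops l m" "x \<in> Hom C U (lev X n)" "U \<in> Ob C"
  shows "act X m \<phi> \<cdot> (act X n \<theta> \<cdot> x) = act X n (op_comp \<theta> \<phi>) \<cdot> x"
proof -
  have "act X n (op_comp \<theta> \<phi>) = act X m \<phi> \<cdot> act X n \<theta>"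
    using simplicial_object assms unfolding simplicial_object_def by blast
  then show ?thesis
    using assoc[OF assms(3) act_hom[OF assms(1)] act_hom[OF assms(2)]] assms by simp
qed

lemma act_Id: "act X n [0..<Suc n] = Id C (lev X n)"
  using simplicial_object unfolding simplicial_object_def by blast

lemma act_id: "\<lbrakk>x \<in> Hom C U (lev X n); U \<in> Ob C\<rbrakk> \<Longrightarrow> act X n [0..<Suc n] \<cdot> x = x"
  using act_Id Id_Comp by simp

end

lemma hom_pointsD:
  assumes "x \<in> hom_points C S X U" "\<sigma> \<in> S"
  shows "x \<sigma> \<in> Hom C U (lev X (sdim \<sigma>))"
    "\<theta> \<in> ops m (sdim \<sigma>) \<Longrightarrow> x (op_comp \<sigma> \<theta>) = act X (sdim \<sigma>) \<theta> \<cdot>\<^bsub>C\<^esub> x \<sigma>"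
  using assms unfolding hom_points_def by auto

lemma hom_points_mono: "\<lbrakk>x \<in> hom_points C S' X U; S \<subseteq> S'\<rbrakk> \<Longrightarrow> x \<in> hom_points C S X U"
  unfolding hom_points_def by blast

text \<open>
  Points of \<open>hom(S, X)\<close> can be restricted along any operator \<open>\<tau>\<close> that maps \<open>T\<close> into \<open>S\<close>, injective or
  not. Degenerate \<open>\<tau>\<close> occur when a point is spread out along a collapse.
\<close>

lemma hom_points_pull:
  assumes "x \<in> hom_points C S X U" "subcomplex r T" "\<tau> \<in> ops r N" "\<And>\<theta>. \<theta> \<in> T \<Longrightarrow> op_comp \<tau> \<theta> \<in> S"
  shows "(\<lambda>\<theta>. x (op_comp \<tau> \<theta>)) \<in> hom_points C T X U"
  unfolding hom_points_def
proof (safe)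
  fix \<theta> assume t: "\<theta> \<in> T"
  show "x (op_comp \<tau> \<theta>) \<in> Hom C U (lev X (sdim \<theta>))"
    using hom_pointsD(1)[OF assms(1) assms(4)[OF t]] by simp
  fix m \<phi> assume "\<phi> \<in> ops m (sdim \<theta>)"
  then show "x (op_comp \<tau> (op_comp \<theta> \<phi>)) = act X (sdim \<theta>) \<phi> \<cdot>\<^bsub>C\<^esub> x (op_comp \<tau> \<theta>)"
    using hom_pointsD(2)[OF assms(1) assms(4)[OF t], of \<phi> m] subcomplexD(2)[OF assms(2) t]
    by (simp add: op_comp_assoc)
qed

lemma hom_points_cong:
  assumes "x \<in> hom_points C S X U" "subcomplex N S" "\<And>\<sigma>. \<sigma> \<in> S \<Longrightarrow> x' \<sigma> = x \<sigma>"
  shows "x' \<in> hom_points C S X U"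
  using assms subcomplexD(3)[OF assms(2)] unfolding hom_points_def by auto

context simplicial_obj
begin

lemma hom_points_act:
  assumes "t \<in> Hom C U (lev X N)" "U \<in> Ob C" "S \<subseteq> simplex N"
  shows "(\<lambda>\<sigma>. act X N \<sigma> \<cdot> t) \<in> hom_points C S X U"
  unfolding hom_points_def
  using assms by (auto simp: act_pt simplex_ops subset_iff act_act)

text \<open>
  The Yoneda lemma: a cone over all simplices of \<open>\<Delta>\<^sup>N\<close> is determined by its value at the top simplex.
\<close>

lemma hom_points_simplex:
  assumes "x \<in> hom_points C (simplex N) X U" "\<sigma> \<in> simplex N"
  shows "x \<sigma> = act X N \<sigma> \<cdot> x [0..<Suc N]"
  using hom_pointsD(2)[OF assms(1) id_simplex, of \<sigma> "sdim \<sigma>"] simplex_ops[OF assms(2)]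
  by (simp add: op_comp_id_left)

lemma hom_points_pre:
  assumes "x \<in> hom_points C S X U" "u \<in> Hom C V U" "U \<in> Ob C" "V \<in> Ob C"
  shows "(\<lambda>\<sigma>. x \<sigma> \<cdot> u) \<in> hom_points C S X V"
  unfolding hom_points_def
proof (safe)
  fix \<sigma> assume s: "\<sigma> \<in> S"
  show "x \<sigma> \<cdot> u \<in> Hom C V (lev X (sdim \<sigma>))"
    using comp_hom[OF assms(2) hom_pointsD(1)[OF assms(1) s]] assms by simp
  fix m \<theta> assume t: "\<theta> \<in> ops m (sdim \<sigma>)"
  show "x (op_comp \<sigma> \<theta>) \<cdot> u = act X (sdim \<sigma>) \<theta> \<cdot> (x \<sigma> \<cdot> u)"
    using hom_pointsD(2)[OF assms(1) s t] act_pre[OF t hom_pointsD(1)[OF assms(1) s] assms(2)] assms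
    by simp
qed

end

locale simplicial_map = category C for C :: "('o, 'm) cat" (structure) +
  fixes X Y :: "('o, 'm) sobj" and f :: "nat \<Rightarrow> 'm"
  assumes X_simplicial: "simplicial_object C X"
    and Y_simplicial: "simplicial_object C Y"
    and simplicial_map: "f \<in> simplicial_maps C X Y"
begin

sublocale X: simplicial_obj C X
  by unfold_locales (rule X_simplicial)

sublocale Y: simplicial_obj C Y
  by unfold_locales (rule Y_simplicial)

lemma map_hom: "f n \<in> Hom C (lev X n) (lev Y n)"
  using simplicial_map unfolding simplicial_maps_def by blast

lemma map_pt: "\<lbrakk>x \<in> Hom C U (lev X n); U \<in> Ob C\<rbrakk> \<Longrightarrow> f n \<cdot> x \<in> Hom C U (lev Y n)"
  by (rule comp_hom[where Y = "lev X n"]) (simp_all add: map_hom)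

lemma map_pre:
  "\<lbrakk>x \<in> Hom C U (lev X n); u \<in> Hom C V U; U \<in> Ob C; V \<in> Ob C\<rbrakk> \<Longrightarrow> (f n \<cdot> x) \<cdot> u = f n \<cdot> (x \<cdot> u)"
  by (rule assoc[where W = V and X = U and Y = "lev X n" and Z = "lev Y n"]) (simp_all add: map_hom)

lemma map_act:
  assumes "\<theta> \<in> ops m n" "x \<in> Hom C U (lev X n)" "U \<in> Ob C"
  shows "f m \<cdot> (act X n \<theta> \<cdot> x) = act Y n \<theta> \<cdot> (f n \<cdot> x)"
proof -
  have "act Y n \<theta> \<cdot> f n = f m \<cdot> act X n \<theta>"
    using simplicial_map assms unfolding simplicial_maps_def by blast
  then show ?thesis
    using assoc[OF assms(2) map_hom Y.act_hom[OF assms(1)]]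
      assoc[OF assms(2) X.act_hom[OF assms(1)] map_hom] assms by simp
qed

abbreviation pts :: "nat list set \<Rightarrow> nat \<Rightarrow> 'o \<Rightarrow> ((nat list \<Rightarrow> 'm) \<times> 'm) set" where
  "pts S N U \<equiv> rel_hom_points C S N X Y f U"

lemma ptsD:
  assumes "(x, y) \<in> pts S N U"
  shows "x \<in> hom_points C S X U" "y \<in> Hom C U (lev Y N)"
    "\<sigma> \<in> S \<Longrightarrow> f (sdim \<sigma>) \<cdot> x \<sigma> = act Y N \<sigma> \<cdot> y"
    "\<sigma> \<in> S \<Longrightarrow> x \<sigma> \<in> Hom C U (lev X (sdim \<sigma>))"
  using assms hom_pointsD(1) unfolding rel_hom_points_def by auto

lemma ptsI:
  "\<lbrakk>x \<in> hom_points C S X U; y \<in> Hom C U (lev Y N);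
    \<And>\<sigma>. \<sigma> \<in> S \<Longrightarrow> f (sdim \<sigma>) \<cdot> x \<sigma> = act Y N \<sigma> \<cdot> y\<rbrakk> \<Longrightarrow> (x, y) \<in> pts S N U"
  unfolding rel_hom_points_def by auto

lemma pts_mono: "\<lbrakk>(x, y) \<in> pts S' N U; S \<subseteq> S'\<rbrakk> \<Longrightarrow> (x, y) \<in> pts S N U"
  by (rule ptsI) (auto dest: ptsD hom_points_mono)

lemma pts_cong:
  assumes "(x, y) \<in> pts S N U" "subcomplex M S" "\<And>\<sigma>. \<sigma> \<in> S \<Longrightarrow> x' \<sigma> = x \<sigma>"
  shows "(x', y) \<in> pts S N U"
  using ptsD[OF assms(1)] hom_points_cong[OF _ assms(2,3)] assms(3) by (intro ptsI) auto

lemma pts_pull: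
  assumes "(x, y) \<in> pts S N U" "subcomplex r T" "\<tau> \<in> ops r N" "\<And>\<theta>. \<theta> \<in> T \<Longrightarrow> op_comp \<tau> \<theta> \<in> S"
    and "U \<in> Ob C"
  shows "(\<lambda>\<theta>. x (op_comp \<tau> \<theta>), act Y N \<tau> \<cdot> y) \<in> pts T r U"
proof (rule ptsI)
  note p = ptsD[OF assms(1)]
  show "(\<lambda>\<theta>. x (op_comp \<tau> \<theta>)) \<in> hom_points C T X U"
    by (rule hom_points_pull[OF p(1) assms(2,3,4)])
  show "act Y N \<tau> \<cdot> y \<in> Hom C U (lev Y r)"
    by (rule Y.act_pt[OF assms(3) p(2) assms(5)])
  fix \<theta> assume t: "\<theta> \<in> T"
  show "f (sdim \<theta>) \<cdot> x (op_comp \<tau> \<theta>) = act Y r \<theta> \<cdot> (act Y N \<tau> \<cdot> y)"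
    using p(3)[OF assms(4)[OF t]] Y.act_act[OF assms(3) subcomplexD(2)[OF assms(2) t] p(2) assms(5)]
    by simp
qed

lemma pts_pre:
  assumes "(x, y) \<in> pts S N U" "u \<in> Hom C V U" "S \<subseteq> simplex N" "U \<in> Ob C" "V \<in> Ob C"
  shows "(\<lambda>\<sigma>. x \<sigma> \<cdot> u, y \<cdot> u) \<in> pts S N V"
proof (rule ptsI)
  note p = ptsD[OF assms(1)]
  show "(\<lambda>\<sigma>. x \<sigma> \<cdot> u) \<in> hom_points C S X V"
    by (rule X.hom_points_pre[OF p(1) assms(2,4,5)])
  show "y \<cdot> u \<in> Hom C V (lev Y N)"
    using comp_hom[OF assms(2) p(2)] assms by simp
  fix \<sigma> assume s: "\<sigma> \<in> S"
  show "f (sdim \<sigma>) \<cdot> (x \<sigma> \<cdot> u) = act Y N \<sigma> \<cdot> (y \<cdot> u)"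
    using p(3)[OF s] map_pre[OF p(4)[OF s] assms(2)] Y.act_pre[OF simplex_ops p(2) assms(2)] s assms
    by (metis subsetD)
qed

lemma pts_act:
  assumes "t \<in> Hom C U (lev X N)" "U \<in> Ob C" "S \<subseteq> simplex N"
  shows "(\<lambda>\<sigma>. act X N \<sigma> \<cdot> t, f N \<cdot> t) \<in> pts S N U"
  using assms simplex_ops by (intro ptsI X.hom_points_act) (auto intro!: map_pt map_act)

lemma pts_simplex:
  assumes "(x, y) \<in> pts (simplex N) N U" "U \<in> Ob C"
  shows "x [0..<Suc N] \<in> Hom C U (lev X N)" "f N \<cdot> x [0..<Suc N] = y"
  using ptsD(4)[OF assms(1) id_simplex] ptsD(3)[OF assms(1) id_simplex]
    Y.act_id[OF ptsD(2)[OF assms(1)] assms(2)] by auto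

text \<open>
  \<open>P\<close> with \<open>c : P \<rightarrow> W\<close> represents the fibre over the point \<open>(x, y)\<close> of the restriction of points from
  \<open>S'\<close> to \<open>S\<close>, with universal extension \<open>x'\<close>. The component \<open>y\<close> in \<open>Y\<^sub>N\<close> is shared by \<open>S\<close> and \<open>S'\<close>.
  If the limits on \<open>S\<close> and \<open>S'\<close> existed, \<open>P\<close> would be the pullback of the
  limit on \<open>S'\<close> along the arrow from \<open>W\<close> to the limit on \<open>S\<close> classifying \<open>(x, y)\<close>.
\<close>

definition extension ::
  "nat list set \<Rightarrow> nat list set \<Rightarrow> nat \<Rightarrow> 'o \<Rightarrow> (nat list \<Rightarrow> 'm) \<Rightarrow> 'm \<Rightarrow>
   'o \<Rightarrow> 'm \<Rightarrow> (nat list \<Rightarrow> 'm) \<Rightarrow> bool" where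
  "extension S S' N W x y P c x' \<longleftrightarrow>
     P \<in> Ob C \<and> c \<in> Hom C P W \<and> (x', y \<cdot> c) \<in> pts S' N P \<and> (\<forall>\<sigma> \<in> S. x' \<sigma> = x \<sigma> \<cdot> c) \<and>
     (\<forall>U \<in> Ob C. \<forall>u \<in> Hom C U W. \<forall>z. (z, y \<cdot> u) \<in> pts S' N U \<longrightarrow> (\<forall>\<sigma> \<in> S. z \<sigma> = x \<sigma> \<cdot> u) \<longrightarrow>
        (\<exists>!v. v \<in> Hom C U P \<and> c \<cdot> v = u \<and> (\<forall>\<sigma> \<in> S'. x' \<sigma> \<cdot> v = z \<sigma>)))"

lemma extensionD:
  assumes "extension S S' N W x y P c x'"
  shows "P \<in> Ob C" "c \<in> Hom C P W" "(x', y \<cdot> c) \<in> pts S' N P" "\<And>\<sigma>. \<sigma> \<in> S \<Longrightarrow> x' \<sigma> = x \<sigma> \<cdot> c"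
    "\<And>U u z. \<lbrakk>U \<in> Ob C; u \<in> Hom C U W; (z, y \<cdot> u) \<in> pts S' N U; \<And>\<sigma>. \<sigma> \<in> S \<Longrightarrow> z \<sigma> = x \<sigma> \<cdot> u\<rbrakk> \<Longrightarrow>
        \<exists>!v. v \<in> Hom C U P \<and> c \<cdot> v = u \<and> (\<forall>\<sigma> \<in> S'. x' \<sigma> \<cdot> v = z \<sigma>)"
  using assms unfolding extension_def by blast+

lemma extensionI:
  assumes "P \<in> Ob C" "c \<in> Hom C P W" "(x', y \<cdot> c) \<in> pts S' N P" "\<And>\<sigma>. \<sigma> \<in> S \<Longrightarrow> x' \<sigma> = x \<sigma> \<cdot> c"
    "\<And>U u z. \<lbrakk>U \<in> Ob C; u \<in> Hom C U W; (z, y \<cdot> u) \<in> pts S' N U; \<And>\<sigma>. \<sigma> \<in> S \<Longrightarrow> z \<sigma> = x \<sigma> \<cdot> u\<rbrakk> \<Longrightarrow>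
        \<exists>v. v \<in> Hom C U P \<and> c \<cdot> v = u \<and> (\<forall>\<sigma> \<in> S'. x' \<sigma> \<cdot> v = z \<sigma>)"
    "\<And>U v w. \<lbrakk>U \<in> Ob C; v \<in> Hom C U P; w \<in> Hom C U P; c \<cdot> v = c \<cdot> w; \<And>\<sigma>. \<sigma> \<in> S' \<Longrightarrow> x' \<sigma> \<cdot> v = x' \<sigma> \<cdot> w\<rbrakk>
      \<Longrightarrow> v = w"
  shows "extension S S' N W x y P c x'"
  unfolding extension_def
proof (intro conjI ballI allI impI)
  fix U u z
  assume *: "U \<in> Ob C" "u \<in> Hom C U W" "(z, y \<cdot> u) \<in> pts S' N U" "\<forall>\<sigma> \<in> S. z \<sigma> = x \<sigma> \<cdot> u"
  then obtain v where v: "v \<in> Hom C U P \<and> c \<cdot> v = u \<and> (\<forall>\<sigma> \<in> S'. x' \<sigma> \<cdot> v = z \<sigma>)"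
    using assms(5)[OF *(1-3)] by blast
  then show "\<exists>!v. v \<in> Hom C U P \<and> c \<cdot> v = u \<and> (\<forall>\<sigma> \<in> S'. x' \<sigma> \<cdot> v = z \<sigma>)"
    using assms(6)[OF *(1)] by (intro ex1I[of _ v]) auto
qed (use assms in auto)

text \<open>
  Both arrows represent the same extended point over \<open>c \<cdot> v\<close>, so uniqueness for that point applies.
\<close>

lemma extension_eqI:
  assumes "extension S S' N W x y P c x'" "S \<subseteq> S'" "S' \<subseteq> simplex N"
    and "U \<in> Ob C" "W \<in> Ob C" "(x, y) \<in> pts S N W"
    and "v \<in> Hom C U P" "w \<in> Hom C U P" "c \<cdot> v = c \<cdot> w"
    and "\<And>\<sigma>. \<sigma> \<in> S' \<Longrightarrow> x' \<sigma> \<cdot> v = x' \<sigma> \<cdot> w"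
  shows "v = w"
proof -
  note e = extensionD[OF assms(1)]
  note p = ptsD[OF assms(6)]
  have 1: "(y \<cdot> c) \<cdot> v = y \<cdot> (c \<cdot> v)"
    using assoc[OF assms(7) e(2) p(2)] assms e(1) by simp
  have cv: "c \<cdot> v \<in> Hom C U W" using comp_hom[OF assms(7) e(2)] assms e(1,2) by blast
  have 2: "(\<lambda>\<sigma>. x' \<sigma> \<cdot> v, y \<cdot> (c \<cdot> v)) \<in> pts S' N U"
    using pts_pre[OF e(3) assms(7,3) e(1) assms(4)] 1 by simp
  have 3: "x' \<sigma> \<cdot> v = x \<sigma> \<cdot> (c \<cdot> v)" if "\<sigma> \<in> S" for \<sigma>
    using assoc[OF assms(7) e(2) p(4)[OF that]] e(4)[OF that] assms e(1,2) by simp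
  show ?thesis using e(5)[OF assms(4) cv 2 3] assms(7-10) by metis
qed

definition covering :: "('o \<Rightarrow> 'o \<Rightarrow> 'm set) \<Rightarrow> nat list set \<Rightarrow> nat list set \<Rightarrow> nat \<Rightarrow> bool" where
  "covering K S S' N \<longleftrightarrow>
     (\<forall>W \<in> Ob C. \<forall>x y. (x, y) \<in> pts S N W \<longrightarrow>
        (\<exists>P c x'. extension S S' N W x y P c x' \<and> c \<in> K P W))"

lemma coveringD:
  assumes "covering K S S' N" "W \<in> Ob C" "(x, y) \<in> pts S N W"
  obtains P c x' where "extension S S' N W x y P c x'" "c \<in> K P W"
  using assms unfolding covering_def by blast

end

section \<open>Covering inclusions\<close>

text \<open>
  The two instances are the covers and the isomorphisms. Treating them together proves the covering
  and the isomorphism statements about horns at once.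
\<close>

locale cover_class = category C for C :: "('o, 'm) cat" (structure) +
  fixes K :: "'o \<Rightarrow> 'o \<Rightarrow> 'm set"
  assumes K_Comp:
      "\<lbrakk>X \<in> Ob C; Y \<in> Ob C; Z \<in> Ob C; f \<in> K X Y; g \<in> K Y Z\<rbrakk> \<Longrightarrow> g \<cdot> f \<in> K X Z"
    and K_iso: "\<lbrakk>X \<in> Ob C; Y \<in> Ob C; is_iso C X Y f\<rbrakk> \<Longrightarrow> f \<in> K X Y"
    and K_pullback:
      "\<lbrakk>A \<in> Ob C; B \<in> Ob C; D \<in> Ob C; f \<in> K A D; g \<in> Hom C B D\<rbrakk>
        \<Longrightarrow> \<exists>P p q. is_pullback C A B D f g P p q \<and> q \<in> K P B"

locale simplicial_map_covers = simplicial_map C X Y f + cover_class C K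
  for C :: "('o, 'm) cat" (structure) and X Y :: "('o, 'm) sobj" and f :: "nat \<Rightarrow> 'm"
    and K :: "'o \<Rightarrow> 'o \<Rightarrow> 'm set"
begin

text \<open>
  The representing objects are stacked: first \<open>P1\<close> over \<open>W\<close>, which carries a universal point on \<open>S'\<close>,
  then \<open>P2\<close> over \<open>P1\<close>.
\<close>

lemma covering_trans:
  assumes "covering K S S' N" "covering K S' S'' N" "S \<subseteq> S'" "S' \<subseteq> S''" "S'' \<subseteq> simplex N"
  shows "covering K S S'' N"
  unfolding covering_def
proof (intro ballI allI impI)
  fix W x y assume W: "W \<in> Ob C" and xy: "(x, y) \<in> pts S N W"
  obtain P1 c1 x1 where e1: "extension S S' N W x y P1 c1 x1" "c1 \<in> K P1 W"
    using coveringD[OF assms(1) W xy] .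
  note d1 = extensionD[OF e1(1)]
  obtain P2 c2 x2 where e2: "extension S' S'' N P1 x1 (y \<cdot> c1) P2 c2 x2" "c2 \<in> K P2 P1"
    using coveringD[OF assms(2) d1(1) d1(3)] .
  note d2 = extensionD[OF e2(1)]
  note y = ptsD(2)[OF xy]
  have yc: "(y \<cdot> c1) \<cdot> v = y \<cdot> (c1 \<cdot> v)" if "v \<in> Hom C U P1" "U \<in> Ob C" for U v
    using assoc[OF that(1) d1(2) y] that d1(1,2) W by simp
  have cc: "(c1 \<cdot> c2) \<cdot> v = c1 \<cdot> (c2 \<cdot> v)" if "v \<in> Hom C U P2" "U \<in> Ob C" for U v
    using assoc[OF that(1) d2(2) d1(2)] that d1(1,2) d2(1,2) W by simp
  have xc: "(x \<sigma> \<cdot> c1) \<cdot> v = x \<sigma> \<cdot> (c1 \<cdot> v)" if "\<sigma> \<in> S" "v \<in> Hom C U P1" "U \<in> Ob C" for U v \<sigma>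
    using assoc[OF that(2) d1(2) ptsD(4)[OF xy that(1)]] that d1(1,2) W by simp
  have x1c: "x2 \<sigma> \<cdot> v = x1 \<sigma> \<cdot> (c2 \<cdot> v)" if "\<sigma> \<in> S'" "v \<in> Hom C U P2" "U \<in> Ob C" for U v \<sigma>
    using assoc[OF that(2) d2(2) ptsD(4)[OF d1(3) that(1)]] d2(4)[OF that(1)] that d1(1,2) d2(1,2) W by simp
  have "extension S S'' N W x y P2 (c1 \<cdot> c2) x2"
  proof (rule extensionI)
    show "P2 \<in> Ob C" by (rule d2)
    show "c1 \<cdot> c2 \<in> Hom C P2 W" using comp_hom[OF d2(2) d1(2)] d1(1,2) d2(1,2) W by blast
    show "(x2, y \<cdot> (c1 \<cdot> c2)) \<in> pts S'' N P2" using d2(3) yc[OF d2(2) d2(1)] by simp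
    show "x2 \<sigma> = x \<sigma> \<cdot> (c1 \<cdot> c2)" if "\<sigma> \<in> S" for \<sigma>
      using d2(4)[of \<sigma>] d1(4)[OF that] that assms(3) xc[OF that d2(2) d2(1)] by auto
  next
    fix U u z
    assume *: "U \<in> Ob C" "u \<in> Hom C U W" "(z, y \<cdot> u) \<in> pts S'' N U" "\<And>\<sigma>. \<sigma> \<in> S \<Longrightarrow> z \<sigma> = x \<sigma> \<cdot> u"
    obtain v1 where v1: "v1 \<in> Hom C U P1" "c1 \<cdot> v1 = u" "\<And>\<sigma>. \<sigma> \<in> S' \<Longrightarrow> x1 \<sigma> \<cdot> v1 = z \<sigma>"
      using d1(5)[OF *(1,2) pts_mono[OF *(3) assms(4)] *(4)] by blast
    have "(z, (y \<cdot> c1) \<cdot> v1) \<in> pts S'' N U" using *(3) v1(2) yc[OF v1(1) *(1)] by simp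
    then obtain v where v: "v \<in> Hom C U P2" "c2 \<cdot> v = v1" "\<forall>\<sigma>\<in>S''. x2 \<sigma> \<cdot> v = z \<sigma>"
      using d2(5)[OF *(1) v1(1) _ v1(3)[symmetric]] by blast
    then show "\<exists>v. v \<in> Hom C U P2 \<and> c1 \<cdot> c2 \<cdot> v = u \<and> (\<forall>\<sigma>\<in>S''. x2 \<sigma> \<cdot> v = z \<sigma>)"
      using cc[OF v(1) *(1)] v1 by auto
  next
    fix U v w
    assume *: "U \<in> Ob C" "v \<in> Hom C U P2" "w \<in> Hom C U P2" "c1 \<cdot> c2 \<cdot> v = c1 \<cdot> c2 \<cdot> w"
      "\<And>\<sigma>. \<sigma> \<in> S'' \<Longrightarrow> x2 \<sigma> \<cdot> v = x2 \<sigma> \<cdot> w"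
    have h: "c2 \<cdot> v \<in> Hom C U P1" "c2 \<cdot> w \<in> Hom C U P1"
      using comp_hom[OF *(2) d2(2)] comp_hom[OF *(3) d2(2)] * d1(1,2) d2(1,2) by auto
    have "c2 \<cdot> v = c2 \<cdot> w"
    proof (rule extension_eqI[OF e1(1) assms(3) _ *(1) W xy h])
      show "S' \<subseteq> simplex N" using assms by auto
      show "c1 \<cdot> (c2 \<cdot> v) = c1 \<cdot> (c2 \<cdot> w)" using * cc by simp
      show "x1 \<sigma> \<cdot> (c2 \<cdot> v) = x1 \<sigma> \<cdot> (c2 \<cdot> w)" if "\<sigma> \<in> S'" for \<sigma>
        using x1c[OF that *(2,1)] x1c[OF that *(3,1)] *(5) that assms(4) by auto
    qed
    then show "v = w"
      using extension_eqI[OF e2(1) assms(4,5) *(1) d1(1) d1(3) *(2,3)] *(5) by blast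
  qed
  moreover have "c1 \<cdot> c2 \<in> K P2 W" using K_Comp[OF d2(1) d1(1) W e2(2) e1(2)] by simp
  ultimately show "\<exists>P c x'. extension S S'' N W x y P c x' \<and> c \<in> K P W" by blast
qed

text \<open>
  If \<open>\<Delta>\<^sup>r\<close> is attached to \<open>S\<close> along \<open>T\<close>, then extending a point from \<open>S\<close> to the union is the same as
  extending its restriction along \<open>\<tau>\<close> from \<open>T\<close> to \<open>\<Delta>\<^sup>r\<close>. The same representing object therefore serves
  for both problems.
\<close>

lemma covering_pushout:
  assumes T: "covering K T (simplex r) r" "subcomplex r T"
    and tau: "\<tau> \<in> ops r N" "distinct \<tau>"
    and S: "subcomplex N S" "\<And>\<theta>. \<theta> \<in> simplex r \<Longrightarrow> op_comp \<tau> \<theta> \<in> S \<longleftrightarrow> \<theta> \<in> T"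
  shows "covering K S (S \<union> op_comp \<tau> ` simplex r) N"
  unfolding covering_def
proof (intro ballI allI impI)
  fix W x y assume W: "W \<in> Ob C" and xy: "(x, y) \<in> pts S N W"
  let ?S' = "S \<union> op_comp \<tau> ` simplex r"
  have TS: "T \<subseteq> simplex r" using T(2) unfolding subcomplex_def by blast
  note p = ptsD[OF xy]
  have inj: "\<theta> = \<theta>'" if "\<theta> \<in> simplex r" "\<theta>' \<in> simplex r" "op_comp \<tau> \<theta> = op_comp \<tau> \<theta>'" for \<theta> \<theta>'
  proof -
    have "inj_on ((!) \<tau>) (set \<theta> \<union> set \<theta>')"
      using that tau by (intro inj_on_nth) (auto simp: simplex_iff ops_iff less_Suc_eq_le)
    then show ?thesis using that(3) unfolding op_comp_def by (rule map_inj_on[rotated])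
  qed
  have xt: "(\<lambda>\<theta>. x (op_comp \<tau> \<theta>), act Y N \<tau> \<cdot> y) \<in> pts T r W"
    using S(2) TS by (intro pts_pull[OF xy T(2) tau(1) _ W]) auto
  obtain P c x1 where e: "extension T (simplex r) r W (\<lambda>\<theta>. x (op_comp \<tau> \<theta>)) (act Y N \<tau> \<cdot> y) P c x1"
    "c \<in> K P W"
    using coveringD[OF T(1) W xt] .
  note d = extensionD[OF e(1)]
  \<comment> \<open>The two parts of the union agree on their overlap, so the choice of priority is immaterial.\<close>
  define x' where "x' \<sigma> = (if \<sigma> \<in> S then x \<sigma> \<cdot> c else x1 (THE \<theta>. \<theta> \<in> simplex r \<and> op_comp \<tau> \<theta> = \<sigma>))" for \<sigma>
  have x'S: "x' \<sigma> = x \<sigma> \<cdot> c" if "\<sigma> \<in> S" for \<sigma> using that by (simp add: x'_def)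
  have x'1: "x' (op_comp \<tau> \<theta>) = x1 \<theta>" if "\<theta> \<in> simplex r" for \<theta>
  proof (cases "\<theta> \<in> T")
    case True
    then show ?thesis using d(4)[OF True] S(2)[OF that] by (simp add: x'_def)
  next
    case False
    moreover have "(THE \<theta>'. \<theta>' \<in> simplex r \<and> op_comp \<tau> \<theta>' = op_comp \<tau> \<theta>) = \<theta>"
      using that inj by blast
    ultimately show ?thesis using S(2)[OF that] by (simp add: x'_def)
  qed
  have yc: "y \<cdot> c \<in> Hom C P (lev Y N)" using comp_hom[OF d(2) p(2)] d(1,2) W by simp
  have xcP: "(\<lambda>\<sigma>. x \<sigma> \<cdot> c, y \<cdot> c) \<in> pts S N P"
    using pts_pre[OF xy d(2) _ W d(1)] subcomplexD(1)[OF S(1)] by blast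
  note pc = ptsD[OF xcP] and p1 = ptsD[OF d(3)]
  have x'P: "(x', y \<cdot> c) \<in> pts ?S' N P"
  proof (rule ptsI)
    show "x' \<in> hom_points C ?S' X P"
      unfolding hom_points_def
    proof safe
      fix \<sigma> assume s: "\<sigma> \<in> S"
      show "x' \<sigma> \<in> Hom C P (lev X (sdim \<sigma>))" using x'S pc(4) s by simp
      fix m \<phi> assume "\<phi> \<in> ops m (sdim \<sigma>)"
      then show "x' (op_comp \<sigma> \<phi>) = act X (sdim \<sigma>) \<phi> \<cdot> x' \<sigma>"
        using x'S s subcomplexD(3)[OF S(1) s] hom_pointsD(2)[OF pc(1) s] by simp
    next
      fix \<theta> assume t: "\<theta> \<in> simplex r"
      show "x' (op_comp \<tau> \<theta>) \<in> Hom C P (lev X (sdim (op_comp \<tau> \<theta>)))"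
        using x'1[OF t] p1(4)[OF t] by simp
      fix m \<phi> assume f: "\<phi> \<in> ops m (sdim (op_comp \<tau> \<theta>))"
      then have "x' (op_comp (op_comp \<tau> \<theta>) \<phi>) = x1 (op_comp \<theta> \<phi>)"
        using x'1[OF subcomplexD(3)[OF subcomplex_simplex t]] op_comp_assoc[OF simplex_ops[OF t]] by simp
      then show "x' (op_comp (op_comp \<tau> \<theta>) \<phi>) = act X (sdim (op_comp \<tau> \<theta>)) \<phi> \<cdot> x' (op_comp \<tau> \<theta>)"
        using hom_pointsD(2)[OF p1(1) t] f x'1[OF t] by simp
    qed
    show "y \<cdot> c \<in> Hom C P (lev Y N)" by (rule yc)
    fix \<sigma> assume "\<sigma> \<in> ?S'"
    then show "f (sdim \<sigma>) \<cdot> x' \<sigma> = act Y N \<sigma> \<cdot> (y \<cdot> c)"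
    proof
      assume "\<sigma> \<in> S" then show ?thesis using pc(3) x'S by simp
    next
      assume "\<sigma> \<in> op_comp \<tau> ` simplex r"
      then obtain \<theta> where t: "\<theta> \<in> simplex r" "\<sigma> = op_comp \<tau> \<theta>" by auto
      then show ?thesis
        using x'1[OF t(1)] p1(3)[OF t(1)] Y.act_pre[OF tau(1) p(2) d(2) W d(1)]
          Y.act_act[OF tau(1) simplex_ops[OF t(1)] yc d(1)] by simp
    qed
  qed
  have "extension S ?S' N W x y P c x'"
  proof (rule extensionI[OF d(1,2) x'P x'S])
    fix U u z
    assume *: "U \<in> Ob C" "u \<in> Hom C U W" "(z, y \<cdot> u) \<in> pts ?S' N U" "\<And>\<sigma>. \<sigma> \<in> S \<Longrightarrow> z \<sigma> = x \<sigma> \<cdot> u"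
    have "(\<lambda>\<theta>. z (op_comp \<tau> \<theta>), (act Y N \<tau> \<cdot> y) \<cdot> u) \<in> pts (simplex r) r U"
      using pts_pull[OF *(3) subcomplex_simplex tau(1) _ *(1)] Y.act_pre[OF tau(1) p(2) *(2) W *(1)]
      by simp
    moreover have "z (op_comp \<tau> \<theta>) = x (op_comp \<tau> \<theta>) \<cdot> u" if "\<theta> \<in> T" for \<theta>
      using *(4) S(2) that TS by auto
    ultimately obtain v where v: "v \<in> Hom C U P" "c \<cdot> v = u" "\<forall>\<theta>\<in>simplex r. x1 \<theta> \<cdot> v = z (op_comp \<tau> \<theta>)"
      using d(5)[OF *(1,2)] by blast
    have "x' \<sigma> \<cdot> v = z \<sigma>" if "\<sigma> \<in> S" for \<sigma>
      using assoc[OF v(1) d(2) p(4)[OF that]] x'S[OF that] *(4)[OF that] v(2) W d(1) *(1) by simp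
    moreover have "x' (op_comp \<tau> \<theta>) \<cdot> v = z (op_comp \<tau> \<theta>)" if "\<theta> \<in> simplex r" for \<theta>
      using x'1[OF that] v(3) that by simp
    ultimately show "\<exists>v. v \<in> Hom C U P \<and> c \<cdot> v = u \<and> (\<forall>\<sigma>\<in>?S'. x' \<sigma> \<cdot> v = z \<sigma>)"
      using v(1,2) by blast
  next
    fix U v w
    assume *: "U \<in> Ob C" "v \<in> Hom C U P" "w \<in> Hom C U P" "c \<cdot> v = c \<cdot> w"
      "\<And>\<sigma>. \<sigma> \<in> ?S' \<Longrightarrow> x' \<sigma> \<cdot> v = x' \<sigma> \<cdot> w"
    show "v = w"
      by (rule extension_eqI[OF e(1) TS subset_refl *(1) W xt *(2,3,4)])
        (use *(5) x'1 in force)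
  qed
  then show "\<exists>P c x'. extension S ?S' N W x y P c x' \<and> c \<in> K P W" using e(2) by blast
qed

end

section \<open>Limits over unions of faces\<close>

text \<open>
  The inverse of the coface on simplices that avoid \<open>j\<close>: it turns a simplex of the face opposite to
  \<open>j\<close> into one of \<open>\<Delta>\<^sup>M\<close>.
\<close>

definition coface_inverse :: "nat \<Rightarrow> nat list \<Rightarrow> nat list" where
  "coface_inverse j \<sigma> = map (\<lambda>i. if i < j then i else i - 1) \<sigma>"

lemma coface_inverse: "\<theta> \<in> simplex M \<Longrightarrow> coface_inverse j (op_comp (coface M j) \<theta>) = \<theta>"
proof -
  assume "\<theta> \<in> simplex M"
  then have "\<forall>i \<in> set \<theta>. i \<le> M" by (simp add: simplex_iff)
  then have "map (\<lambda>i. if coface M j ! i < j then coface M j ! i else coface M j ! i - 1) \<theta> = map (\<lambda>i. i) \<theta>"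
    by (intro map_cong refl) (auto simp: nth_coface)
  then show ?thesis unfolding coface_inverse_def op_comp_def by (simp add: comp_def)
qed

context simplicial_obj
begin

lemma hom_points_face:
  assumes "j \<le> Suc M"
  shows "(\<lambda>\<sigma>. act X M (coface_inverse j \<sigma>)) \<in> hom_points C (faces (Suc M) {j}) X (lev X M)"
proof -
  have "(\<lambda>\<sigma>. act X M \<sigma> \<cdot> Id C (lev X M)) \<in> hom_points C (simplex M) X (lev X M)"
    by (rule hom_points_act[OF Id_in_Hom[OF lev_Ob] lev_Ob subset_refl])
  then have h: "(\<lambda>\<sigma>. act X M \<sigma>) \<in> hom_points C (simplex M) X (lev X M)"
    by (rule hom_points_cong[OF _ subcomplex_simplex])
      (simp add: Comp_Id[OF lev_Ob lev_Ob act_hom[OF simplex_ops]])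
  have F: "faces (Suc M) {j} = op_comp (coface M j) ` simplex M"
    using faces_insert[OF assms, of "{}"] by (simp add: faces_empty)
  show ?thesis
    unfolding hom_points_def F
  proof safe
    fix \<theta> assume t: "\<theta> \<in> simplex M"
    let ?\<sigma> = "op_comp (coface M j) \<theta>"
    show "act X M (coface_inverse j ?\<sigma>) \<in> Hom C (lev X M) (lev X (sdim ?\<sigma>))"
      using hom_pointsD(1)[OF h t] coface_inverse[OF t] by simp
    fix m \<phi> assume f: "\<phi> \<in> ops m (sdim ?\<sigma>)"
    then show "act X M (coface_inverse j (op_comp ?\<sigma> \<phi>)) =
        act X (sdim ?\<sigma>) \<phi> \<cdot> act X M (coface_inverse j ?\<sigma>)"
      using hom_pointsD(2)[OF h t, of \<phi> m] coface_inverse[OF t]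
        coface_inverse[OF subcomplexD(3)[OF subcomplex_simplex t]]
        op_comp_assoc[OF simplex_ops[OF t]] by simp
  qed
qed

lemma is_hom_face:
  assumes "j \<le> Suc M"
  shows "is_hom C (faces (Suc M) {j}) X (lev X M) (\<lambda>\<sigma>. act X M (coface_inverse j \<sigma>))"
  unfolding is_hom_def
proof (intro conjI ballI)
  fix U x assume U: "U \<in> Ob C" and x: "x \<in> hom_points C (faces (Suc M) {j}) X U"
  have F: "faces (Suc M) {j} = op_comp (coface M j) ` simplex M"
    using faces_insert[OF assms, of "{}"] by (simp add: faces_empty)
  have "(\<lambda>\<theta>. x (op_comp (coface M j) \<theta>)) \<in> hom_points C (simplex M) X U"
    using F by (intro hom_points_pull[OF x subcomplex_simplex coface_ops]) auto
  note h = hom_points_simplex[OF this] hom_pointsD(1)[OF this id_simplex]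
  show "\<exists>!u. u \<in> Hom C U (lev X M) \<and> (\<forall>\<sigma>\<in>faces (Suc M) {j}. act X M (coface_inverse j \<sigma>) \<cdot> u = x \<sigma>)"
  proof (intro ex1I[of _ "x (op_comp (coface M j) [0..<Suc M])"] conjI)
    show "x (op_comp (coface M j) [0..<Suc M]) \<in> Hom C U (lev X M)" using h(2) by simp
    show "\<forall>\<sigma>\<in>faces (Suc M) {j}.
        act X M (coface_inverse j \<sigma>) \<cdot> x (op_comp (coface M j) [0..<Suc M]) = x \<sigma>"
      unfolding F using h(1)[symmetric] coface_inverse by simp
    fix u assume u: "u \<in> Hom C U (lev X M) \<and> (\<forall>\<sigma>\<in>faces (Suc M) {j}. act X M (coface_inverse j \<sigma>) \<cdot> u = x \<sigma>)"
    moreover have "op_comp (coface M j) [0..<Suc M] \<in> faces (Suc M) {j}"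
      unfolding F by (rule imageI[OF id_simplex])
    ultimately have "act X M [0..<Suc M] \<cdot> u = x (op_comp (coface M j) [0..<Suc M])"
      using coface_inverse[OF id_simplex, of j M] by metis
    then show "u = x (op_comp (coface M j) [0..<Suc M])" using act_id[of u U M] u U by simp
  qed
qed (use assms hom_points_face in auto)

end

context simplicial_map
begin

lemma is_rel_homD:
  assumes L: "is_rel_hom C S N X Y f L \<xi> \<eta>"
  shows "L \<in> Ob C" "(\<xi>, \<eta>) \<in> pts S N L"
    "\<And>U x y. \<lbrakk>U \<in> Ob C; (x, y) \<in> pts S N U\<rbrakk> \<Longrightarrow>
       \<exists>!u. u \<in> Hom C U L \<and> (\<forall>\<sigma> \<in> S. \<xi> \<sigma> \<cdot> u = x \<sigma>) \<and> \<eta> \<cdot> u = y"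
proof -
  note L' = L[unfolded is_rel_hom_def]
  show "L \<in> Ob C" by (rule conjunct1[OF L'])
  show "(\<xi>, \<eta>) \<in> pts S N L" by (rule conjunct1[OF conjunct2[OF L']])
  fix U x y assume *: "U \<in> Ob C" "(x, y) \<in> pts S N U"
  show "\<exists>!u. u \<in> Hom C U L \<and> (\<forall>\<sigma> \<in> S. \<xi> \<sigma> \<cdot> u = x \<sigma>) \<and> \<eta> \<cdot> u = y"
    using bspec[OF bspec[OF conjunct2[OF conjunct2[OF L']] *(1)] *(2)] by (simp only: prod.case)
qed

lemma is_rel_hom_eqI:
  assumes "is_rel_hom C S N X Y f L \<xi> \<eta>" "S \<subseteq> simplex N" "U \<in> Ob C" "u \<in> Hom C U L" "v \<in> Hom C U L"
    and "\<And>\<sigma>. \<sigma> \<in> S \<Longrightarrow> \<xi> \<sigma> \<cdot> u = \<xi> \<sigma> \<cdot> v" "\<eta> \<cdot> u = \<eta> \<cdot> v"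
  shows "u = v"
  using is_rel_homD(3)[OF assms(1) assms(3) pts_pre[OF is_rel_homD(2)[OF assms(1)] assms(5,2) _ assms(3)]]
    is_rel_homD(1)[OF assms(1)] assms(4-7) by metis

lemma is_rel_homI:
  assumes "L \<in> Ob C" "(\<xi>, \<eta>) \<in> pts S N L"
    and "\<And>U x y. \<lbrakk>U \<in> Ob C; (x, y) \<in> pts S N U\<rbrakk> \<Longrightarrow>
       \<exists>u. u \<in> Hom C U L \<and> (\<forall>\<sigma> \<in> S. \<xi> \<sigma> \<cdot> u = x \<sigma>) \<and> \<eta> \<cdot> u = y"
    and "\<And>U u v. \<lbrakk>U \<in> Ob C; u \<in> Hom C U L; v \<in> Hom C U L;
        \<And>\<sigma>. \<sigma> \<in> S \<Longrightarrow> \<xi> \<sigma> \<cdot> u = \<xi> \<sigma> \<cdot> v; \<eta> \<cdot> u = \<eta> \<cdot> v\<rbrakk> \<Longrightarrow> u = v"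
  shows "is_rel_hom C S N X Y f L \<xi> \<eta>"
  unfolding is_rel_hom_def
proof (intro conjI ballI, goal_cases)
  case (3 U xy)
  obtain x y where xy: "xy = (x, y)" by (cases xy)
  obtain u where "u \<in> Hom C U L \<and> (\<forall>\<sigma> \<in> S. \<xi> \<sigma> \<cdot> u = x \<sigma>) \<and> \<eta> \<cdot> u = y"
    using assms(3)[OF 3(1)] 3(2) xy by blast
  then show ?case unfolding xy prod.case using assms(4)[OF 3(1)] by (intro ex1I[of _ u]) auto
qed (use assms in auto)

lemma restriction_exists:
  assumes "is_rel_hom C S N X Y f L \<xi> \<eta>" "S \<subseteq> simplex N"
  shows "\<exists>r. is_rel_restriction C S N X f L \<xi> \<eta> r"
proof -
  let ?I = "Id C (lev X N)"
  obtain r where "r \<in> Hom C (lev X N) L" "\<forall>\<sigma>\<in>S. \<xi> \<sigma> \<cdot> r = act X N \<sigma> \<cdot> ?I" "\<eta> \<cdot> r = f N \<cdot> ?I"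
    using is_rel_homD(3)[OF assms(1) X.lev_Ob pts_act[OF Id_in_Hom[OF X.lev_Ob] X.lev_Ob assms(2)]]
    by blast
  moreover have "f N \<cdot> ?I = f N" by (rule Comp_Id[OF X.lev_Ob Y.lev_Ob map_hom])
  moreover have "act X N \<sigma> \<cdot> ?I = act X N \<sigma>" if "\<sigma> \<in> S" for \<sigma>
    using Comp_Id[OF X.lev_Ob X.lev_Ob X.act_hom[OF simplex_ops]] that assms(2) by blast
  ultimately show ?thesis unfolding is_rel_restriction_def is_restriction_def by auto
qed

end

context simplicial_map_covers
begin

text \<open>
  Extensions of a point to \<open>\<Delta>\<^sup>N\<close> are represented by the pullback of the restriction map along the
  arrow that classifies the point.
\<close>

lemma covering_of_restriction:
  assumes L: "is_rel_hom C S N X Y f L \<xi> \<eta>" and r: "is_rel_restriction C S N X f L \<xi> \<eta> r"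
    and K: "r \<in> K (lev X N) L" and S: "S \<subseteq> simplex N"
  shows "covering K S (simplex N) N"
  unfolding covering_def
proof (intro ballI allI impI)
  fix W x y assume W: "W \<in> Ob C" and xy: "(x, y) \<in> pts S N W"
  note l = is_rel_homD[OF L] and p = ptsD[OF xy]
  note q = ptsD[OF l(2)]
  have r': "r \<in> Hom C (lev X N) L" "\<And>\<sigma>. \<sigma> \<in> S \<Longrightarrow> \<xi> \<sigma> \<cdot> r = act X N \<sigma>" "\<eta> \<cdot> r = f N"
    using r unfolding is_rel_restriction_def is_restriction_def by auto
  obtain u0 where u0: "u0 \<in> Hom C W L" "\<And>\<sigma>. \<sigma> \<in> S \<Longrightarrow> \<xi> \<sigma> \<cdot> u0 = x \<sigma>" "\<eta> \<cdot> u0 = y"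
    using l(3)[OF W xy] by blast
  obtain P t c where pb: "is_pullback C (lev X N) W L r u0 P t c" and cK: "c \<in> K P W"
    using K_pullback[OF X.lev_Ob W l(1) K u0(1)] by blast
  note b = is_pullbackD[OF pb]
  have rt: "\<xi> \<sigma> \<cdot> (r \<cdot> v) = act X N \<sigma> \<cdot> v" if "\<sigma> \<in> S" "v \<in> Hom C U (lev X N)" "U \<in> Ob C" for \<sigma> v U
    using assoc[OF that(2) r'(1) q(4)[OF that(1)]] r'(2)[OF that(1)] that(3) l(1) by simp
  have et: "\<eta> \<cdot> (r \<cdot> v) = f N \<cdot> v" if "v \<in> Hom C U (lev X N)" "U \<in> Ob C" for v U
    using assoc[OF that(1) r'(1) q(2)] r'(3) that(2) l(1) by simp
  have xu: "\<xi> \<sigma> \<cdot> (u0 \<cdot> v) = x \<sigma> \<cdot> v" if "\<sigma> \<in> S" "v \<in> Hom C U W" "U \<in> Ob C" for \<sigma> v U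
    using assoc[OF that(2) u0(1) q(4)[OF that(1)]] u0(2)[OF that(1)] that(3) l(1) W by simp
  have eu: "\<eta> \<cdot> (u0 \<cdot> v) = y \<cdot> v" if "v \<in> Hom C U W" "U \<in> Ob C" for v U
    using assoc[OF that(1) u0(1) q(2)] u0(3) that(2) l(1) W by simp
  have fy: "f N \<cdot> t = y \<cdot> c" using et[OF b(7,4)] eu[OF b(8,4)] b(9) by simp
  have idt: "act X N [0..<Suc N] \<cdot> t = t" by (rule X.act_id[OF b(7,4)])
  have "extension S (simplex N) N W x y P c (\<lambda>\<sigma>. act X N \<sigma> \<cdot> t)"
  proof (rule extensionI[OF b(4) b(8)])
    show "(\<lambda>\<sigma>. act X N \<sigma> \<cdot> t, y \<cdot> c) \<in> pts (simplex N) N P"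
      using pts_act[OF b(7,4) subset_refl] fy by simp
    show "act X N \<sigma> \<cdot> t = x \<sigma> \<cdot> c" if "\<sigma> \<in> S" for \<sigma>
      using rt[OF that b(7,4)] xu[OF that b(8,4)] b(9) by simp
  next
    fix U u z
    assume *: "U \<in> Ob C" "u \<in> Hom C U W" "(z, y \<cdot> u) \<in> pts (simplex N) N U" "\<And>\<sigma>. \<sigma> \<in> S \<Longrightarrow> z \<sigma> = x \<sigma> \<cdot> u"
    let ?t = "z [0..<Suc N]"
    note zt = pts_simplex[OF *(3,1)]
    have zs: "z \<sigma> = act X N \<sigma> \<cdot> ?t" if "\<sigma> \<in> simplex N" for \<sigma>
      by (rule X.hom_points_simplex[OF ptsD(1)[OF *(3)] that])
    have "r \<cdot> ?t = u0 \<cdot> u"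
    proof (rule is_rel_hom_eqI[OF L S *(1)])
      show "r \<cdot> ?t \<in> Hom C U L" using comp_hom[OF zt(1) r'(1)] *(1) l(1) by simp
      show "u0 \<cdot> u \<in> Hom C U L" using comp_hom[OF *(2) u0(1)] *(1) l(1) W by simp
      show "\<xi> \<sigma> \<cdot> (r \<cdot> ?t) = \<xi> \<sigma> \<cdot> (u0 \<cdot> u)" if "\<sigma> \<in> S" for \<sigma>
        using rt[OF that zt(1) *(1)] xu[OF that *(2,1)] *(4)[OF that] zs[of \<sigma>] that S by auto
      show "\<eta> \<cdot> (r \<cdot> ?t) = \<eta> \<cdot> (u0 \<cdot> u)"
        using et[OF zt(1) *(1)] eu[OF *(2,1)] zt(2) by simp
    qed
    then obtain v where v: "v \<in> Hom C U P" "t \<cdot> v = ?t" "c \<cdot> v = u"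
      using b(10)[OF *(1) zt(1) *(2)] by blast
    have "(act X N \<sigma> \<cdot> t) \<cdot> v = z \<sigma>" if "\<sigma> \<in> simplex N" for \<sigma>
      using X.act_pre[OF simplex_ops[OF that] b(7) v(1) b(4) *(1)] v(2) zs[OF that] by simp
    then show "\<exists>v. v \<in> Hom C U P \<and> c \<cdot> v = u \<and> (\<forall>\<sigma>\<in>simplex N. act X N \<sigma> \<cdot> t \<cdot> v = z \<sigma>)"
      using v by blast
  next
    fix U v w
    assume *: "U \<in> Ob C" "v \<in> Hom C U P" "w \<in> Hom C U P" "c \<cdot> v = c \<cdot> w"
      "\<And>\<sigma>. \<sigma> \<in> simplex N \<Longrightarrow> act X N \<sigma> \<cdot> t \<cdot> v = act X N \<sigma> \<cdot> t \<cdot> w"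
    have "t \<cdot> v = t \<cdot> w" using *(5)[OF id_simplex] idt by simp
    then show "v = w" using pullback_eqI[OF pb *(1-3)] *(4) by blast
  qed
  then show "\<exists>P c x'. extension S (simplex N) N W x y P c x' \<and> c \<in> K P W" using cK by blast
qed

text \<open>
  The limit on \<open>S'\<close> is the object representing the extensions of the universal point on \<open>S\<close>.
\<close>

lemma representable_extend:
  assumes L: "is_rel_hom C S N X Y f L \<xi> \<eta>" and cov: "covering K S S' N"
    and S: "S \<subseteq> S'" "S' \<subseteq> simplex N"
  shows "\<exists>L' \<xi>' \<eta>'. is_rel_hom C S' N X Y f L' \<xi>' \<eta>'"
proof -
  note l = is_rel_homD[OF L]
  note q = ptsD[OF l(2)]
  obtain P c x' where e: "extension S S' N L \<xi> \<eta> P c x'"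
    using coveringD[OF cov l(1,2)] .
  note d = extensionD[OF e]
  have ec: "\<eta> \<cdot> c \<cdot> v = \<eta> \<cdot> (c \<cdot> v)" if "v \<in> Hom C U P" "U \<in> Ob C" for v U
    using assoc[OF that(1) d(2) q(2)] that(2) l(1) d(1) by simp
  have xc: "x' \<sigma> \<cdot> v = \<xi> \<sigma> \<cdot> (c \<cdot> v)" if "\<sigma> \<in> S" "v \<in> Hom C U P" "U \<in> Ob C" for \<sigma> v U
    using assoc[OF that(2) d(2) q(4)[OF that(1)]] d(4)[OF that(1)] that(3) l(1) d(1) by simp
  have "is_rel_hom C S' N X Y f P x' (\<eta> \<cdot> c)"
  proof (rule is_rel_homI[OF d(1,3)])
    fix U z y assume *: "U \<in> Ob C" "(z, y) \<in> pts S' N U"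
    obtain u where u: "u \<in> Hom C U L" "\<forall>\<sigma>\<in>S. \<xi> \<sigma> \<cdot> u = z \<sigma>" "\<eta> \<cdot> u = y"
      using l(3)[OF *(1) pts_mono[OF *(2) S(1)]] by blast
    have "\<exists>!v. v \<in> Hom C U P \<and> c \<cdot> v = u \<and> (\<forall>\<sigma>\<in>S'. x' \<sigma> \<cdot> v = z \<sigma>)"
      using d(5)[OF *(1) u(1), of z] *(2) u(2,3) by simp
    then show "\<exists>v. v \<in> Hom C U P \<and> (\<forall>\<sigma>\<in>S'. x' \<sigma> \<cdot> v = z \<sigma>) \<and> \<eta> \<cdot> c \<cdot> v = y"
      using ec[OF _ *(1)] u(3) by blast
  next
    fix U u v
    assume *: "U \<in> Ob C" "u \<in> Hom C U P" "v \<in> Hom C U P"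
      "\<And>\<sigma>. \<sigma> \<in> S' \<Longrightarrow> x' \<sigma> \<cdot> u = x' \<sigma> \<cdot> v" "\<eta> \<cdot> c \<cdot> u = \<eta> \<cdot> c \<cdot> v"
    have h: "c \<cdot> u \<in> Hom C U L" "c \<cdot> v \<in> Hom C U L"
      using comp_hom[OF *(2) d(2)] comp_hom[OF *(3) d(2)] *(1) d(1) l(1) by auto
    have "c \<cdot> u = c \<cdot> v"
    proof (rule is_rel_hom_eqI[OF L _ *(1) h])
      show "S \<subseteq> simplex N" using S by auto
      show "\<xi> \<sigma> \<cdot> (c \<cdot> u) = \<xi> \<sigma> \<cdot> (c \<cdot> v)" if "\<sigma> \<in> S" for \<sigma>
        using xc[OF that *(2,1)] xc[OF that *(3,1)] *(4)[of \<sigma>] that S(1) by auto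
      show "\<eta> \<cdot> (c \<cdot> u) = \<eta> \<cdot> (c \<cdot> v)" using ec[OF *(2,1)] ec[OF *(3,1)] *(5) by simp
    qed
    then show "u = v" using extension_eqI[OF e S *(1) l(1,2) *(2,3)] *(4) by blast
  qed
  then show ?thesis by blast
qed

text \<open>
  Extensions of the universal point on \<open>S\<close> to \<open>\<Delta>\<^sup>N\<close> are represented on the one hand by some \<open>c : P \<rightarrow> L\<close>
  in \<open>K\<close> and on the other hand, by the Yoneda lemma, by \<open>X\<^sub>N\<close>. Hence \<open>r\<close> is \<open>c\<close> up to an isomorphism
  \<open>X\<^sub>N \<cong> P\<close>.
\<close>

lemma restriction_of_covering:
  assumes L: "is_rel_hom C S N X Y f L \<xi> \<eta>" and r: "is_rel_restriction C S N X f L \<xi> \<eta> r"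
    and cov: "covering K S (simplex N) N" and S: "S \<subseteq> simplex N"
  shows "r \<in> K (lev X N) L"
proof -
  note l = is_rel_homD[OF L]
  note q = ptsD[OF l(2)]
  have r': "r \<in> Hom C (lev X N) L" "\<And>\<sigma>. \<sigma> \<in> S \<Longrightarrow> \<xi> \<sigma> \<cdot> r = act X N \<sigma>" "\<eta> \<cdot> r = f N"
    using r unfolding is_rel_restriction_def is_restriction_def by auto
  obtain P c x' where e: "extension S (simplex N) N L \<xi> \<eta> P c x'" and cK: "c \<in> K P L"
    using coveringD[OF cov l(1,2)] .
  note d = extensionD[OF e]
  define t where "t = x' [0..<Suc N]"
  have t: "t \<in> Hom C P (lev X N)" "f N \<cdot> t = \<eta> \<cdot> c"
    using pts_simplex[OF d(3,1)] unfolding t_def by auto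
  have x't: "x' \<sigma> = act X N \<sigma> \<cdot> t" if "\<sigma> \<in> simplex N" for \<sigma>
    unfolding t_def by (rule X.hom_points_simplex[OF ptsD(1)[OF d(3)] that])
  have I: "Id C (lev X N) \<in> Hom C (lev X N) (lev X N)" by (rule Id_in_Hom) simp
  have aI: "act X N \<sigma> \<cdot> Id C (lev X N) = act X N \<sigma>" if "\<sigma> \<in> simplex N" for \<sigma>
    by (rule Comp_Id[OF X.lev_Ob X.lev_Ob X.act_hom[OF simplex_ops[OF that]]])
  have fI: "f N \<cdot> Id C (lev X N) = f N" by (rule Comp_Id[OF X.lev_Ob Y.lev_Ob map_hom])
  have z: "(\<lambda>\<sigma>. act X N \<sigma> \<cdot> Id C (lev X N), \<eta> \<cdot> r) \<in> pts (simplex N) N (lev X N)"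
    using pts_act[OF I X.lev_Ob subset_refl] fI r'(3) by simp
  have "act X N \<sigma> \<cdot> Id C (lev X N) = \<xi> \<sigma> \<cdot> r" if "\<sigma> \<in> S" for \<sigma>
    using aI[of \<sigma>] r'(2)[OF that] that S by auto
  then obtain v where v: "v \<in> Hom C (lev X N) P" "c \<cdot> v = r"
    "\<forall>\<sigma>\<in>simplex N. x' \<sigma> \<cdot> v = act X N \<sigma> \<cdot> Id C (lev X N)"
    using d(5)[OF X.lev_Ob r'(1) z] by blast
  have tv: "t \<cdot> v = Id C (lev X N)"
    using v(3) id_simplex[of N] X.act_id[OF I] unfolding t_def by simp
  have vt: "v \<cdot> t = Id C P"
  proof (rule extension_eqI[OF e S subset_refl d(1) l(1,2)])
    show "v \<cdot> t \<in> Hom C P P" using comp_hom[OF t(1) v(1)] d(1) by simp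
    show "Id C P \<in> Hom C P P" by (rule Id_in_Hom[OF d(1)])
    have cI: "c \<cdot> Id C P = c" by (rule Comp_Id[OF d(1) l(1) d(2)])
    have "r \<cdot> t = c"
    proof (rule is_rel_hom_eqI[OF L S d(1) _ d(2)])
      show "r \<cdot> t \<in> Hom C P L" using comp_hom[OF t(1) r'(1)] d(1) l(1) by simp
      show "\<xi> \<sigma> \<cdot> (r \<cdot> t) = \<xi> \<sigma> \<cdot> c" if "\<sigma> \<in> S" for \<sigma>
        using assoc[OF t(1) r'(1) q(4)[OF that]] r'(2)[OF that] d(4)[OF that] x't[of \<sigma>] that S d(1) l(1)
        by auto
      show "\<eta> \<cdot> (r \<cdot> t) = \<eta> \<cdot> c"
        using assoc[OF t(1) r'(1) q(2)] r'(3) t(2) d(1) l(1) by simp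
    qed
    then show "c \<cdot> (v \<cdot> t) = c \<cdot> Id C P"
      using assoc[OF t(1) v(1) d(2)] v(2) cI d(1) l(1) by simp
    fix \<sigma> assume s: "\<sigma> \<in> simplex N"
    have x's: "x' \<sigma> \<in> Hom C P (lev X (sdim \<sigma>))" by (rule ptsD(4)[OF d(3) s])
    show "x' \<sigma> \<cdot> (v \<cdot> t) = x' \<sigma> \<cdot> Id C P"
      using assoc[OF t(1) v(1) x's] bspec[OF v(3) s] aI[OF s] x't[OF s] Comp_Id[OF d(1) _ x's] d(1) by simp
  qed
  have "is_iso C (lev X N) P v"
    unfolding is_iso_def using v(1) t(1) tv vt by blast
  then have "v \<in> K (lev X N) P" using K_iso d(1) by simp
  then have "c \<cdot> v \<in> K (lev X N) L" using K_Comp[OF X.lev_Ob d(1) l(1)] cK by blast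
  then show ?thesis using v(2) by simp
qed

text \<open>
  Outer induction on \<open>M\<close>, inner induction on the number of faces that are missing. If one face
  \<open>i\<close> is missing, the union is a horn. Otherwise a further face \<open>j \<noteq> i\<close> is added, which is a pushout
  of an inclusion in dimension \<open>M - 1\<close>; keeping \<open>i\<close> out of the union ensures that the result is again
  proper.
\<close>

lemma covering_faces:
  assumes "\<And>r i. \<lbrakk>0 < r; r \<le> M; i \<le> r\<rbrakk> \<Longrightarrow> covering K (horn r i) (simplex r) r"
    and "J \<subseteq> {..M}" "J \<noteq> {}" "J \<noteq> {..M}"
  shows "covering K (faces M J) (simplex M) M"
  using assms
proof (induction M arbitrary: J)
  case 0
  then show ?case by auto
next
  case (Suc M)
  have IH: "covering K (faces M I) (simplex M) M" if "I \<subseteq> {..M}" "I \<noteq> {}" "I \<noteq> {..M}" for I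
    using Suc.IH[OF _ that] Suc.prems(1) by simp
  show ?case using Suc.prems(2-4)
  proof (induction "card ({..Suc M} - J)" arbitrary: J rule: less_induct)
    case less
    obtain i where i: "i \<le> Suc M" "i \<notin> J" using less.prems by auto
    show ?case
    proof (cases "J = {..Suc M} - {i}")
      case True
      then show ?thesis using Suc.prems(1)[of "Suc M" i] i horn_eq_faces by simp
    next
      case False
      then obtain j where j: "j \<le> Suc M" "j \<notin> J" "j \<noteq> i" using less.prems i by auto
      have ne: "insert j J \<noteq> {..Suc M}" using i j by auto
      let ?I = "{i. i \<le> M \<and> coface M j ! i \<in> J}"
      note I = coface_preimage_proper[OF less.prems(1) j(2,1) less.prems(2) ne]
      have "covering K (faces M ?I) (simplex M) M" by (rule IH) (use I in auto)
      then have "covering K (faces (Suc M) J) (faces (Suc M) J \<union> op_comp (coface M j) ` simplex M) (Suc M)"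
        using coface_faces_iff[OF _ less.prems(1) j(2,1)]
        by (intro covering_pushout[OF _ subcomplex_faces coface_ops distinct_coface subcomplex_faces])
      then have 1: "covering K (faces (Suc M) J) (faces (Suc M) (insert j J)) (Suc M)"
        using faces_insert[OF j(1)] by simp
      have "card ({..Suc M} - insert j J) < card ({..Suc M} - J)"
        using j by (intro psubset_card_mono) auto
      then have 2: "covering K (faces (Suc M) (insert j J)) (simplex (Suc M)) (Suc M)"
        using less.hyps[of "insert j J"] less.prems j ne by auto
      show ?thesis
        by (rule covering_trans[OF 1 2]) (auto simp: faces_def)
    qed
  qed
qed

text \<open>
  On a single face the limit is \<open>X\<^sub>M \<times>\<^bsub>Y\<^sub>M\<^esub> Y\<^bsub>M+1\<^esub>\<close>, which exists as the pullback of
  a face map of \<open>Y\<close> in \<open>K\<close>.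
\<close>

lemma representable_face:
  assumes K: "act Y (Suc M) (coface M j) \<in> K (lev Y (Suc M)) (lev Y M)" and j: "j \<le> Suc M"
  shows "\<exists>L \<xi> \<eta>. is_rel_hom C (faces (Suc M) {j}) (Suc M) X Y f L \<xi> \<eta>"
proof -
  let ?\<delta> = "coface M j" and ?F = "faces (Suc M) {j}"
  have F: "?F = op_comp ?\<delta> ` simplex M" using faces_insert[OF j, of "{}"] by (simp add: faces_empty)
  obtain P p q where pb: "is_pullback C (lev Y (Suc M)) (lev X M) (lev Y M) (act Y (Suc M) ?\<delta>) (f M) P p q"
    using K_pullback[OF Y.lev_Ob X.lev_Ob Y.lev_Ob K map_hom] by blast
  note b = is_pullbackD[OF pb]
  define \<xi> where "\<xi> \<sigma> = act X M (coface_inverse j \<sigma>) \<cdot> q" for \<sigma>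
  have xi: "\<xi> (op_comp ?\<delta> \<theta>) = act X M \<theta> \<cdot> q" if "\<theta> \<in> simplex M" for \<theta>
    unfolding \<xi>_def using coface_inverse[OF that] by simp
  have "is_rel_hom C ?F (Suc M) X Y f P \<xi> p"
  proof (rule is_rel_homI[OF b(4)])
    show "(\<xi>, p) \<in> pts ?F (Suc M) P"
    proof (rule ptsI[OF _ b(7)])
      show "\<xi> \<in> hom_points C ?F X P"
        unfolding \<xi>_def by (rule X.hom_points_pre[OF X.hom_points_face[OF j] b(8)]) (use b in simp_all)
      fix \<sigma> assume "\<sigma> \<in> ?F"
      then obtain \<theta> where t: "\<theta> \<in> simplex M" "\<sigma> = op_comp ?\<delta> \<theta>" unfolding F by auto
      show "f (sdim \<sigma>) \<cdot> \<xi> \<sigma> = act Y (Suc M) \<sigma> \<cdot> p"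
        using map_act[OF simplex_ops[OF t(1)] b(8,4)] xi[OF t(1)] t(2) b(9)[symmetric]
          Y.act_act[OF coface_ops[of M j] simplex_ops[OF t(1)] b(7,4)] by simp
    qed
  next
    fix U x y assume *: "U \<in> Ob C" "(x, y) \<in> pts ?F (Suc M) U"
    have "(\<lambda>\<theta>. x (op_comp ?\<delta> \<theta>), act Y (Suc M) ?\<delta> \<cdot> y) \<in> pts (simplex M) M U"
      using F by (intro pts_pull[OF *(2) subcomplex_simplex coface_ops _ *(1)]) auto
    note p = pts_simplex[OF this *(1)] and h = X.hom_points_simplex[OF ptsD(1)[OF this]]
    obtain u where u: "u \<in> Hom C U P" "p \<cdot> u = y" "q \<cdot> u = x (op_comp ?\<delta> [0..<Suc M])"
      using b(10)[OF *(1) ptsD(2)[OF *(2)] p(1)] p(2) by metis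
    have "\<xi> (op_comp ?\<delta> \<theta>) \<cdot> u = x (op_comp ?\<delta> \<theta>)" if "\<theta> \<in> simplex M" for \<theta>
      using xi[OF that] X.act_pre[OF simplex_ops[OF that] b(8) u(1) b(4) *(1)] u(3) h[OF that] by simp
    then show "\<exists>u. u \<in> Hom C U P \<and> (\<forall>\<sigma>\<in>?F. \<xi> \<sigma> \<cdot> u = x \<sigma>) \<and> p \<cdot> u = y"
      using u F by auto
  next
    fix U u v
    assume *: "U \<in> Ob C" "u \<in> Hom C U P" "v \<in> Hom C U P"
      "\<And>\<sigma>. \<sigma> \<in> ?F \<Longrightarrow> \<xi> \<sigma> \<cdot> u = \<xi> \<sigma> \<cdot> v" "p \<cdot> u = p \<cdot> v"
    have "\<xi> (op_comp ?\<delta> [0..<Suc M]) = q" using xi[OF id_simplex] X.act_id[OF b(8,4)] by simp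
    then have "q \<cdot> u = q \<cdot> v" using *(4)[of "op_comp ?\<delta> [0..<Suc M]"] F by force
    then show "u = v" using pullback_eqI[OF pb *(1-3) *(5)] by blast
  qed
  then show ?thesis by blast
qed

text \<open>
  Faces are added one at a time, starting from a single one. Horns of dimension at most \<open>M\<close> suffice
  for a union of faces of \<open>\<Delta>\<^bsup>M+1\<^esup>\<close>.
\<close>

lemma representable_faces:
  assumes hK: "\<And>r i. \<lbrakk>0 < r; r \<le> M; i \<le> r\<rbrakk> \<Longrightarrow> covering K (horn r i) (simplex r) r"
    and K: "\<And>j. j \<le> Suc M \<Longrightarrow> act Y (Suc M) (coface M j) \<in> K (lev Y (Suc M)) (lev Y M)"
    and J: "J \<subseteq> {..Suc M}" "J \<noteq> {}" "J \<noteq> {..Suc M}"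
  shows "\<exists>L \<xi> \<eta>. is_rel_hom C (faces (Suc M) J) (Suc M) X Y f L \<xi> \<eta>"
proof -
  have "finite J" using J(1) finite_subset by blast
  then show ?thesis using J(2,1,3)
  proof (induction J rule: finite_ne_induct)
    case (singleton j)
    then show ?case using representable_face[OF K] by simp
  next
    case (insert j J)
    have ne: "J \<noteq> {..Suc M}" and sub: "J \<subseteq> {..Suc M}" and j: "j \<le> Suc M" using insert by auto
    let ?I = "{i. i \<le> M \<and> coface M j ! i \<in> J}"
    note I = coface_preimage_proper[OF sub insert.hyps(3) j insert.hyps(2) insert.prems(2)]
    have "covering K (faces M ?I) (simplex M) M" by (rule covering_faces[OF hK]) (use I in auto)
    then have "covering K (faces (Suc M) J) (faces (Suc M) J \<union> op_comp (coface M j) ` simplex M) (Suc M)"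
      using coface_faces_iff[OF _ sub insert.hyps(3) j]
      by (intro covering_pushout[OF _ subcomplex_faces coface_ops distinct_coface subcomplex_faces])
    then have "covering K (faces (Suc M) J) (faces (Suc M) (insert j J)) (Suc M)"
      using faces_insert[OF j] by simp
    moreover obtain L \<xi> \<eta> where "is_rel_hom C (faces (Suc M) J) (Suc M) X Y f L \<xi> \<eta>"
      using insert.IH[OF sub ne] by blast
    ultimately show ?case
      using faces_insert[OF j] faces_subset
      by (intro representable_extend[of "faces (Suc M) J"]) blast+
  qed
qed

end

section \<open>Covers and isomorphisms\<close>

lemma (in category) is_pullback_along_iso:
  assumes "A \<in> Ob C" "B \<in> Ob C" "D \<in> Ob C" "f \<in> Hom C A D" "h \<in> Hom C D A"
    and "h \<cdot> f = Id C A" "f \<cdot> h = Id C D" "g \<in> Hom C B D"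
  shows "is_pullback C A B D f g B (h \<cdot> g) (Id C B)"
  unfolding is_pullback_def
proof (intro conjI ballI impI)
  show "h \<cdot> g \<in> Hom C B A" using comp_hom[OF assms(8,5)] assms by blast
  show "Id C B \<in> Hom C B B" using Id_in_Hom assms by blast
  show "f \<cdot> (h \<cdot> g) = g \<cdot> Id C B"
    using assoc[OF assms(8,5,4)] Comp_Id[OF assms(2,3,8)] Id_Comp[OF assms(2,3,8)] assms by simp
  fix U a b assume U: "U \<in> Ob C" and a: "a \<in> Hom C U A" and b: "b \<in> Hom C U B" and e: "f \<cdot> a = g \<cdot> b"
  have "h \<cdot> g \<cdot> b = h \<cdot> (f \<cdot> a)" using assoc[OF b assms(8,5)] e U assms(1-3) by simp
  also have "\<dots> = a" using assoc[OF a assms(4,5)] Id_Comp[OF U assms(1) a] assms(1-6) U by simp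
  finally have ha: "h \<cdot> g \<cdot> b = a" .
  show "\<exists>!u. u \<in> Hom C U B \<and> h \<cdot> g \<cdot> u = a \<and> Id C B \<cdot> u = b"
    using ha b Id_Comp[OF U assms(2)] by metis
qed (use assms in auto)

lemma (in category) cover_class_iso: "cover_class C (\<lambda>A B. {f. is_iso C A B f})"
proof
  fix X Y Z f g
  assume o: "X \<in> Ob C" "Y \<in> Ob C" "Z \<in> Ob C" and "f \<in> {f. is_iso C X Y f}" "g \<in> {f. is_iso C Y Z f}"
  then obtain f' g' where f: "f \<in> Hom C X Y" "f' \<in> Hom C Y X" "f' \<cdot> f = Id C X" "f \<cdot> f' = Id C Y"
    and g: "g \<in> Hom C Y Z" "g' \<in> Hom C Z Y" "g' \<cdot> g = Id C Y" "g \<cdot> g' = Id C Z"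
    unfolding is_iso_def by blast
  have gf: "g \<cdot> f \<in> Hom C X Z" "f' \<cdot> g' \<in> Hom C Z X"
    using comp_hom[OF f(1) g(1)] comp_hom[OF g(2) f(2)] o by auto
  have "f' \<cdot> g' \<cdot> (g \<cdot> f) = f' \<cdot> (g' \<cdot> g \<cdot> f)"
    using assoc[OF gf(1) g(2) f(2)] assoc[OF f(1) g(1,2)] o by simp
  also have "\<dots> = Id C X" using g(3) f(3) Id_Comp[OF o(1,2) f(1)] by simp
  finally have 1: "f' \<cdot> g' \<cdot> (g \<cdot> f) = Id C X" .
  have "g \<cdot> f \<cdot> (f' \<cdot> g') = g \<cdot> (f \<cdot> f' \<cdot> g')"
    using assoc[OF gf(2) f(1) g(1)] assoc[OF g(2) f(2,1)] o by simp
  also have "\<dots> = Id C Z" using g(4) f(4) Id_Comp[OF o(3,2) g(2)] by simp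
  finally show "g \<cdot> f \<in> {f. is_iso C X Z f}" unfolding is_iso_def using gf 1 by blast
next
  fix A B D f g
  assume o: "A \<in> Ob C" "B \<in> Ob C" "D \<in> Ob C" and "f \<in> {f. is_iso C A D f}" and g: "g \<in> Hom C B D"
  then obtain h where f: "f \<in> Hom C A D" "h \<in> Hom C D A" "h \<cdot> f = Id C A" "f \<cdot> h = Id C D"
    unfolding is_iso_def by blast
  have I: "Id C B \<in> Hom C B B" by (rule Id_in_Hom[OF o(2)])
  have "is_iso C B B (Id C B)" unfolding is_iso_def using I Comp_Id[OF o(2,2) I] by blast
  then show "\<exists>P p q. is_pullback C A B D f g P p q \<and> q \<in> {f. is_iso C P B f}"
    using is_pullback_along_iso[OF o f g] by blast
qed auto

text \<open>
  An isomorphism \<open>f : X \<rightarrow> Y\<close> with inverse \<open>h\<close> is a cover because it is a projection of the pullback of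
  the cover \<open>Id X\<close> along \<open>h\<close>.
\<close>

lemma (in category_with_covers) cover_class_Cov: "cover_class C Cov"
proof
  fix X Y f assume o: "X \<in> Ob C" "Y \<in> Ob C" and "is_iso C X Y f"
  then obtain h where f: "f \<in> Hom C X Y" "h \<in> Hom C Y X" "h \<cdot> f = Id C X" "f \<cdot> h = Id C Y"
    unfolding is_iso_def by blast
  have I: "Id C X \<in> Hom C X X" by (rule Id_in_Hom[OF o(1)])
  have "is_pullback C X Y X (Id C X) h X (Id C X) f"
    unfolding is_pullback_def
  proof (intro conjI ballI impI)
    show "Id C X \<cdot> Id C X = h \<cdot> f" using Comp_Id[OF o(1,1) I] f(3) by simp
    fix U a b assume U: "U \<in> Ob C" and a: "a \<in> Hom C U X" and b: "b \<in> Hom C U Y" and e: "Id C X \<cdot> a = h \<cdot> b"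
    have "f \<cdot> a = b"
      using Id_Comp[OF U o(1) a] Id_Comp[OF U o(2) b] assoc[OF b f(2,1)] f(4) e o U by simp
    then show "\<exists>!u. u \<in> Hom C U X \<and> Id C X \<cdot> u = a \<and> f \<cdot> u = b"
      using Id_Comp[OF U o(1)] a by metis
  qed (use o f I in auto)
  then show "f \<in> Cov X Y" using A2_cover Cov_Id[OF o(1)] by blast
next
  fix A B D f g
  assume "A \<in> Ob C" "B \<in> Ob C" "D \<in> Ob C" "f \<in> Cov A D" "g \<in> Hom C B D"
  then show "\<exists>P p q. is_pullback C A B D f g P p q \<and> q \<in> Cov P B"
    using A2_exists A2_cover by metis
qed (rule Cov_Comp)

section \<open>Absolute limits as relative limits over the terminal object\<close>

definition to_terminal :: "('o, 'm) cat \<Rightarrow> 'o \<Rightarrow> ('o, 'm) sobj \<Rightarrow> nat \<Rightarrow> 'm" where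
  "to_terminal C T X n = (THE h. h \<in> Hom C (lev X n) T)"

lemma (in category) simplicial_object_const:
  assumes "A \<in> Ob C" shows "simplicial_object C (const_sobj C A)"
  using assms Id_in_Hom[OF assms] Comp_Id[OF assms assms]
  unfolding simplicial_object_def const_sobj_def by simp

lemma (in category) terminal_eq:
  assumes "is_terminal C T" "U \<in> Ob C" "g \<in> Hom C U T" "h \<in> Hom C U T" shows "g = h"
  using assms unfolding is_terminal_def by blast

lemma (in simplicial_obj) simplicial_map_to_terminal:
  assumes "is_terminal C T"
  shows "simplicial_map C X (const_sobj C T) (to_terminal C T X)"
proof
  have T: "T \<in> Ob C" "\<And>U. U \<in> Ob C \<Longrightarrow> \<exists>!h. h \<in> Hom C U T"
    using assms unfolding is_terminal_def by auto
  have h: "to_terminal C T X n \<in> Hom C (lev X n) T" for n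
    unfolding to_terminal_def by (rule theI'[OF T(2)[OF lev_Ob]])
  show "simplicial_object C X" by (rule simplicial_object)
  show "simplicial_object C (const_sobj C T)" by (rule simplicial_object_const[OF T(1)])
  have "Id C T \<cdot> to_terminal C T X n = to_terminal C T X m \<cdot> act X n \<theta>" if "\<theta> \<in> ops m n" for m n \<theta>
    using terminal_eq[OF assms lev_Ob, of "Id C T \<cdot> to_terminal C T X n" n]
      comp_hom[OF h Id_in_Hom[OF T(1)]] comp_hom[OF act_hom[OF that] h] T(1) by simp
  then show "to_terminal C T X \<in> simplicial_maps C X (const_sobj C T)"
    unfolding simplicial_maps_def const_sobj_def using h by simp
qed

text \<open>
  Over the constant terminal object the component in \<open>Y\<^sub>N\<close> carries no information. The two lemmas
  that follow turn the relative notions for \<open>X \<rightarrow> *\<close> into the absolute ones used in the definition of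
  Lie groupoids.
\<close>

lemma (in simplicial_obj) rel_hom_points_terminal:
  assumes "is_terminal C T" "U \<in> Ob C"
  shows "rel_hom_points C S N X (const_sobj C T) (to_terminal C T X) U = hom_points C S X U \<times> Hom C U T"
proof -
  interpret t: simplicial_map C X "const_sobj C T" "to_terminal C T X"
    by (rule simplicial_map_to_terminal[OF assms(1)])
  have T: "T \<in> Ob C" using assms unfolding is_terminal_def by auto
  have "to_terminal C T X (sdim \<sigma>) \<cdot> x \<sigma> = Id C T \<cdot> y"
    if "x \<in> hom_points C S X U" "y \<in> Hom C U T" "\<sigma> \<in> S" for x y \<sigma>
    using terminal_eq[OF assms, of "to_terminal C T X (sdim \<sigma>) \<cdot> x \<sigma>" "Id C T \<cdot> y"]
      t.map_pt[OF hom_pointsD(1)[OF that(1,3)] assms(2)] Id_Comp[OF assms(2) T that(2)] that(2)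
    by (simp add: const_sobj_def)
  then show ?thesis unfolding rel_hom_points_def by (auto simp: const_sobj_def)
qed

lemma (in simplicial_obj) is_rel_hom_terminal:
  assumes "is_terminal C T"
  shows "is_rel_hom C S N X (const_sobj C T) (to_terminal C T X) L \<xi> \<eta> \<longleftrightarrow>
    is_hom C S X L \<xi> \<and> \<eta> \<in> Hom C L T"
proof (cases "L \<in> Ob C \<and> \<eta> \<in> Hom C L T")
  case False
  then show ?thesis unfolding is_rel_hom_def is_hom_def
    using rel_hom_points_terminal[OF assms] by blast
next
  case True
  have T: "T \<in> Ob C" "\<And>U. U \<in> Ob C \<Longrightarrow> \<exists>h. h \<in> Hom C U T"
    using assms unfolding is_terminal_def by auto
  have e: "(u \<in> Hom C U L \<and> (\<forall>\<sigma>\<in>S. \<xi> \<sigma> \<cdot> u = x \<sigma>) \<and> \<eta> \<cdot> u = y) \<longleftrightarrow>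
      (u \<in> Hom C U L \<and> (\<forall>\<sigma>\<in>S. \<xi> \<sigma> \<cdot> u = x \<sigma>))" if "U \<in> Ob C" "y \<in> Hom C U T" for U u x y
    using terminal_eq[OF assms that(1) comp_hom[of u U L \<eta> T] that(2)] True T(1) that(1) by blast
  have "(\<forall>U \<in> Ob C. \<forall>(x, y) \<in> hom_points C S X U \<times> Hom C U T.
        \<exists>!u. u \<in> Hom C U L \<and> (\<forall>\<sigma>\<in>S. \<xi> \<sigma> \<cdot> u = x \<sigma>) \<and> \<eta> \<cdot> u = y) \<longleftrightarrow>
      (\<forall>U \<in> Ob C. \<forall>x \<in> hom_points C S X U. \<exists>!u. u \<in> Hom C U L \<and> (\<forall>\<sigma>\<in>S. \<xi> \<sigma> \<cdot> u = x \<sigma>))"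
    (is "?l \<longleftrightarrow> ?r")
  proof
    assume l: ?l
    show ?r
    proof (intro ballI)
      fix U x assume *: "U \<in> Ob C" "x \<in> hom_points C S X U"
      obtain y where y: "y \<in> Hom C U T" using T(2) *(1) by blast
      show "\<exists>!u. u \<in> Hom C U L \<and> (\<forall>\<sigma>\<in>S. \<xi> \<sigma> \<cdot> u = x \<sigma>)"
        using bspec[OF bspec[OF l *(1)], of "(x, y)"] * y e[OF *(1) y, of _ x] by simp
    qed
  next
    assume r: ?r
    show ?l
    proof (intro ballI, clarify)
      fix U x y assume *: "U \<in> Ob C" "x \<in> hom_points C S X U" "y \<in> Hom C U T"
      show "\<exists>!u. u \<in> Hom C U L \<and> (\<forall>\<sigma>\<in>S. \<xi> \<sigma> \<cdot> u = x \<sigma>) \<and> \<eta> \<cdot> u = y"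
        using bspec[OF bspec[OF r *(1)] *(2)] e[OF *(1,3), of _ x] by simp
    qed
  qed
  then show ?thesis unfolding is_rel_hom_def is_hom_def
    using True rel_hom_points_terminal[OF assms] by (simp cong: ball_cong)
qed

lemma (in simplicial_obj) is_rel_restriction_terminal:
  assumes "is_terminal C T" "L \<in> Ob C" "\<eta> \<in> Hom C L T"
  shows "is_rel_restriction C S N X (to_terminal C T X) L \<xi> \<eta> r \<longleftrightarrow> is_restriction C S N X L \<xi> r"
proof -
  interpret t: simplicial_map C X "const_sobj C T" "to_terminal C T X"
    by (rule simplicial_map_to_terminal[OF assms(1)])
  have T: "T \<in> Ob C" using assms unfolding is_terminal_def by auto
  have "\<eta> \<cdot> r = to_terminal C T X N" if "r \<in> Hom C (lev X N) L"
    using terminal_eq[OF assms(1) lev_Ob comp_hom[OF that assms(3)] ] t.map_hom[of N] T assms(2)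
    by (simp add: const_sobj_def)
  then show ?thesis unfolding is_rel_restriction_def is_restriction_def by blast
qed

section \<open>Lie groupoids and stacks in terms of covering inclusions\<close>

lemma lie_groupoidE:
  assumes "lie_groupoid C Cov n X" "0 < k" "i \<le> k"
  obtains L \<xi> r where "is_hom C (horn k i) X L \<xi>" "is_restriction C (horn k i) k X L \<xi> r"
    "r \<in> Cov (lev X k) L" "n < enat k \<Longrightarrow> is_iso C (lev X k) L r"
  using assms(1)[unfolded lie_groupoid_def, THEN conjunct2, rule_format, OF assms(2,3)] by blast

lemma n_stackE:
  assumes "n_stack C Cov n X Y f" "0 < k" "i \<le> k"
  obtains L \<xi> \<eta> r where "is_rel_hom C (horn k i) k X Y f L \<xi> \<eta>"
    "is_rel_restriction C (horn k i) k X f L \<xi> \<eta> r"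
    "r \<in> Cov (lev X k) L" "n < enat k \<Longrightarrow> is_iso C (lev X k) L r"
  using assms(1)[unfolded n_stack_def, THEN conjunct2, THEN conjunct2, THEN conjunct2, rule_format, OF assms(2,3)]
  by blast

context category_with_covers
begin

lemma lie_groupoid_covering:
  assumes X: "lie_groupoid C Cov n X" and T: "is_terminal C T" and r: "0 < r" "i \<le> r"
  shows "simplicial_map.covering C X (const_sobj C T) (to_terminal C T X) Cov (horn r i) (simplex r) r"
proof -
  interpret K: cover_class C Cov by (rule cover_class_Cov)
  interpret X: simplicial_obj C X using X unfolding lie_groupoid_def by unfold_locales blast
  interpret t: simplicial_map C X "const_sobj C T" "to_terminal C T X"
    by (rule X.simplicial_map_to_terminal[OF T])
  interpret t: simplicial_map_covers C X "const_sobj C T" "to_terminal C T X" Cov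
    by unfold_locales
  obtain L \<xi> p where L: "is_hom C (horn r i) X L \<xi>" "is_restriction C (horn r i) r X L \<xi> p"
    "p \<in> Cov (lev X r) L"
    using lie_groupoidE[OF X r] by blast
  have LO: "L \<in> Ob C" using L(1) unfolding is_hom_def by blast
  then obtain \<eta> where e: "\<eta> \<in> Hom C L T" using T unfolding is_terminal_def by blast
  show ?thesis
  proof (rule t.covering_of_restriction[OF _ _ L(3) horn_subset])
    show "is_rel_hom C (horn r i) r X (const_sobj C T) (to_terminal C T X) L \<xi> \<eta>"
      using X.is_rel_hom_terminal[OF T] L(1) e by blast
    show "is_rel_restriction C (horn r i) r X (to_terminal C T X) L \<xi> \<eta> p"
      using X.is_rel_restriction_terminal[OF T LO e] L(2) by blast
  qed
qed

text \<open>
  The limit over a horn exists because the horns of smaller dimension are covering and the face maps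
  of the terminal object are identities.
\<close>

lemma lie_groupoid_of_covering:
  assumes X: "simplicial_object C X" and T: "is_terminal C T"
    and cov: "\<And>r i. \<lbrakk>0 < r; i \<le> r\<rbrakk> \<Longrightarrow>
      simplicial_map.covering C X (const_sobj C T) (to_terminal C T X) Cov (horn r i) (simplex r) r"
    and iso: "\<And>r i. \<lbrakk>0 < r; i \<le> r; n < enat r\<rbrakk> \<Longrightarrow>
      simplicial_map.covering C X (const_sobj C T) (to_terminal C T X)
        (\<lambda>A B. {g. is_iso C A B g}) (horn r i) (simplex r) r"
  shows "lie_groupoid C Cov n X"
proof -
  interpret K: cover_class C Cov by (rule cover_class_Cov)
  interpret I: cover_class C "\<lambda>A B. {g. is_iso C A B g}" by (rule cover_class_iso)
  interpret X: simplicial_obj C X by unfold_locales (rule X)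
  interpret t: simplicial_map C X "const_sobj C T" "to_terminal C T X"
    by (rule X.simplicial_map_to_terminal[OF T])
  interpret tK: simplicial_map_covers C X "const_sobj C T" "to_terminal C T X" Cov by unfold_locales
  interpret tI: simplicial_map_covers C X "const_sobj C T" "to_terminal C T X"
    "\<lambda>A B. {g. is_iso C A B g}" by unfold_locales
  show ?thesis
    unfolding lie_groupoid_def
  proof (intro conjI allI impI X)
    fix m i :: nat assume m: "0 < m" and i: "i \<le> m"
    obtain M where M: "m = Suc M" using m by (cases m) auto
    have id: "act (const_sobj C T) (Suc M) (coface M j) \<in>
        Cov (lev (const_sobj C T) (Suc M)) (lev (const_sobj C T) M)" for j
      using Cov_Id T unfolding is_terminal_def by (simp add: const_sobj_def)
    have "{..Suc M} - {i} \<noteq> {}"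
      using m i M by (cases i) auto
    then have "\<exists>L \<xi> \<eta>. is_rel_hom C (horn m i) m X (const_sobj C T) (to_terminal C T X) L \<xi> \<eta>"
      unfolding horn_eq_faces M by (intro tK.representable_faces cov id) (use i M in auto)
    then obtain L \<xi> \<eta> where L: "is_rel_hom C (horn m i) m X (const_sobj C T) (to_terminal C T X) L \<xi> \<eta>"
      by blast
    obtain r where r: "is_rel_restriction C (horn m i) m X (to_terminal C T X) L \<xi> \<eta> r"
      using t.restriction_exists[OF L horn_subset] by blast
    have "is_hom C (horn m i) X L \<xi>" using L X.is_rel_hom_terminal[OF T] by blast
    moreover have "is_restriction C (horn m i) m X L \<xi> r"
      using r unfolding is_rel_restriction_def by blast
    moreover have "r \<in> Cov (lev X m) L"
      by (rule tK.restriction_of_covering[OF L r cov[OF m i] horn_subset])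
    moreover have "is_iso C (lev X m) L r" if "n < enat m"
      using tI.restriction_of_covering[OF L r iso[OF m i that] horn_subset] by simp
    ultimately show "\<exists>L \<xi> r. is_hom C (horn m i) X L \<xi> \<and> is_restriction C (horn m i) m X L \<xi> r \<and>
        r \<in> Cov (lev X m) L \<and> (n < enat m \<longrightarrow> is_iso C (lev X m) L r)" by blast
  qed
qed

text \<open>
  A single face of \<open>\<Delta>\<^bsup>M+1\<^esup>\<close> is a proper nonempty union of faces, and the limit over it is \<open>X\<^sub>M\<close>.
\<close>

lemma coface_cover:
  assumes X: "lie_groupoid C Cov n X" and j: "j \<le> Suc M"
  shows "act X (Suc M) (coface M j) \<in> Cov (lev X (Suc M)) (lev X M)"
proof -
  have sX: "simplicial_object C X" using X unfolding lie_groupoid_def by blast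
  interpret X: simplicial_obj C X by unfold_locales (rule sX)
  obtain T where T: "is_terminal C T" using A1 by blast
  interpret K: cover_class C Cov by (rule cover_class_Cov)
  interpret t: simplicial_map C X "const_sobj C T" "to_terminal C T X"
    by (rule X.simplicial_map_to_terminal[OF T])
  interpret t: simplicial_map_covers C X "const_sobj C T" "to_terminal C T X" Cov
    by unfold_locales
  let ?F = "faces (Suc M) {j}"
  obtain \<eta> where e: "\<eta> \<in> Hom C (lev X M) T" using T X.lev_Ob unfolding is_terminal_def by blast
  have L: "is_rel_hom C ?F (Suc M) X (const_sobj C T) (to_terminal C T X)
      (lev X M) (\<lambda>\<sigma>. act X M (coface_inverse j \<sigma>)) \<eta>"
    using X.is_rel_hom_terminal[OF T] X.is_hom_face[OF j] e by blast
  have F: "?F = op_comp (coface M j) ` simplex M"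
    using faces_insert[OF j, of "{}"] by (simp add: faces_empty)
  have "is_restriction C ?F (Suc M) X (lev X M) (\<lambda>\<sigma>. act X M (coface_inverse j \<sigma>))
      (act X (Suc M) (coface M j))"
    unfolding is_restriction_def
  proof
    show "act X (Suc M) (coface M j) \<in> Hom C (lev X (Suc M)) (lev X M)"
      by (rule X.act_hom[OF coface_ops])
    have "act X M \<theta> \<cdot> act X (Suc M) (coface M j) = act X (Suc M) (op_comp (coface M j) \<theta>)"
      if "\<theta> \<in> simplex M" for \<theta>
      using sX coface_ops[of M j] simplex_ops[OF that] unfolding simplicial_object_def by metis
    then show "\<forall>\<sigma>\<in>?F. act X M (coface_inverse j \<sigma>) \<cdot> act X (Suc M) (coface M j) = act X (Suc M) \<sigma>"
      unfolding F using coface_inverse by auto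
  qed
  then have r: "is_rel_restriction C ?F (Suc M) X (to_terminal C T X) (lev X M)
      (\<lambda>\<sigma>. act X M (coface_inverse j \<sigma>)) \<eta> (act X (Suc M) (coface M j))"
    using X.is_rel_restriction_terminal[OF T X.lev_Ob e] by blast
  have "0 \<in> {..Suc M}" "Suc M \<in> {..Suc M}" by auto
  then have ne: "{j} \<noteq> {..Suc M}" by (metis singletonD nat.distinct(1))
  have "t.covering Cov ?F (simplex (Suc M)) (Suc M)"
    using t.covering_faces[OF lie_groupoid_covering[OF X T] _ _ ne] j by simp
  then show ?thesis
    by (rule t.restriction_of_covering[OF L r _ faces_subset])
qed

lemma n_stack_covering:
  assumes "n_stack C Cov n X Y f" "0 < r" "i \<le> r"
  shows "simplicial_map.covering C X Y f Cov (horn r i) (simplex r) r"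
    and "n < enat r \<Longrightarrow>
      simplicial_map.covering C X Y f (\<lambda>A B. {g. is_iso C A B g}) (horn r i) (simplex r) r"
proof -
  interpret K: cover_class C Cov by (rule cover_class_Cov)
  interpret I: cover_class C "\<lambda>A B. {g. is_iso C A B g}" by (rule cover_class_iso)
  interpret f: simplicial_map C X Y f
    using assms(1) unfolding n_stack_def lie_groupoid_def by unfold_locales auto
  interpret fK: simplicial_map_covers C X Y f Cov by unfold_locales
  interpret fI: simplicial_map_covers C X Y f "\<lambda>A B. {g. is_iso C A B g}" by unfold_locales
  note S = horn_subset[of r i]
  obtain L \<xi> \<eta> p where L: "is_rel_hom C (horn r i) r X Y f L \<xi> \<eta>"
    "is_rel_restriction C (horn r i) r X f L \<xi> \<eta> p" "p \<in> Cov (lev X r) L"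
    "n < enat r \<Longrightarrow> is_iso C (lev X r) L p"
    using n_stackE[OF assms] by blast
  show "f.covering Cov (horn r i) (simplex r) r" by (rule fK.covering_of_restriction[OF L(1-3) S])
  show "f.covering (\<lambda>A B. {g. is_iso C A B g}) (horn r i) (simplex r) r" if "n < enat r"
    by (rule fI.covering_of_restriction[OF L(1,2) _ S]) (use L(4) that in simp)
qed

end

section \<open>Pullbacks of simplicial objects\<close>

context category
begin

lemma pullback_iso:
  assumes pb: "is_pullback C A B D f g P p q" and P': "P' \<in> Ob C"
    and u: "u \<in> Hom C P' P" and v: "v \<in> Hom C P P'" and vu: "v \<cdot> u = Id C P'" and uv: "u \<cdot> v = Id C P"
  shows "is_pullback C A B D f g P' (p \<cdot> u) (q \<cdot> u)"
proof -
  note b = is_pullbackD[OF pb]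
  have pu: "p \<cdot> u \<in> Hom C P' A" "q \<cdot> u \<in> Hom C P' B"
    using comp_hom[OF u b(7)] comp_hom[OF u b(8)] b(1-4) P' by auto
  have e: "f \<cdot> (p \<cdot> u) = g \<cdot> (q \<cdot> u)"
    using assoc[OF u b(7,5)] assoc[OF u b(8,6)] b(1-4,9) P' by simp
  have "\<exists>!w. w \<in> Hom C U P' \<and> p \<cdot> u \<cdot> w = a \<and> q \<cdot> u \<cdot> w = c"
    if U: "U \<in> Ob C" and a: "a \<in> Hom C U A" and c: "c \<in> Hom C U B" and e: "f \<cdot> a = g \<cdot> c" for U a c
  proof -
    obtain w0 where w0: "w0 \<in> Hom C U P" "p \<cdot> w0 = a" "q \<cdot> w0 = c" using b(10)[OF U a c e] by blast
    have s: "p \<cdot> u \<cdot> w = p \<cdot> (u \<cdot> w)" "q \<cdot> u \<cdot> w = q \<cdot> (u \<cdot> w)" if "w \<in> Hom C U P'" for w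
      using assoc[OF that u b(7)] assoc[OF that u b(8)] b(1-4) P' U by auto
    have vw: "v \<cdot> w0 \<in> Hom C U P'" using comp_hom[OF w0(1) v] b(4) P' U by simp
    have uvw: "u \<cdot> (v \<cdot> w0) = w0"
      using assoc[OF w0(1) v u] uv Id_Comp[OF U b(4) w0(1)] b(4) P' U by simp
    show ?thesis
    proof (intro ex1I[of _ "v \<cdot> w0"] conjI vw)
      show "p \<cdot> u \<cdot> (v \<cdot> w0) = a" "q \<cdot> u \<cdot> (v \<cdot> w0) = c" using s[OF vw] uvw w0 by auto
      fix w assume w: "w \<in> Hom C U P' \<and> p \<cdot> u \<cdot> w = a \<and> q \<cdot> u \<cdot> w = c"
      have "u \<cdot> w \<in> Hom C U P" using comp_hom[OF _ u] w b(4) P' U by blast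
      then have "u \<cdot> w = w0" using pullback_eqI[OF pb U _ w0(1)] s[of w] w w0 by metis
      then show "w = v \<cdot> w0"
        using assoc[OF _ u v, of w U] vu Id_Comp[OF U P', of w] w b(4) P' U by simp
    qed
  qed
  then show ?thesis unfolding is_pullback_def using b(1-6) P' pu e by blast
qed

text \<open>
  The structure maps of the pullback are the arrows induced on the levels; uniqueness in the
  universal property gives functoriality, and naturality of the induced arrows out of any other
  simplicial object.
\<close>

lemma levelwise_pullback_exists:
  assumes \<phi>: "simplicial_map C X B \<phi>" and g: "simplicial_map C A B g"
    and ex: "\<And>l. \<exists>P p q. is_pullback C (lev X l) (lev A l) (lev B l) (\<phi> l) (g l) P p q"
  shows "\<exists>P p q. is_pullback (sCat C) X A B \<phi> g P p q \<and>
    (\<forall>l. is_pullback C (lev X l) (lev A l) (lev B l) (\<phi> l) (g l) (lev P l) (p l) (q l))"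
proof -
  interpret \<phi>: simplicial_map C X B \<phi> by (rule \<phi>)
  interpret g: simplicial_map C A B g by (rule g)
  obtain P p q where pb: "\<And>l. is_pullback C (lev X l) (lev A l) (lev B l) (\<phi> l) (g l) (P l) (p l) (q l)"
    using ex by metis
  note b = is_pullbackD[OF pb]
  note p = b(7) and q = b(8) and ob = b(4)
  define \<alpha> where "\<alpha> n \<theta> = (SOME u. u \<in> Hom C (P n) (P (sdim \<theta>)) \<and>
      p (sdim \<theta>) \<cdot> u = act X n \<theta> \<cdot> p n \<and> q (sdim \<theta>) \<cdot> u = act A n \<theta> \<cdot> q n)" for n \<theta>
  have \<alpha>: "\<alpha> n \<theta> \<in> Hom C (P n) (P m)" "p m \<cdot> \<alpha> n \<theta> = act X n \<theta> \<cdot> p n" "q m \<cdot> \<alpha> n \<theta> = act A n \<theta> \<cdot> q n"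
    if t: "\<theta> \<in> ops m n" for m n \<theta>
  proof -
    have "\<phi> m \<cdot> (act X n \<theta> \<cdot> p n) = g m \<cdot> (act A n \<theta> \<cdot> q n)"
      using \<phi>.map_act[OF t p ob] g.map_act[OF t q ob] b(9) by simp
    then have "\<exists>u. u \<in> Hom C (P n) (P m) \<and> p m \<cdot> u = act X n \<theta> \<cdot> p n \<and> q m \<cdot> u = act A n \<theta> \<cdot> q n"
      using b(10)[OF ob \<phi>.X.act_pt[OF t p ob] g.X.act_pt[OF t q ob]] by blast
    from someI_ex[OF this] show "\<alpha> n \<theta> \<in> Hom C (P n) (P m)"
      "p m \<cdot> \<alpha> n \<theta> = act X n \<theta> \<cdot> p n" "q m \<cdot> \<alpha> n \<theta> = act A n \<theta> \<cdot> q n"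
      unfolding \<alpha>_def sdim_ops[OF t] by auto
  qed
  define S where "S = \<lparr>lev = P, act = \<alpha>\<rparr>"
  have S: "lev S = P" "act S = \<alpha>" unfolding S_def by auto
  have pa: "p m \<cdot> (\<alpha> n \<theta> \<cdot> x) = act X n \<theta> \<cdot> (p n \<cdot> x)" "q m \<cdot> (\<alpha> n \<theta> \<cdot> x) = act A n \<theta> \<cdot> (q n \<cdot> x)"
    if t: "\<theta> \<in> ops m n" and x: "x \<in> Hom C U (P n)" and U: "U \<in> Ob C" for m n \<theta> x U
  proof -
    show "p m \<cdot> (\<alpha> n \<theta> \<cdot> x) = act X n \<theta> \<cdot> (p n \<cdot> x)"
      using assoc[OF x \<alpha>(1)[OF t] p U ob ob b(1)] \<phi>.X.act_pre[OF t p x ob U] \<alpha>(2)[OF t] by simp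
    show "q m \<cdot> (\<alpha> n \<theta> \<cdot> x) = act A n \<theta> \<cdot> (q n \<cdot> x)"
      using assoc[OF x \<alpha>(1)[OF t] q U ob ob b(2)] g.X.act_pre[OF t q x ob U] \<alpha>(3)[OF t] by simp
  qed
  have sS: "simplicial_object C S"
    unfolding simplicial_object_def S
  proof (intro conjI allI ballI)
    fix n show "P n \<in> Ob C" by (rule ob)
    show "\<alpha> n [0..<Suc n] = Id C (P n)"
    proof (rule pullback_eqI[OF pb ob])
      show "\<alpha> n [0..<Suc n] \<in> Hom C (P n) (P n)" by (rule \<alpha>(1)[OF id_ops])
      show "Id C (P n) \<in> Hom C (P n) (P n)" by (rule Id_in_Hom[OF ob])
      show "p n \<cdot> \<alpha> n [0..<Suc n] = p n \<cdot> Id C (P n)"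
        using \<alpha>(2)[OF id_ops] \<phi>.X.act_id[OF p ob] Comp_Id[OF ob b(1) p] by simp
      show "q n \<cdot> \<alpha> n [0..<Suc n] = q n \<cdot> Id C (P n)"
        using \<alpha>(3)[OF id_ops] g.X.act_id[OF q ob] Comp_Id[OF ob b(2) q] by simp
    qed
  next
    fix m n \<theta> assume "\<theta> \<in> ops m n"
    then show "\<alpha> n \<theta> \<in> Hom C (P n) (P m)" by (rule \<alpha>(1))
  next
    fix l m n \<theta> \<psi> assume t: "\<theta> \<in> ops m n" and f: "\<psi> \<in> ops l m"
    note tf = op_comp_ops[OF t f]
    show "\<alpha> n (op_comp \<theta> \<psi>) = \<alpha> m \<psi> \<cdot> \<alpha> n \<theta>"
    proof (rule pullback_eqI[OF pb ob \<alpha>(1)[OF tf]])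
      show "\<alpha> m \<psi> \<cdot> \<alpha> n \<theta> \<in> Hom C (P n) (P l)"
        by (rule comp_hom[OF \<alpha>(1)[OF t] \<alpha>(1)[OF f] ob ob ob])
      show "p l \<cdot> \<alpha> n (op_comp \<theta> \<psi>) = p l \<cdot> (\<alpha> m \<psi> \<cdot> \<alpha> n \<theta>)"
        using pa(1)[OF f \<alpha>(1)[OF t] ob] \<alpha>(2)[OF t] \<alpha>(2)[OF tf] \<phi>.X.act_act[OF t f p ob] by simp
      show "q l \<cdot> \<alpha> n (op_comp \<theta> \<psi>) = q l \<cdot> (\<alpha> m \<psi> \<cdot> \<alpha> n \<theta>)"
        using pa(2)[OF f \<alpha>(1)[OF t] ob] \<alpha>(3)[OF t] \<alpha>(3)[OF tf] g.X.act_act[OF t f q ob] by simp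
    qed
  qed
  have "is_pullback (sCat C) X A B \<phi> g S p q"
    unfolding is_pullback_def
  proof (intro conjI ballI impI)
    show "X \<in> Ob (sCat C)" "A \<in> Ob (sCat C)" "B \<in> Ob (sCat C)" "S \<in> Ob (sCat C)"
      using \<phi>.X_simplicial g.X_simplicial g.Y_simplicial sS by (auto simp: sCat_def)
    show "\<phi> \<in> Hom (sCat C) X B" "g \<in> Hom (sCat C) A B"
      using \<phi>.simplicial_map g.simplicial_map by (auto simp: sCat_def)
    show "p \<in> Hom (sCat C) S X" "q \<in> Hom (sCat C) S A"
      using p q \<alpha> by (auto simp: sCat_def simplicial_maps_def S)
    show "\<phi> \<cdot>\<^bsub>sCat C\<^esub> p = g \<cdot>\<^bsub>sCat C\<^esub> q" using b(9) by (auto simp: sCat_def)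
    fix Z a c assume "Z \<in> Ob (sCat C)" and "a \<in> Hom (sCat C) Z X" "c \<in> Hom (sCat C) Z A"
      and e: "\<phi> \<cdot>\<^bsub>sCat C\<^esub> a = g \<cdot>\<^bsub>sCat C\<^esub> c"
    then interpret a: simplicial_map C Z X a + c: simplicial_map C Z A c
      using \<phi>.X_simplicial g.X_simplicial by unfold_locales (auto simp: sCat_def)
    have "\<phi> l \<cdot> a l = g l \<cdot> c l" for l using fun_cong[OF e, of l] by (simp add: sCat_def)
    then have "\<exists>!u. u \<in> Hom C (lev Z l) (P l) \<and> p l \<cdot> u = a l \<and> q l \<cdot> u = c l" for l
      using b(10)[OF a.X.lev_Ob a.map_hom c.map_hom] by blast
    then obtain w where w: "\<And>l. w l \<in> Hom C (lev Z l) (P l)" "\<And>l. p l \<cdot> w l = a l" "\<And>l. q l \<cdot> w l = c l"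
      by metis
    have "\<alpha> n \<theta> \<cdot> w n = w m \<cdot> act Z n \<theta>" if t: "\<theta> \<in> ops m n" for m n \<theta>
    proof (rule pullback_eqI[OF pb a.X.lev_Ob])
      note z = a.X.act_hom[OF t] and zo = a.X.lev_Ob
      have aI: "act X n \<theta> \<cdot> a n = a m \<cdot> act Z n \<theta>" "act A n \<theta> \<cdot> c n = c m \<cdot> act Z n \<theta>"
        using a.simplicial_map c.simplicial_map t unfolding simplicial_maps_def by auto
      show "\<alpha> n \<theta> \<cdot> w n \<in> Hom C (lev Z n) (P m)" by (rule comp_hom[OF w(1) \<alpha>(1)[OF t] zo ob ob])
      show "w m \<cdot> act Z n \<theta> \<in> Hom C (lev Z n) (P m)" by (rule comp_hom[OF z w(1) zo zo ob])
      show "p m \<cdot> (\<alpha> n \<theta> \<cdot> w n) = p m \<cdot> (w m \<cdot> act Z n \<theta>)"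
        using pa(1)[OF t w(1) zo] w(2) aI(1) assoc[OF z w(1) p zo zo ob b(1)] by simp
      show "q m \<cdot> (\<alpha> n \<theta> \<cdot> w n) = q m \<cdot> (w m \<cdot> act Z n \<theta>)"
        using pa(2)[OF t w(1) zo] w(3) aI(2) assoc[OF z w(1) q zo zo ob b(2)] by simp
    qed
    then have "w \<in> Hom (sCat C) Z S" using w(1) by (simp add: sCat_def simplicial_maps_def S)
    then show "\<exists>!u. u \<in> Hom (sCat C) Z S \<and> p \<cdot>\<^bsub>sCat C\<^esub> u = a \<and> q \<cdot>\<^bsub>sCat C\<^esub> u = c"
    proof (intro ex1I[of _ w] conjI)
      show "p \<cdot>\<^bsub>sCat C\<^esub> w = a" "q \<cdot>\<^bsub>sCat C\<^esub> w = c" using w by (auto simp: sCat_def)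
      fix u assume u: "u \<in> Hom (sCat C) Z S \<and> p \<cdot>\<^bsub>sCat C\<^esub> u = a \<and> q \<cdot>\<^bsub>sCat C\<^esub> u = c"
      show "u = w"
      proof
        fix l
        have ul: "u l \<in> Hom C (lev Z l) (P l)" using u by (auto simp: sCat_def simplicial_maps_def S)
        have "p l \<cdot> u l = a l" "q l \<cdot> u l = c l" using u by (auto simp: sCat_def)
        then show "u l = w l" using pullback_eqI[OF pb a.X.lev_Ob ul w(1)] w by simp
      qed
    qed
  qed
  then show ?thesis using pb S by (metis (no_types, lifting))
qed

text \<open>
  A levelwise pullback exists and is isomorphic to the given one, by uniqueness of pullbacks of
  simplicial objects.
\<close>

lemma sCat_pullback_levelwise:
  assumes pb: "is_pullback (sCat C) X A B \<phi> g P p q"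
    and ex: "\<And>l. \<exists>P p q. is_pullback C (lev X l) (lev A l) (lev B l) (\<phi> l) (g l) P p q"
  shows "is_pullback C (lev X l) (lev A l) (lev B l) (\<phi> l) (g l) (lev P l) (p l) (q l)"
proof -
  interpret S: category "sCat C" by (rule category_sCat) unfold_locales
  note b = S.is_pullbackD[OF pb]
  have "simplicial_map C X B \<phi>" "simplicial_map C A B g"
    using b(1-3,5,6) by unfold_locales (auto simp: sCat_def)
  then obtain P0 p0 q0 where pb0: "is_pullback (sCat C) X A B \<phi> g P0 p0 q0"
    and lw: "is_pullback C (lev X l) (lev A l) (lev B l) (\<phi> l) (g l) (lev P0 l) (p0 l) (q0 l)"
    using levelwise_pullback_exists[OF _ _ ex] by blast
  note c = S.is_pullbackD[OF pb0]
  obtain u where u: "u \<in> Hom (sCat C) P P0" "p0 \<cdot>\<^bsub>sCat C\<^esub> u = p" "q0 \<cdot>\<^bsub>sCat C\<^esub> u = q"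
    using c(10)[OF b(4,7,8,9)] by blast
  obtain v where v: "v \<in> Hom (sCat C) P0 P" "p \<cdot>\<^bsub>sCat C\<^esub> v = p0" "q \<cdot>\<^bsub>sCat C\<^esub> v = q0"
    using b(10)[OF c(4,7,8,9)] by blast
  have vu: "v \<cdot>\<^bsub>sCat C\<^esub> u = Id (sCat C) P"
  proof (rule S.pullback_eqI[OF pb b(4)])
    show "v \<cdot>\<^bsub>sCat C\<^esub> u \<in> Hom (sCat C) P P" by (rule S.comp_hom[OF u(1) v(1) b(4) c(4) b(4)])
    show "Id (sCat C) P \<in> Hom (sCat C) P P" by (rule S.Id_in_Hom[OF b(4)])
    show "p \<cdot>\<^bsub>sCat C\<^esub> (v \<cdot>\<^bsub>sCat C\<^esub> u) = p \<cdot>\<^bsub>sCat C\<^esub> Id (sCat C) P"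
      using S.assoc[OF u(1) v(1) b(7,4) c(4) b(4,1)] S.Comp_Id[OF b(4,1,7)] u(2) v(2) by simp
    show "q \<cdot>\<^bsub>sCat C\<^esub> (v \<cdot>\<^bsub>sCat C\<^esub> u) = q \<cdot>\<^bsub>sCat C\<^esub> Id (sCat C) P"
      using S.assoc[OF u(1) v(1) b(8,4) c(4) b(4,2)] S.Comp_Id[OF b(4,2,8)] u(3) v(3) by simp
  qed
  have uv: "u \<cdot>\<^bsub>sCat C\<^esub> v = Id (sCat C) P0"
  proof (rule S.pullback_eqI[OF pb0 c(4)])
    show "u \<cdot>\<^bsub>sCat C\<^esub> v \<in> Hom (sCat C) P0 P0" by (rule S.comp_hom[OF v(1) u(1) c(4) b(4) c(4)])
    show "Id (sCat C) P0 \<in> Hom (sCat C) P0 P0" by (rule S.Id_in_Hom[OF c(4)])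
    show "p0 \<cdot>\<^bsub>sCat C\<^esub> (u \<cdot>\<^bsub>sCat C\<^esub> v) = p0 \<cdot>\<^bsub>sCat C\<^esub> Id (sCat C) P0"
      using S.assoc[OF v(1) u(1) c(7,4) b(4) c(4,1)] S.Comp_Id[OF c(4,1,7)] u(2) v(2) by simp
    show "q0 \<cdot>\<^bsub>sCat C\<^esub> (u \<cdot>\<^bsub>sCat C\<^esub> v) = q0 \<cdot>\<^bsub>sCat C\<^esub> Id (sCat C) P0"
      using S.assoc[OF v(1) u(1) c(8,4) b(4) c(4,2)] S.Comp_Id[OF c(4,2,8)] u(3) v(3) by simp
  qed
  have "is_pullback C (lev X l) (lev A l) (lev B l) (\<phi> l) (g l) (lev P l) (p0 l \<cdot> u l) (q0 l \<cdot> u l)"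
  proof (rule pullback_iso[OF lw])
    show "lev P l \<in> Ob C" using b(4) by (simp add: sCat_def simplicial_object_def)
    show "u l \<in> Hom C (lev P l) (lev P0 l)" "v l \<in> Hom C (lev P0 l) (lev P l)"
      using u(1) v(1) by (auto simp: sCat_def simplicial_maps_def)
    show "v l \<cdot> u l = Id C (lev P l)" "u l \<cdot> v l = Id C (lev P0 l)"
      using fun_cong[OF vu, of l] fun_cong[OF uv, of l] by (auto simp: sCat_def)
  qed
  moreover have "p0 l \<cdot> u l = p l" "q0 l \<cdot> u l = q l"
    using fun_cong[OF u(2), of l] fun_cong[OF u(3), of l] by (auto simp: sCat_def)
  ultimately show ?thesis by simp
qed

end

section \<open>Joins\<close>

lemma id_join_ops: "\<theta> \<in> ops m l \<Longrightarrow> id_join a \<theta> \<in> ops (Suc a + m) (Suc a + l)"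
  by (auto simp: ops_iff id_join_def sorted_append sorted_map intro!: sorted_wrt_mono_rel[of \<theta> "(\<le>)"])

lemma nth_id_join:
  "v \<le> a \<Longrightarrow> id_join a \<theta> ! v = v"
  "\<lbrakk>a < v; v - Suc a < length \<theta>\<rbrakk> \<Longrightarrow> id_join a \<theta> ! v = Suc a + \<theta> ! (v - Suc a)"
  by (auto simp: id_join_def nth_append less_Suc_eq_le)

lemma id_join_id: "id_join a [0..<Suc l] = [0..<Suc (Suc a + l)]"
  by (intro nth_equalityI) (auto simp: id_join_def nth_append)

lemma op_comp_id_join:
  assumes "set \<sigma> \<subseteq> {..a}" "set \<tau> \<subseteq> {..<length \<theta>}"
  shows "op_comp (id_join a \<theta>) (\<sigma> @ map (\<lambda>j. Suc a + j) \<tau>) = \<sigma> @ map (\<lambda>j. Suc a + j) (op_comp \<theta> \<tau>)"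
  using assms by (auto simp: op_comp_def nth_id_join subset_iff intro!: map_idI)

lemma id_join_comp:
  "\<lbrakk>\<theta> \<in> ops m l; \<phi> \<in> ops h m\<rbrakk> \<Longrightarrow> op_comp (id_join a \<theta>) (id_join a \<phi>) = id_join a (op_comp \<theta> \<phi>)"
  using op_comp_id_join[of "[0..<Suc a]" a \<phi> \<theta>] unfolding id_join_def[of a \<phi>] id_join_def[of a "op_comp \<theta> \<phi>"]
  by (fastforce simp: ops_iff)

lemma simplex_join_cases:
  assumes "\<rho> \<in> simplex (Suc a + l)"
  obtains \<sigma> \<tau> where "\<rho> = \<sigma> @ map (\<lambda>j. Suc a + j) \<tau>" "\<sigma> \<in> insert [] (simplex a)" "\<tau> \<in> insert [] (simplex l)"
    "\<sigma> \<noteq> [] \<or> \<tau> \<noteq> []"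
proof -
  have "\<rho> \<in> join a (simplex a) (simplex l)" using assms join_simplex_simplex[of a l] by simp
  then show thesis using that unfolding join_def by blast
qed

lemma join_boundary_eq_faces: "join a (simplex_boundary a) (simplex l) = faces (Suc a + l) {..a}"
proof (intro set_eqI iffI)
  fix \<rho> assume *: "\<rho> \<in> join a (simplex_boundary a) (simplex l)"
  then have "\<rho> \<in> join a (simplex a) (simplex l)"
    unfolding join_def simplex_boundary_def by blast
  then have r: "\<rho> \<in> simplex (Suc a + l)" using join_simplex_simplex[of a l] by simp
  from * obtain \<sigma> \<tau> where rho: "\<rho> = \<sigma> @ map (\<lambda>j. Suc a + j) \<tau>"
    and s: "\<sigma> \<in> insert [] (simplex_boundary a)" unfolding join_def by blast
  obtain j where "j \<le> a" "j \<notin> set \<sigma>" using s by (fastforce simp: simplex_boundary_def)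
  then show "\<rho> \<in> faces (Suc a + l) {..a}"
    unfolding faces_def using r rho by (auto intro!: bexI[of _ j])
next
  fix \<rho> assume *: "\<rho> \<in> faces (Suc a + l) {..a}"
  then have "\<rho> \<in> simplex (Suc a + l)" by (simp add: faces_def)
  then obtain \<sigma> \<tau> where rho: "\<rho> = \<sigma> @ map (\<lambda>j. Suc a + j) \<tau>"
    and s: "\<sigma> \<in> insert [] (simplex a)" "\<tau> \<in> insert [] (simplex l)" "\<sigma> \<noteq> [] \<or> \<tau> \<noteq> []"
    by (rule simplex_join_cases)
  have "\<sigma> \<in> insert [] (simplex_boundary a)"
    using s * rho by (auto simp: simplex_boundary_def faces_def)
  then show "\<rho> \<in> join a (simplex_boundary a) (simplex l)"
    unfolding join_def using rho s(2,3) by blast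
qed

lemma id_join_faces_iff:
  assumes t: "\<theta> \<in> ops m l" and r: "\<rho> \<in> simplex (Suc a + m)"
  shows "op_comp (id_join a \<theta>) \<rho> \<in> faces (Suc a + l) {..a} \<longleftrightarrow> \<rho> \<in> faces (Suc a + m) {..a}"
proof -
  obtain \<sigma> \<tau> where *: "\<rho> = \<sigma> @ map (\<lambda>j. Suc a + j) \<tau>" "\<sigma> \<in> insert [] (simplex a)"
      "\<tau> \<in> insert [] (simplex m)"
    using simplex_join_cases[OF r] by blast
  have s: "set \<sigma> \<subseteq> {..a}" "set \<tau> \<subseteq> {..<length \<theta>}"
    using * t by (auto simp: simplex_iff ops_iff)
  have "(\<exists>j\<in>{..a}. j \<notin> set (op_comp (id_join a \<theta>) \<rho>)) \<longleftrightarrow> (\<exists>j\<in>{..a}. j \<notin> set \<rho>)"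
    unfolding *(1) op_comp_id_join[OF s] by auto
  then show ?thesis
    unfolding faces_def using r op_comp_simplex[OF id_join_ops[OF t] r] by auto
qed

text \<open>
  The map \<open>\<Delta>\<^sup>a \<star> \<Delta>\<^sup>l \<rightarrow> \<Delta>\<^sup>a \<star> \<Delta>\<^sup>0\<close> that collapses the second factor. On simplices it acts by
  \<open>map (min (Suc a))\<close>, a formula in which \<open>l\<close> does not occur; this makes its compatibility with the
  operators \<open>id_join a \<theta>\<close> immediate.
\<close>

definition collapse :: "nat \<Rightarrow> nat \<Rightarrow> nat list" where
  "collapse a l = id_join a (replicate (Suc l) 0)"

lemma replicate_ops: "replicate (Suc l) 0 \<in> ops l 0"
  by (auto simp: ops_iff sorted_replicate simp del: replicate_Suc)

lemma collapse_ops: "collapse a l \<in> ops (Suc a + l) (Suc a)"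
  using id_join_ops[OF replicate_ops, of a l] unfolding collapse_def by simp

lemma op_comp_collapse: "\<rho> \<in> simplex (Suc a + l) \<Longrightarrow> op_comp (collapse a l) \<rho> = map (min (Suc a)) \<rho>"
proof -
  assume r: "\<rho> \<in> simplex (Suc a + l)"
  have "collapse a l ! v = min (Suc a) v" if "v \<le> Suc a + l" for v
    using that unfolding collapse_def
    by (cases "v \<le> a") (auto simp: nth_id_join nth_replicate simp del: replicate_Suc)
  then show ?thesis unfolding op_comp_def using r by (auto simp: simplex_iff)
qed

lemma map_min_id_join:
  assumes "\<rho> \<in> simplex (Suc a + m)" "\<theta> \<in> ops m l"
  shows "map (min (Suc a)) (op_comp (id_join a \<theta>) \<rho>) = map (min (Suc a)) \<rho>"
proof -
  have "min (Suc a) (id_join a \<theta> ! v) = min (Suc a) v" if "v \<le> Suc a + m" for v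
    using that assms(2) by (cases "v \<le> a") (auto simp: nth_id_join ops_iff)
  then show ?thesis unfolding op_comp_def using assms(1) by (auto simp: simplex_iff)
qed

lemma op_comp_replicate: "\<theta> \<in> ops m l \<Longrightarrow> op_comp (replicate (Suc l) 0) \<theta> = replicate (Suc m) 0"
  by (intro nth_equalityI) (auto simp: ops_iff op_comp_def less_Suc_eq_le all_set_conv_all_nth simp del: replicate_Suc)

lemma id_join_collapse: "\<theta> \<in> ops m l \<Longrightarrow> op_comp (collapse a l) (id_join a \<theta>) = collapse a m"
  unfolding collapse_def by (subst id_join_comp[OF replicate_ops]) (auto simp: op_comp_replicate simp del: replicate_Suc)

section \<open>Points of the relative higher morphism space\<close>

lemma simplicial_object_join_power:
  assumes "simplicial_object C X"
  shows "simplicial_object C (join_power a X)"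
  unfolding simplicial_object_def
proof (intro conjI allI ballI)
  fix n show "lev (join_power a X) n \<in> Ob C"
    using assms unfolding simplicial_object_def join_power_def by simp
  show "act (join_power a X) n [0..<Suc n] = Id C (lev (join_power a X) n)"
    using assms unfolding simplicial_object_def join_power_def by (simp add: id_join_id[simplified])
next
  fix m n \<theta> assume "\<theta> \<in> ops m n"
  then show "act (join_power a X) n \<theta> \<in> Hom C (lev (join_power a X) n) (lev (join_power a X) m)"
    using assms id_join_ops[of \<theta> m n a] unfolding simplicial_object_def join_power_def by simp
next
  fix l m n \<theta> \<phi> assume t: "\<theta> \<in> ops m n" "\<phi> \<in> ops l m"
  have "act X (Suc a + n) (op_comp (id_join a \<theta>) (id_join a \<phi>)) =
      act X (Suc a + m) (id_join a \<phi>) \<cdot>\<^bsub>C\<^esub> act X (Suc a + n) (id_join a \<theta>)"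
    using assms id_join_ops[OF t(1), of a] id_join_ops[OF t(2), of a] unfolding simplicial_object_def by blast
  then show "act (join_power a X) n (op_comp \<theta> \<phi>) =
      act (join_power a X) m \<phi> \<cdot>\<^bsub>C\<^esub> act (join_power a X) n \<theta>"
    by (simp add: join_power_def id_join_comp[OF t])
qed

lemma is_rel_join_powerD:
  assumes "is_rel_join_power C a (simplex_boundary a) X Y f B \<xi> \<eta>"
  shows "simplicial_object C B"
    "is_rel_hom C (faces (Suc a + l) {..a}) (Suc a + l) X Y f (lev B l) (\<xi> l) (\<eta> l)"
    "\<lbrakk>\<theta> \<in> ops m l; \<sigma> \<in> faces (Suc a + m) {..a}\<rbrakk> \<Longrightarrow>
      \<xi> m \<sigma> \<cdot>\<^bsub>C\<^esub> act B l \<theta> = \<xi> l (op_comp (id_join a \<theta>) \<sigma>)"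
    "\<theta> \<in> ops m l \<Longrightarrow> \<eta> m \<cdot>\<^bsub>C\<^esub> act B l \<theta> = act Y (Suc a + l) (id_join a \<theta>) \<cdot>\<^bsub>C\<^esub> \<eta> l"
  using assms unfolding is_rel_join_power_def join_boundary_eq_faces by blast+

context simplicial_map
begin

text \<open>
  The operators \<open>1 \<star> \<theta>\<close> map \<open>\<partial>\<Delta>\<^sup>a \<star> \<Delta>\<^sup>m\<close> into \<open>\<partial>\<Delta>\<^sup>a \<star> \<Delta>\<^sup>l\<close>, so universal points pull back along them and
  induce the structure maps of \<open>B\<close>.
\<close>

lemma rel_join_power_exists:
  assumes rep: "\<And>l. \<exists>L \<xi> \<eta>. is_rel_hom C (faces (Suc a + l) {..a}) (Suc a + l) X Y f L \<xi> \<eta>"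
  shows "\<exists>B \<xi> \<eta>. is_rel_join_power C a (simplex_boundary a) X Y f B \<xi> \<eta>"
proof -
  let ?F = "\<lambda>l. faces (Suc a + l) {..a}"
  obtain B \<xi> \<eta> where L: "\<And>l. is_rel_hom C (?F l) (Suc a + l) X Y f (B l) (\<xi> l) (\<eta> l)"
    using rep by metis
  note h = is_rel_homD[OF L]
  note ob = h(1)
  note pt = ptsD[OF h(2)]
  define ind where "ind l m \<theta> u \<longleftrightarrow> u \<in> Hom C (B l) (B m) \<and>
      (\<forall>\<sigma> \<in> ?F m. \<xi> m \<sigma> \<cdot> u = \<xi> l (op_comp (id_join a \<theta>) \<sigma>)) \<and>
      \<eta> m \<cdot> u = act Y (Suc a + l) (id_join a \<theta>) \<cdot> \<eta> l" for l m \<theta> u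
  have ex: "\<exists>!u. ind l m \<theta> u" if t: "\<theta> \<in> ops m l" for l m \<theta>
  proof -
    have "(\<lambda>\<sigma>. \<xi> l (op_comp (id_join a \<theta>) \<sigma>), act Y (Suc a + l) (id_join a \<theta>) \<cdot> \<eta> l)
        \<in> pts (?F m) (Suc a + m) (B l)"
      using id_join_faces_iff[OF t] faces_subset
      by (intro pts_pull[OF h(2) subcomplex_faces id_join_ops[OF t] _ ob]) blast
    from h(3)[OF ob this] show ?thesis unfolding ind_def .
  qed
  define \<alpha> where "\<alpha> l \<theta> = (THE u. ind l (sdim \<theta>) \<theta> u)" for l \<theta>
  have "ind l m \<theta> (\<alpha> l \<theta>)" if t: "\<theta> \<in> ops m l" for l m \<theta>
    using theI'[OF ex[OF t]] unfolding \<alpha>_def sdim_ops[OF t] .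
  then have \<alpha>: "\<alpha> l \<theta> \<in> Hom C (B l) (B m)"
      "\<And>\<sigma>. \<sigma> \<in> ?F m \<Longrightarrow> \<xi> m \<sigma> \<cdot> \<alpha> l \<theta> = \<xi> l (op_comp (id_join a \<theta>) \<sigma>)"
      "\<eta> m \<cdot> \<alpha> l \<theta> = act Y (Suc a + l) (id_join a \<theta>) \<cdot> \<eta> l"
    if "\<theta> \<in> ops m l" for l m \<theta>
    using that unfolding ind_def by blast+
  define S where "S = \<lparr>lev = B, act = \<alpha>\<rparr>"
  have S: "lev S = B" "act S = \<alpha>" unfolding S_def by auto
  have "simplicial_object C S"
    unfolding simplicial_object_def S
  proof (intro conjI allI ballI)
    fix n show "B n \<in> Ob C" by (rule ob)
    show "\<alpha> n [0..<Suc n] = Id C (B n)"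
    proof (rule is_rel_hom_eqI[OF L faces_subset ob])
      show "\<alpha> n [0..<Suc n] \<in> Hom C (B n) (B n)" by (rule \<alpha>(1)[OF id_ops])
      show "Id C (B n) \<in> Hom C (B n) (B n)" by (rule Id_in_Hom[OF ob])
      show "\<eta> n \<cdot> \<alpha> n [0..<Suc n] = \<eta> n \<cdot> Id C (B n)"
        using \<alpha>(3)[OF id_ops] Y.act_id[OF pt(2) ob] Comp_Id[OF ob Y.lev_Ob pt(2)] id_join_id by simp
      fix \<sigma> assume s: "\<sigma> \<in> ?F n"
      then show "\<xi> n \<sigma> \<cdot> \<alpha> n [0..<Suc n] = \<xi> n \<sigma> \<cdot> Id C (B n)"
        using \<alpha>(2)[OF id_ops s] Comp_Id[OF ob X.lev_Ob pt(4)[OF s]] id_join_id[of a n]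
          op_comp_id_left[OF subcomplexD(2)[OF subcomplex_faces s]] by simp
    qed
  next
    fix m n \<theta> assume "\<theta> \<in> ops m n"
    then show "\<alpha> n \<theta> \<in> Hom C (B n) (B m)" by (rule \<alpha>(1))
  next
    fix l m n \<theta> \<psi> assume t: "\<theta> \<in> ops m n" and f: "\<psi> \<in> ops l m"
    note tf = op_comp_ops[OF t f]
    note it = id_join_ops[OF t, of a] and jf = id_join_ops[OF f, of a]
    show "\<alpha> n (op_comp \<theta> \<psi>) = \<alpha> m \<psi> \<cdot> \<alpha> n \<theta>"
    proof (rule is_rel_hom_eqI[OF L faces_subset ob \<alpha>(1)[OF tf]])
      show "\<alpha> m \<psi> \<cdot> \<alpha> n \<theta> \<in> Hom C (B n) (B l)"
        by (rule comp_hom[OF \<alpha>(1)[OF t] \<alpha>(1)[OF f] ob ob ob])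
      have "\<eta> l \<cdot> (\<alpha> m \<psi> \<cdot> \<alpha> n \<theta>) = act Y (Suc a + m) (id_join a \<psi>) \<cdot> \<eta> m \<cdot> \<alpha> n \<theta>"
        using assoc[OF \<alpha>(1)[OF t] \<alpha>(1)[OF f] pt(2) ob ob ob Y.lev_Ob] \<alpha>(3)[OF f] by simp
      also have "\<dots> = act Y (Suc a + m) (id_join a \<psi>) \<cdot> (act Y (Suc a + n) (id_join a \<theta>) \<cdot> \<eta> n)"
        using Y.act_pre[OF jf pt(2) \<alpha>(1)[OF t] ob ob] \<alpha>(3)[OF t] by simp
      also have "\<dots> = \<eta> l \<cdot> \<alpha> n (op_comp \<theta> \<psi>)"
        using Y.act_act[OF it jf pt(2) ob] \<alpha>(3)[OF tf] id_join_comp[OF t f] by simp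
      finally show "\<eta> l \<cdot> \<alpha> n (op_comp \<theta> \<psi>) = \<eta> l \<cdot> (\<alpha> m \<psi> \<cdot> \<alpha> n \<theta>)" by (rule sym)
      fix \<sigma> assume s: "\<sigma> \<in> ?F l"
      then have s': "op_comp (id_join a \<psi>) \<sigma> \<in> ?F m"
        using id_join_faces_iff[OF f] faces_subset by blast
      have "\<xi> l \<sigma> \<cdot> (\<alpha> m \<psi> \<cdot> \<alpha> n \<theta>) = \<xi> m (op_comp (id_join a \<psi>) \<sigma>) \<cdot> \<alpha> n \<theta>"
        using assoc[OF \<alpha>(1)[OF t] \<alpha>(1)[OF f] pt(4)[OF s] ob ob ob X.lev_Ob] \<alpha>(2)[OF f s] by simp
      also have "\<dots> = \<xi> n (op_comp (id_join a (op_comp \<theta> \<psi>)) \<sigma>)"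
        using \<alpha>(2)[OF t s'] op_comp_assoc[OF jf subcomplexD(2)[OF subcomplex_faces s]] id_join_comp[OF t f, of a, symmetric]
        by simp
      finally show "\<xi> l \<sigma> \<cdot> \<alpha> n (op_comp \<theta> \<psi>) = \<xi> l \<sigma> \<cdot> (\<alpha> m \<psi> \<cdot> \<alpha> n \<theta>)"
        using \<alpha>(2)[OF tf s] by simp
    qed
  qed
  then have "is_rel_join_power C a (simplex_boundary a) X Y f S \<xi> \<eta>"
    unfolding is_rel_join_power_def join_boundary_eq_faces S using L \<alpha>(2,3) by blast
  then show ?thesis by blast
qed

lemma restriction_simplicial_map:
  assumes B: "is_rel_join_power C a (simplex_boundary a) X Y f B \<xi> \<eta>"
    and r: "\<And>l. is_rel_restriction C (faces (Suc a + l) {..a}) (Suc a + l) X f (lev B l) (\<xi> l) (\<eta> l) (\<phi> l)"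
  shows "simplicial_map C (join_power a X) B \<phi>"
proof
  note b = is_rel_join_powerD[OF B]
  interpret B: simplicial_obj C B by unfold_locales (rule b(1))
  let ?F = "\<lambda>l. faces (Suc a + l) {..a}"
  note pt = ptsD[OF is_rel_homD(2)[OF b(2)]]
  have r: "\<phi> l \<in> Hom C (lev X (Suc a + l)) (lev B l)"
      "\<And>\<sigma>. \<sigma> \<in> ?F l \<Longrightarrow> \<xi> l \<sigma> \<cdot> \<phi> l = act X (Suc a + l) \<sigma>" "\<eta> l \<cdot> \<phi> l = f (Suc a + l)" for l
    using r[of l] unfolding is_rel_restriction_def is_restriction_def by auto
  show "simplicial_object C (join_power a X)" by (rule simplicial_object_join_power[OF X_simplicial])
  show "simplicial_object C B" by (rule b(1))
  have "act B n \<theta> \<cdot> \<phi> n = \<phi> m \<cdot> act X (Suc a + n) (id_join a \<theta>)" if t: "\<theta> \<in> ops m n" for m n \<theta>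
  proof (rule is_rel_hom_eqI[OF b(2) faces_subset X.lev_Ob])
    note it = id_join_ops[OF t, of a]
    note x = X.act_hom[OF it] and bt = B.act_hom[OF t]
    show "act B n \<theta> \<cdot> \<phi> n \<in> Hom C (lev X (Suc a + n)) (lev B m)"
      by (rule comp_hom[OF r(1) bt]) simp_all
    show "\<phi> m \<cdot> act X (Suc a + n) (id_join a \<theta>) \<in> Hom C (lev X (Suc a + n)) (lev B m)"
      by (rule comp_hom[OF x r(1)]) simp_all
    have "\<eta> m \<cdot> (act B n \<theta> \<cdot> \<phi> n) = act Y (Suc a + n) (id_join a \<theta>) \<cdot> f (Suc a + n)"
      using assoc[OF r(1) bt pt(2)] b(4)[OF t] Y.act_pre[OF it pt(2) r(1)] r(3) by simp
    also have "\<dots> = f (Suc a + m) \<cdot> act X (Suc a + n) (id_join a \<theta>)"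
      using simplicial_map it unfolding simplicial_maps_def by blast
    also have "\<dots> = \<eta> m \<cdot> (\<phi> m \<cdot> act X (Suc a + n) (id_join a \<theta>))"
      using assoc[OF x r(1) pt(2)] r(3) by simp
    finally show "\<eta> m \<cdot> (act B n \<theta> \<cdot> \<phi> n) = \<eta> m \<cdot> (\<phi> m \<cdot> act X (Suc a + n) (id_join a \<theta>))" .
    fix \<sigma> assume s: "\<sigma> \<in> ?F m"
    then have s': "op_comp (id_join a \<theta>) \<sigma> \<in> ?F n"
      using id_join_faces_iff[OF t] faces_subset by blast
    have "\<xi> m \<sigma> \<cdot> (act B n \<theta> \<cdot> \<phi> n) = act X (Suc a + n) (op_comp (id_join a \<theta>) \<sigma>)"
      using assoc[OF r(1) bt pt(4)[OF s]] b(3)[OF t s] r(2)[OF s'] by simp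
    also have "\<dots> = act X (Suc a + m) \<sigma> \<cdot> act X (Suc a + n) (id_join a \<theta>)"
      using X_simplicial it subcomplexD(2)[OF subcomplex_faces s] unfolding simplicial_object_def by blast
    also have "\<dots> = \<xi> m \<sigma> \<cdot> (\<phi> m \<cdot> act X (Suc a + n) (id_join a \<theta>))"
      using assoc[OF x r(1) pt(4)[OF s]] r(2)[OF s] by simp
    finally show "\<xi> m \<sigma> \<cdot> (act B n \<theta> \<cdot> \<phi> n) = \<xi> m \<sigma> \<cdot> (\<phi> m \<cdot> act X (Suc a + n) (id_join a \<theta>))" .
  qed
  then show "\<phi> \<in> simplicial_maps C (join_power a X) B"
    unfolding simplicial_maps_def using r(1) by (simp add: join_power_def)
qed

end

lemma (in simplicial_obj) degeneracies_simplicial_map: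
  "simplicial_map C (const_sobj C (lev X 0)) X (\<lambda>l. act X 0 (replicate (Suc l) 0))"
proof
  show "simplicial_object C (const_sobj C (lev X 0))" by (rule simplicial_object_const[OF lev_Ob])
  show "simplicial_object C X" by (rule simplicial_object)
  have "act X n \<theta> \<cdot> act X 0 (replicate (Suc n) 0) = act X 0 (replicate (Suc m) 0)"
    if t: "\<theta> \<in> ops m n" for m n \<theta>
    using simplicial_object t replicate_ops[of n] op_comp_replicate[OF t] unfolding simplicial_object_def
    by metis
  then show "(\<lambda>l. act X 0 (replicate (Suc l) 0)) \<in> simplicial_maps C (const_sobj C (lev X 0)) X"
    unfolding simplicial_maps_def const_sobj_def
    using act_hom[OF replicate_ops] Comp_Id[OF lev_Ob lev_Ob act_hom[OF replicate_ops]] by auto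
qed

text \<open>
  The relative higher morphism space \<open>P\<close> for \<open>k = a + 1\<close>, described by its points alone: \<open>D\<close> stands
  for \<open>\<Lambda>\<^sup>k\<^sub>k(f)\<close> with universal point \<open>(\<xi>, \<eta>)\<close>, and a point of \<open>P\<^sub>l\<close> is a simplex \<open>t\<close> of \<open>X\<close> with a point
  \<open>b\<close> of \<open>D\<close> that prescribes \<open>t\<close> on \<open>\<partial>\<Delta>\<^sup>a \<star> \<Delta>\<^sup>l\<close> and its image in \<open>Y\<close> through the collapse.
\<close>

locale higher_morphisms = simplicial_map C X Y f
  for C :: "('o, 'm) cat" (structure) and X Y :: "('o, 'm) sobj" and f :: "nat \<Rightarrow> 'm" +
  fixes a :: nat and P :: "('o, 'm) sobj" and D :: 'o and \<xi> :: "nat list \<Rightarrow> 'm" and \<eta> :: 'm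
    and p q :: "nat \<Rightarrow> 'm"
  assumes P_simplicial: "simplicial_object C P"
    and D [simp]: "D \<in> Ob C"
    and base_pt: "(\<xi>, \<eta>) \<in> rel_hom_points C (faces (Suc a) {..a}) (Suc a) X Y f D"
    and p_hom: "p l \<in> Hom C (lev P l) (lev X (Suc a + l))"
    and q_hom: "q l \<in> Hom C (lev P l) D"
    and p_act: "\<theta> \<in> ops m l \<Longrightarrow> p m \<cdot> act P l \<theta> = act X (Suc a + l) (id_join a \<theta>) \<cdot> p l"
    and q_act: "\<theta> \<in> ops m l \<Longrightarrow> q m \<cdot> act P l \<theta> = q l"
    and p_boundary: "\<rho> \<in> faces (Suc a + l) {..a} \<Longrightarrow>
      act X (Suc a + l) \<rho> \<cdot> p l = \<xi> (map (min (Suc a)) \<rho>) \<cdot> q l"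
    and p_base: "f (Suc a + l) \<cdot> p l = act Y (Suc a) (collapse a l) \<cdot> (\<eta> \<cdot> q l)"
    and univ: "\<lbrakk>U \<in> Ob C; t \<in> Hom C U (lev X (Suc a + l)); b \<in> Hom C U D;
      \<And>\<rho>. \<rho> \<in> faces (Suc a + l) {..a} \<Longrightarrow> act X (Suc a + l) \<rho> \<cdot> t = \<xi> (map (min (Suc a)) \<rho>) \<cdot> b;
      f (Suc a + l) \<cdot> t = act Y (Suc a) (collapse a l) \<cdot> (\<eta> \<cdot> b)\<rbrakk>
      \<Longrightarrow> \<exists>!u. u \<in> Hom C U (lev P l) \<and> p l \<cdot> u = t \<and> q l \<cdot> u = b"

text \<open>
  Two arrows into \<open>B\<^sub>l\<close> are equal iff they give the same point of the limit that \<open>B\<^sub>l\<close> represents, and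
  the iterated degeneracy \<open>B\<^sub>0 \<rightarrow> B\<^sub>l\<close> acts on points by restriction along the collapse. This translates
  the pullback condition into conditions on simplices.
\<close>

lemma (in simplicial_map) higher_morphisms_of_pullback:
  assumes B: "is_rel_join_power C a (simplex_boundary a) X Y f B \<xi> \<eta>"
    and r: "\<And>l. is_rel_restriction C (faces (Suc a + l) {..a}) (Suc a + l) X f (lev B l) (\<xi> l) (\<eta> l) (\<phi> l)"
    and pb: "is_pullback (sCat C) (join_power a X) (const_sobj C (lev B 0)) B \<phi>
      (\<lambda>l. act B 0 (replicate (Suc l) 0)) P p q"
    and lw: "\<And>l. is_pullback C (lev X (Suc a + l)) (lev B 0) (lev B l) (\<phi> l)
      (act B 0 (replicate (Suc l) 0)) (lev P l) (p l) (q l)"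
  shows "higher_morphisms C X Y f a P (lev B 0) (\<xi> 0) (\<eta> 0) p q"
proof -
  interpret S: category "sCat C" by (rule category_sCat) unfold_locales
  note b = is_rel_join_powerD[OF B]
  interpret B: simplicial_obj C B by unfold_locales (rule b(1))
  let ?F = "\<lambda>l. faces (Suc a + l) {..a}"
  note pt = ptsD[OF is_rel_homD(2)[OF b(2)]]
  have r: "\<phi> l \<in> Hom C (lev X (Suc a + l)) (lev B l)"
      "\<And>\<sigma>. \<sigma> \<in> ?F l \<Longrightarrow> \<xi> l \<sigma> \<cdot> \<phi> l = act X (Suc a + l) \<sigma>" "\<eta> l \<cdot> \<phi> l = f (Suc a + l)" for l
    using r[of l] unfolding is_rel_restriction_def is_restriction_def by auto
  note s = S.is_pullbackD[OF pb] and w = is_pullbackD[OF lw]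
  have \<phi>_boundary: "act X (Suc a + l) \<rho> \<cdot> t = \<xi> l \<rho> \<cdot> (\<phi> l \<cdot> t)"
    if "\<rho> \<in> ?F l" "U \<in> Ob C" "t \<in> Hom C U (lev X (Suc a + l))" for l \<rho> U t
    using assoc[OF that(3) r(1) pt(4)[OF that(1)]] r(2)[OF that(1)] that(2) by simp
  have \<phi>_base: "f (Suc a + l) \<cdot> t = \<eta> l \<cdot> (\<phi> l \<cdot> t)"
    if "U \<in> Ob C" "t \<in> Hom C U (lev X (Suc a + l))" for l U t
    using assoc[OF that(2) r(1) pt(2)] r(3) that(1) by simp
  have deg_boundary: "\<xi> l \<rho> \<cdot> (act B 0 (replicate (Suc l) 0) \<cdot> u) = \<xi> 0 (map (min (Suc a)) \<rho>) \<cdot> u"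
    if "\<rho> \<in> ?F l" "U \<in> Ob C" "u \<in> Hom C U (lev B 0)" for l \<rho> U u
    using assoc[OF that(3) B.act_hom[OF replicate_ops] pt(4)[OF that(1)]] b(3)[OF replicate_ops that(1)]
      op_comp_collapse[of \<rho> a l] that(1,2) faces_subset[of "Suc a + l" "{..a}"]
    unfolding collapse_def by auto
  have deg_base: "\<eta> l \<cdot> (act B 0 (replicate (Suc l) 0) \<cdot> u) = act Y (Suc a) (collapse a l) \<cdot> (\<eta> 0 \<cdot> u)"
    if "U \<in> Ob C" "u \<in> Hom C U (lev B 0)" for l U u
    using assoc[OF that(2) B.act_hom[OF replicate_ops] pt(2)] b(4)[OF replicate_ops]
      Y.act_pre[OF _ pt(2) that(2), of "collapse a l" "Suc a + l"] collapse_ops[of a l] that(1)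
    unfolding collapse_def by simp
  have Pob: "lev P l \<in> Ob C" and ph: "p l \<in> Hom C (lev P l) (lev X (Suc a + l))"
    and qh: "q l \<in> Hom C (lev P l) (lev B 0)" for l
    by (rule w(4), rule w(7), rule w(8))
  show ?thesis
  proof
    show "simplicial_object C P" using s(4) by (simp add: sCat_def)
    show "lev B 0 \<in> Ob C" by simp
    show "(\<xi> 0, \<eta> 0) \<in> pts (faces (Suc a) {..a}) (Suc a) (lev B 0)"
      using is_rel_homD(2)[OF b(2), of 0] by simp
    show "p l \<in> Hom C (lev P l) (lev X (Suc a + l))" for l by (rule ph)
    show "q l \<in> Hom C (lev P l) (lev B 0)" for l by (rule qh)
    show "act X (Suc a + l) \<rho> \<cdot> p l = \<xi> 0 (map (min (Suc a)) \<rho>) \<cdot> q l" if "\<rho> \<in> ?F l" for \<rho> l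
      using \<phi>_boundary[OF that Pob ph] deg_boundary[OF that Pob qh] w(9) by simp
    show "f (Suc a + l) \<cdot> p l = act Y (Suc a) (collapse a l) \<cdot> (\<eta> 0 \<cdot> q l)" for l
      using \<phi>_base[OF Pob ph] deg_base[OF Pob qh] w(9) by simp
  next
    fix m l \<theta> assume t: "\<theta> \<in> ops m l"
    have "act (join_power a X) l \<theta> \<cdot> p l = p m \<cdot> act P l \<theta>"
      using s(7) t unfolding sCat_def simplicial_maps_def by simp
    then show "p m \<cdot> act P l \<theta> = act X (Suc a + l) (id_join a \<theta>) \<cdot> p l" by (simp add: join_power_def)
    have "Id C (lev B 0) \<cdot> q l = q m \<cdot> act P l \<theta>"
      using s(8) t unfolding sCat_def simplicial_maps_def const_sobj_def by simp
    then show "q m \<cdot> act P l \<theta> = q l" using Id_Comp[OF Pob B.lev_Ob qh] by simp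
  next
    fix U t l u
    assume U: "U \<in> Ob C" and t: "t \<in> Hom C U (lev X (Suc a + l))" and u: "u \<in> Hom C U (lev B 0)"
      and 1: "\<And>\<rho>. \<rho> \<in> ?F l \<Longrightarrow> act X (Suc a + l) \<rho> \<cdot> t = \<xi> 0 (map (min (Suc a)) \<rho>) \<cdot> u"
      and 2: "f (Suc a + l) \<cdot> t = act Y (Suc a) (collapse a l) \<cdot> (\<eta> 0 \<cdot> u)"
    have "\<phi> l \<cdot> t = act B 0 (replicate (Suc l) 0) \<cdot> u"
    proof (rule is_rel_hom_eqI[OF b(2) faces_subset U])
      show "\<phi> l \<cdot> t \<in> Hom C U (lev B l)" by (rule comp_hom[OF t r(1) U]) simp_all
      show "act B 0 (replicate (Suc l) 0) \<cdot> u \<in> Hom C U (lev B l)" by (rule B.act_pt[OF replicate_ops u U])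
      show "\<xi> l \<rho> \<cdot> (\<phi> l \<cdot> t) = \<xi> l \<rho> \<cdot> (act B 0 (replicate (Suc l) 0) \<cdot> u)" if "\<rho> \<in> ?F l" for \<rho>
        using \<phi>_boundary[OF that U t] deg_boundary[OF that U u] 1[OF that] by simp
      show "\<eta> l \<cdot> (\<phi> l \<cdot> t) = \<eta> l \<cdot> (act B 0 (replicate (Suc l) 0) \<cdot> u)"
        using \<phi>_base[OF U t] deg_base[OF U u] 2 by simp
    qed
    then show "\<exists>!v. v \<in> Hom C U (lev P l) \<and> p l \<cdot> v = t \<and> q l \<cdot> v = u"
      by (rule w(10)[OF U t u])
  qed
qed

section \<open>Horns in the relative higher morphism space\<close>

lemma vertex_in_horn: "\<lbrakk>0 < m; i \<le> m\<rbrakk> \<Longrightarrow> [i] \<in> horn m i"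
  unfolding horn_def simplex_iff
  by (cases "i = 0") (auto intro: exI[of _ m] exI[of _ "0::nat"])

text \<open>
  Connectedness of horns: \<open>g\<close> is invariant under faces and degeneracies, every simplex has its first
  vertex as a face, and any vertex of the horn is joined to the vertex \<open>i\<close> by an edge in the horn.
\<close>

lemma constant_on_horn:
  assumes "i \<le> m" "\<tau> \<in> horn m i"
    and g: "\<And>\<tau> h \<theta>. \<lbrakk>\<tau> \<in> horn m i; \<theta> \<in> ops h (sdim \<tau>)\<rbrakk> \<Longrightarrow> g (op_comp \<tau> \<theta>) = g \<tau>"
  shows "g \<tau> = g [i]"
proof -
  have t: "\<tau> \<in> simplex m" using assms(2) by (simp add: horn_def)
  then have ne: "\<tau> \<noteq> []" by (simp add: simplex_iff)
  let ?v = "\<tau> ! 0"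
  have v: "?v \<in> set \<tau>" "?v \<le> m" using ne t by (auto simp: simplex_iff)
  have 1: "g [?v] = g \<tau>"
    using g[OF assms(2), of "[0]" 0] by (simp add: ops_iff op_comp_def)
  \<comment> \<open>A vertex omitted by \<open>\<tau>\<close> is also omitted by the edge, so the edge stays in the horn.\<close>
  obtain j where j: "j \<le> m" "j \<noteq> i" "j \<notin> set \<tau>" using assms(2) by (auto simp: horn_def)
  let ?e = "if ?v \<le> i then [?v, i] else [i, ?v]"
  have e: "?e \<in> horn m i"
    unfolding horn_def using v j assms(1) by (auto simp: simplex_iff intro!: exI[of _ j])
  have ops: "[0] \<in> ops 0 (sdim ?e)" "[1] \<in> ops 0 (sdim ?e)" by (auto simp: ops_iff sdim_def)
  have "g [?v] = g [i]"
    using g[OF e ops(1)] g[OF e ops(2)] by (auto simp: op_comp_def split: if_splits)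
  then show ?thesis using 1 by simp
qed

definition join_head :: "nat \<Rightarrow> nat list \<Rightarrow> nat list" where
  "join_head a \<rho> = filter (\<lambda>v. v \<le> a) \<rho>"

definition join_tail :: "nat \<Rightarrow> nat list \<Rightarrow> nat list" where
  "join_tail a \<rho> = map (\<lambda>v. v - Suc a) (filter (\<lambda>v. \<not> v \<le> a) \<rho>)"

lemma join_parts:
  assumes "set \<sigma> \<subseteq> {..a}"
  shows "join_head a (\<sigma> @ map (\<lambda>j. Suc a + j) \<tau>) = \<sigma>" "join_tail a (\<sigma> @ map (\<lambda>j. Suc a + j) \<tau>) = \<tau>"
proof -
  have "filter (\<lambda>v. v \<le> a) \<sigma> = \<sigma>" "filter (\<lambda>v. \<not> v \<le> a) \<sigma> = []"
    using assms by (auto simp: filter_id_conv filter_empty_conv)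
  then show "join_head a (\<sigma> @ map (\<lambda>j. Suc a + j) \<tau>) = \<sigma>" "join_tail a (\<sigma> @ map (\<lambda>j. Suc a + j) \<tau>) = \<tau>"
    unfolding join_head_def join_tail_def by (auto simp: filter_map comp_def)
qed

lemma join_standard_simplex:
  "\<sigma> \<in> insert [] (simplex a) \<Longrightarrow> \<sigma> @ map (\<lambda>j. Suc a + j) [0..<Suc r] \<in> simplex (Suc a + r)"
  by (auto simp: simplex_iff sorted_append sorted_map intro!: sorted_wrt_mono_rel[of "[0..<Suc r]" "(\<le>)"])

context higher_morphisms
begin

sublocale P: simplicial_obj C P
  by unfold_locales (rule P_simplicial)

lemma p_pt: "\<lbrakk>w \<in> Hom C U (lev P l); U \<in> Ob C\<rbrakk> \<Longrightarrow> p l \<cdot> w \<in> Hom C U (lev X (Suc a + l))"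
  by (rule comp_hom[OF _ p_hom]) simp_all

lemma q_pt: "\<lbrakk>w \<in> Hom C U (lev P l); U \<in> Ob C\<rbrakk> \<Longrightarrow> q l \<cdot> w \<in> Hom C U D"
  by (rule comp_hom[OF _ q_hom]) simp_all

lemma p_pre:
  "\<lbrakk>w \<in> Hom C U (lev P l); u \<in> Hom C V U; U \<in> Ob C; V \<in> Ob C\<rbrakk> \<Longrightarrow> p l \<cdot> w \<cdot> u = p l \<cdot> (w \<cdot> u)"
  by (rule assoc[where W = V and X = U, OF _ _ p_hom]) simp_all

lemma q_pre:
  "\<lbrakk>w \<in> Hom C U (lev P l); u \<in> Hom C V U; U \<in> Ob C; V \<in> Ob C\<rbrakk> \<Longrightarrow> q l \<cdot> w \<cdot> u = q l \<cdot> (w \<cdot> u)"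
  by (rule assoc[where W = V and X = U, OF _ _ q_hom]) simp_all

lemma p_act_pt:
  assumes "\<theta> \<in> ops m l" "w \<in> Hom C U (lev P l)" "U \<in> Ob C"
  shows "p m \<cdot> (act P l \<theta> \<cdot> w) = act X (Suc a + l) (id_join a \<theta>) \<cdot> (p l \<cdot> w)"
  using assoc[OF assms(2) P.act_hom[OF assms(1)] p_hom] p_act[OF assms(1)]
    X.act_pre[OF id_join_ops[OF assms(1)] p_hom assms(2)] assms(3) by simp

lemma q_act_pt:
  assumes "\<theta> \<in> ops m l" "w \<in> Hom C U (lev P l)" "U \<in> Ob C"
  shows "q m \<cdot> (act P l \<theta> \<cdot> w) = q l \<cdot> w"
  using assoc[OF assms(2) P.act_hom[OF assms(1)] q_hom] q_act[OF assms(1)] assms(3) by simp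

lemma base_hom: "\<eta> \<in> Hom C D (lev Y (Suc a))"
    "\<rho> \<in> faces (Suc a) {..a} \<Longrightarrow> \<xi> \<rho> \<in> Hom C D (lev X (sdim \<rho>))"
  using ptsD[OF base_pt] by auto

lemma map_min_faces:
  "\<rho> \<in> faces (Suc a + l) {..a} \<Longrightarrow> map (min (Suc a)) \<rho> \<in> faces (Suc a) {..a}"
  using id_join_faces_iff[OF replicate_ops, of \<rho> a l] op_comp_collapse[of \<rho> a l]
  unfolding collapse_def by (auto simp: faces_def)

lemma boundary_pt:
  assumes "\<rho> \<in> faces (Suc a + l) {..a}" "w \<in> Hom C U (lev P l)" "U \<in> Ob C"
  shows "act X (Suc a + l) \<rho> \<cdot> (p l \<cdot> w) = \<xi> (map (min (Suc a)) \<rho>) \<cdot> (q l \<cdot> w)"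
proof -
  have r: "\<rho> \<in> ops (sdim \<rho>) (Suc a + l)" by (rule subcomplexD(2)[OF subcomplex_faces assms(1)])
  show ?thesis
    using X.act_pre[OF r p_hom assms(2)] assoc[OF assms(2) q_hom base_hom(2)[OF map_min_faces[OF assms(1)]]]
      p_boundary[OF assms(1)] assms(3) by simp
qed

lemma base_map_pt:
  assumes "w \<in> Hom C U (lev P l)" "U \<in> Ob C"
  shows "f (Suc a + l) \<cdot> (p l \<cdot> w) = act Y (Suc a) (collapse a l) \<cdot> (\<eta> \<cdot> (q l \<cdot> w))"
proof -
  have e: "\<eta> \<cdot> q l \<in> Hom C (lev P l) (lev Y (Suc a))" by (rule comp_hom[OF q_hom base_hom(1)]) simp_all
  show ?thesis
    using map_pre[OF p_hom assms(1)] Y.act_pre[OF collapse_ops e assms(1)] assoc[OF assms(1) q_hom base_hom(1)]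
      p_base assms(2) by simp
qed

lemma P_eqI:
  assumes "u \<in> Hom C U (lev P l)" "v \<in> Hom C U (lev P l)" "U \<in> Ob C"
    and "p l \<cdot> u = p l \<cdot> v" "q l \<cdot> u = q l \<cdot> v"
  shows "u = v"
  using univ[OF assms(3) p_pt[OF assms(2,3)] q_pt[OF assms(2,3)] boundary_pt[OF _ assms(2,3)]
      base_map_pt[OF assms(2,3)]] assms by metis

end

text \<open>
  A point \<open>x\<close> of \<open>P\<close> on a horn is turned into a point of the larger horn \<open>\<Lambda>\<^bsup>a+1+m\<^esup>\<^bsub>a+1+i\<^esub>\<close>
  relative to \<open>f\<close>.
\<close>

locale higher_morphisms_horn = higher_morphisms C X Y f a P D \<xi> \<eta> p q
  for C :: "('o, 'm) cat" (structure) and X Y f a P D \<xi> \<eta> p q +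
  fixes m i :: nat and W :: 'o and x :: "nat list \<Rightarrow> 'm"
  assumes m: "0 < m" and i: "i \<le> m" and W [simp]: "W \<in> Ob C"
    and x: "x \<in> hom_points C (horn m i) P W"
begin

lemma x_hom: "\<tau> \<in> horn m i \<Longrightarrow> x \<tau> \<in> Hom C W (lev P (sdim \<tau>))"
  by (rule hom_pointsD(1)[OF x])

lemma x_act: "\<lbrakk>\<tau> \<in> horn m i; \<theta> \<in> ops h (sdim \<tau>)\<rbrakk> \<Longrightarrow> x (op_comp \<tau> \<theta>) = act P (sdim \<tau>) \<theta> \<cdot> x \<tau>"
  by (rule hom_pointsD(2)[OF x])

lemma horn_ops: "\<tau> \<in> horn m i \<Longrightarrow> \<tau> \<in> ops (sdim \<tau>) m"
  by (rule subcomplexD(2)[OF subcomplex_horn])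

text \<open>
  The point of \<open>D\<close> underlying all values of \<open>x\<close>.
\<close>

definition common :: 'm where "common = q 0 \<cdot> x [i]"

lemma q_x:
  assumes "\<tau> \<in> horn m i"
  shows "q (sdim \<tau>) \<cdot> x \<tau> = common"
proof -
  let ?g = "\<lambda>\<tau>. q (sdim \<tau>) \<cdot> x \<tau>"
  have "?g (op_comp \<tau> \<theta>) = ?g \<tau>" if t: "\<tau> \<in> horn m i" and th: "\<theta> \<in> ops h (sdim \<tau>)" for \<tau> h \<theta>
    using x_act[OF t th] q_act_pt[OF th x_hom[OF t] W] sdim_ops[OF th] by simp
  from constant_on_horn[OF i assms, of ?g, OF this] show ?thesis
    unfolding common_def by (simp add: sdim_def)
qed

lemma common_hom: "common \<in> Hom C W D"
  using q_x[OF vertex_in_horn[OF m i]] q_pt[OF x_hom[OF vertex_in_horn[OF m i]] W] by simp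

text \<open>
  The restriction to \<open>\<Delta>\<^sup>a\<close> of all simplices \<open>p \<cdot> x \<tau>\<close>. By connectedness of the horn it does not depend
  on \<open>\<tau>\<close>, which gives the value of the glued point on simplices with empty back part.
\<close>

definition front :: 'm where "front = act X (Suc a) [0..<Suc a] \<cdot> (p 0 \<cdot> x [i])"

lemma front_ops: "[0..<Suc a] \<in> ops a (Suc a + l)"
  by (auto simp: ops_iff)

lemma front_x:
  assumes "\<tau> \<in> horn m i"
  shows "act X (Suc a + sdim \<tau>) [0..<Suc a] \<cdot> (p (sdim \<tau>) \<cdot> x \<tau>) = front"
proof -
  let ?g = "\<lambda>\<tau>. act X (Suc a + sdim \<tau>) [0..<Suc a] \<cdot> (p (sdim \<tau>) \<cdot> x \<tau>)"
  have "?g (op_comp \<tau> \<theta>) = ?g \<tau>" if t: "\<tau> \<in> horn m i" and th: "\<theta> \<in> ops h (sdim \<tau>)" for \<tau> h \<theta>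
  proof -
    have "op_comp (id_join a \<theta>) [0..<Suc a] = [0..<Suc a]"
      using op_comp_id_join[of "[0..<Suc a]" a "[]" \<theta>]
      by (simp add: op_comp_def atLeastLessThanSuc_atLeastAtMost atLeast0AtMost)
    then show ?thesis
      using x_act[OF t th] p_act_pt[OF th x_hom[OF t]] sdim_ops[OF th]
        X.act_act[OF id_join_ops[OF th] front_ops p_pt[OF x_hom[OF t]]] by simp
  qed
  from constant_on_horn[OF i assms, of ?g, OF this] show ?thesis
    unfolding front_def by (simp add: sdim_def)
qed

text \<open>
  On \<open>\<partial>\<Delta>\<^sup>a \<star> \<Delta>\<^sup>m\<close> the value is the one prescribed by \<open>common\<close>. A simplex \<open>\<sigma> \<star> \<tau>\<close> of \<open>\<Delta>\<^sup>a \<star> \<Lambda>\<^sup>m\<^sub>i\<close> is the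
  image of \<open>\<sigma> \<star> id\<close> under \<open>1 \<star> \<tau>\<close>, so its value is read off from \<open>x \<tau>\<close>; this normal form avoids a
  choice among the simplices of the horn through which \<open>\<sigma> \<star> \<tau>\<close> factors.
\<close>

definition glued :: "nat list \<Rightarrow> 'm" where
  "glued \<rho> =
    (if \<rho> \<in> faces (Suc a + m) {..a} then \<xi> (map (min (Suc a)) \<rho>) \<cdot> common
     else if join_tail a \<rho> = [] then act X a (join_head a \<rho>) \<cdot> front
     else act X (Suc a + sdim (join_tail a \<rho>))
            (join_head a \<rho> @ map (\<lambda>j. Suc a + j) [0..<length (join_tail a \<rho>)]) \<cdot>
          (p (sdim (join_tail a \<rho>)) \<cdot> x (join_tail a \<rho>)))"

text \<open>
  The value on \<open>\<Delta>\<^sup>a \<star> \<Lambda>\<^sup>m\<^sub>i\<close> can be computed from any factorization through \<open>1 \<star> \<tau>\<close>, not only from the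
  normal form. Compatibility with structure maps and with \<open>f\<close> then reduces to that of a single \<open>x \<tau>\<close>.
\<close>

lemma glued_join:
  assumes t: "\<tau> \<in> horn m i" and r: "\<rho> \<in> simplex (Suc a + sdim \<tau>)"
  shows "glued (op_comp (id_join a \<tau>) \<rho>) = act X (Suc a + sdim \<tau>) \<rho> \<cdot> (p (sdim \<tau>) \<cdot> x \<tau>)"
proof (cases "op_comp (id_join a \<tau>) \<rho> \<in> faces (Suc a + m) {..a}")
  case True
  then have "\<rho> \<in> faces (Suc a + sdim \<tau>) {..a}" using id_join_faces_iff[OF horn_ops[OF t] r] by blast
  then show ?thesis
    using True boundary_pt[OF _ x_hom[OF t]] q_x[OF t] map_min_id_join[OF r horn_ops[OF t]]
    unfolding glued_def by simp
next
  case False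
  obtain \<sigma> \<theta> where \<rho>: "\<rho> = \<sigma> @ map (\<lambda>j. Suc a + j) \<theta>" "\<sigma> \<in> insert [] (simplex a)"
    "\<theta> \<in> insert [] (simplex (sdim \<tau>))" "\<sigma> \<noteq> [] \<or> \<theta> \<noteq> []"
    using r by (rule simplex_join_cases)
  have s: "set \<sigma> \<subseteq> {..a}" using \<rho>(2) by (auto simp: simplex_iff)
  have "length \<tau> = Suc (sdim \<tau>)" using horn_ops[OF t] by (simp add: ops_iff)
  then have th: "set \<theta> \<subseteq> {..<length \<tau>}" using \<rho>(3) by (auto simp: simplex_iff)
  note j = op_comp_id_join[OF s th]
  note parts = join_parts[OF s, of "op_comp \<tau> \<theta>"]
  note px = p_pt[OF x_hom[OF t] W]
  show ?thesis
  proof (cases "\<theta> = []")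
    case True
    then have "\<sigma> \<in> simplex a" using \<rho> by auto
    then have sa: "\<sigma> \<in> ops (sdim \<sigma>) a" by (rule simplex_ops)
    have "glued (op_comp (id_join a \<tau>) \<rho>) = act X a \<sigma> \<cdot> front"
      using False True parts j \<rho>(1) unfolding glued_def by (simp add: op_comp_def)
    also have "\<dots> = act X (Suc a + sdim \<tau>) \<sigma> \<cdot> (p (sdim \<tau>) \<cdot> x \<tau>)"
      using X.act_act[OF front_ops sa px W] front_x[OF t] op_comp_id_left[OF sa] by simp
    finally show ?thesis using \<rho>(1) True by simp
  next
    case False': False
    let ?\<omega> = "\<sigma> @ map (\<lambda>j. Suc a + j) [0..<Suc (sdim \<theta>)]"
    have "\<theta> \<in> simplex (sdim \<tau>)" using False' \<rho>(3) by simp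
    then have o: "\<theta> \<in> ops (sdim \<theta>) (sdim \<tau>)" by (rule simplex_ops)
    have l: "length (op_comp \<tau> \<theta>) = Suc (sdim \<theta>)" "op_comp \<tau> \<theta> \<noteq> []"
      using o False' by (auto simp: ops_iff op_comp_def)
    have w: "?\<omega> \<in> simplex (Suc a + sdim \<theta>)" by (rule join_standard_simplex[OF \<rho>(2)])
    have "op_comp (id_join a \<theta>) ?\<omega> = \<rho>"
      using op_comp_id_join[OF s, of "[0..<Suc (sdim \<theta>)]" \<theta>] o op_comp_id_right[OF o] \<rho>(1)
      by (auto simp: ops_iff atLeast0LessThan)
    moreover have "glued (op_comp (id_join a \<tau>) \<rho>) =
        act X (Suc a + sdim \<theta>) ?\<omega> \<cdot> (p (sdim \<theta>) \<cdot> x (op_comp \<tau> \<theta>))"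
      using False parts j \<rho>(1) l unfolding glued_def by (simp del: add_Suc)
    ultimately show ?thesis
      using x_act[OF t o] p_act_pt[OF o x_hom[OF t] W]
        X.act_act[OF id_join_ops[OF o] simplex_ops[OF w] px W] by simp
  qed
qed

lemma join_horn_subset:
  assumes t: "\<tau> \<in> horn m i" and r: "\<rho> \<in> simplex (Suc a + sdim \<tau>)"
  shows "op_comp (id_join a \<tau>) \<rho> \<in> horn (Suc a + m) (Suc a + i)"
proof -
  obtain j where j: "j \<le> m" "j \<noteq> i" "j \<notin> set \<tau>" using t by (auto simp: horn_def)
  have "id_join a \<tau> \<in> horn (Suc a + m) (Suc a + i)"
    unfolding horn_def using ops_simplex[OF id_join_ops[OF horn_ops[OF t], of a]] j
    by (auto simp: id_join_def intro!: exI[of _ "Suc a + j"])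
  moreover have "sdim (id_join a \<tau>) = Suc a + sdim \<tau>" using id_join_ops[OF horn_ops[OF t]] by (rule sdim_ops)
  ultimately show ?thesis
    using subcomplexD(3)[OF subcomplex_horn] simplex_ops[OF r] by metis
qed

text \<open>
  \<open>\<Lambda>\<^bsup>a+1+m\<^esup>\<^bsub>a+1+i\<^esub>\<close> is the union of \<open>\<partial>\<Delta>\<^sup>a \<star> \<Delta>\<^sup>m\<close> and \<open>\<Delta>\<^sup>a \<star> \<Lambda>\<^sup>m\<^sub>i\<close>: the omitted vertex lies either in
  the first or in the second factor of the join.
\<close>

lemma big_horn_cases:
  assumes r: "\<rho> \<in> horn (Suc a + m) (Suc a + i)"
  obtains (boundary) "\<rho> \<in> faces (Suc a + m) {..a}"
  | (join) \<tau> \<rho>' where "\<tau> \<in> horn m i" "\<rho>' \<in> simplex (Suc a + sdim \<tau>)" "\<rho> = op_comp (id_join a \<tau>) \<rho>'"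
proof (cases "\<rho> \<in> faces (Suc a + m) {..a}")
  case True
  then show thesis by (rule boundary)
next
  case False
  have rs: "\<rho> \<in> simplex (Suc a + m)" using r by (simp add: horn_def)
  then obtain \<sigma> \<tau> where \<rho>: "\<rho> = \<sigma> @ map (\<lambda>j. Suc a + j) \<tau>" "\<sigma> \<in> insert [] (simplex a)"
    "\<tau> \<in> insert [] (simplex m)" "\<sigma> \<noteq> [] \<or> \<tau> \<noteq> []" by (rule simplex_join_cases)
  have s: "set \<sigma> \<subseteq> {..a}" using \<rho>(2) by (auto simp: simplex_iff)
  obtain j where j: "j \<le> Suc a + m" "j \<noteq> Suc a + i" "j \<notin> set \<rho>" using r by (auto simp: horn_def)
  then have "\<not> j \<le> a" using False rs by (auto simp: faces_def)
  then obtain h where h: "j = Suc a + h" using le_Suc_ex not_less_eq_eq by blast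
  show thesis
  proof (cases "\<tau> = []")
    case True
    \<comment> \<open>A simplex of \<open>\<Delta>\<^sup>a\<close> alone factors through \<open>1 \<star> \<tau>\<close> for every \<open>\<tau>\<close>; the vertex \<open>i\<close> is a convenient one.\<close>
    have "\<sigma> \<in> simplex (Suc a + sdim [i])" using True \<rho> by (auto simp: simplex_iff)
    moreover have "\<rho> = op_comp (id_join a [i]) \<sigma>"
      using op_comp_id_join[OF s, of "[]" "[i]"] True \<rho>(1) by (simp add: op_comp_def)
    ultimately show thesis using join vertex_in_horn[OF m i] by blast
  next
    case False
    have "\<tau> \<in> horn m i" unfolding horn_def using False \<rho>(1,3) j h by auto
    moreover have l: "length \<tau> = Suc (sdim \<tau>)" using False by (simp add: sdim_def)
    moreover have "\<sigma> @ map (\<lambda>j. Suc a + j) [0..<Suc (sdim \<tau>)] \<in> simplex (Suc a + sdim \<tau>)"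
      by (rule join_standard_simplex[OF \<rho>(2)])
    moreover have "\<rho> = op_comp (id_join a \<tau>) (\<sigma> @ map (\<lambda>j. Suc a + j) [0..<Suc (sdim \<tau>)])"
      using op_comp_id_join[OF s, of "[0..<Suc (sdim \<tau>)]" \<tau>] \<rho>(1) l
        map_nth[of \<tau>, folded op_comp_def]
      by (simp add: atLeast0LessThan)
    ultimately show thesis using join by blast
  qed
qed

definition glued_base :: 'm where "glued_base = act Y (Suc a) (collapse a m) \<cdot> (\<eta> \<cdot> common)"

lemma eta_common: "\<eta> \<cdot> common \<in> Hom C W (lev Y (Suc a))"
  by (rule comp_hom[OF common_hom base_hom(1)]) simp_all

lemma glued_boundary_pts: "(glued, glued_base) \<in> pts (faces (Suc a + m) {..a}) (Suc a + m) W"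
proof (rule pts_cong[OF _ subcomplex_faces])
  have "(\<lambda>\<rho>. \<xi> \<rho> \<cdot> common, \<eta> \<cdot> common) \<in> pts (faces (Suc a) {..a}) (Suc a) W"
    by (rule pts_pre[OF base_pt common_hom faces_subset]) simp_all
  then show "(\<lambda>\<rho>. \<xi> (op_comp (collapse a m) \<rho>) \<cdot> common, glued_base) \<in> pts (faces (Suc a + m) {..a}) (Suc a + m) W"
    unfolding glued_base_def
    by (rule pts_pull[OF _ subcomplex_faces collapse_ops])
      (use map_min_faces op_comp_collapse faces_subset in \<open>auto simp: subset_iff\<close>)
  fix \<rho> assume r: "\<rho> \<in> faces (Suc a + m) {..a}"
  then show "glued \<rho> = \<xi> (op_comp (collapse a m) \<rho>) \<cdot> common"
    using op_comp_collapse[of \<rho> a m] faces_subset[of "Suc a + m" "{..a}"] unfolding glued_def by auto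
qed

lemma glued_pts: "(glued, glued_base) \<in> pts (horn (Suc a + m) (Suc a + i)) (Suc a + m) W"
proof (rule ptsI)
  note bd = ptsD[OF glued_boundary_pts]
  show "glued_base \<in> Hom C W (lev Y (Suc a + m))" by (rule bd(2))
  show "glued \<in> hom_points C (horn (Suc a + m) (Suc a + i)) X W"
    unfolding hom_points_def
  proof safe
    fix \<rho> assume "\<rho> \<in> horn (Suc a + m) (Suc a + i)"
    then show "glued \<rho> \<in> Hom C W (lev X (sdim \<rho>))"
    proof (cases rule: big_horn_cases)
      case boundary
      then show ?thesis by (rule bd(4))
    next
      case (join \<tau> \<rho>')
      then show ?thesis
        using glued_join X.act_pt[OF simplex_ops[OF join(2)] p_pt[OF x_hom[OF join(1)]]] by simp
    qed
  next
    fix \<rho> h \<phi> assume "\<rho> \<in> horn (Suc a + m) (Suc a + i)" and f: "\<phi> \<in> ops h (sdim \<rho>)"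
    then show "glued (op_comp \<rho> \<phi>) = act X (sdim \<rho>) \<phi> \<cdot> glued \<rho>"
    proof (cases rule: big_horn_cases)
      case boundary
      then show ?thesis using hom_pointsD(2)[OF bd(1)] f by blast
    next
      case (join \<tau> \<rho>')
      have f': "\<phi> \<in> ops h (sdim \<rho>')" using f join(3) by simp
      have "op_comp \<rho> \<phi> = op_comp (id_join a \<tau>) (op_comp \<rho>' \<phi>)"
        using join(3) op_comp_assoc[OF simplex_ops[OF join(2)] f'] by simp
      then show ?thesis
        using glued_join[OF join(1) subcomplexD(3)[OF subcomplex_simplex join(2) f']]
          glued_join[OF join(1,2)] join(3)
          X.act_act[OF simplex_ops[OF join(2)] f' p_pt[OF x_hom[OF join(1)]]] by simp
    qed
  qed
  fix \<rho> assume "\<rho> \<in> horn (Suc a + m) (Suc a + i)"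
  then show "f (sdim \<rho>) \<cdot> glued \<rho> = act Y (Suc a + m) \<rho> \<cdot> glued_base"
  proof (cases rule: big_horn_cases)
    case boundary
    then show ?thesis by (rule bd(3))
  next
    case (join \<tau> \<rho>')
    let ?l = "Suc a + sdim \<tau>"
    note px = p_pt[OF x_hom[OF join(1)] W] and t = horn_ops[OF join(1)] and r' = simplex_ops[OF join(2)]
    have "f (sdim \<rho>) \<cdot> glued \<rho> = act Y ?l \<rho>' \<cdot> (f ?l \<cdot> (p (sdim \<tau>) \<cdot> x \<tau>))"
      using glued_join[OF join(1,2)] join(3) map_act[OF r' px W] by simp
    also have "\<dots> = act Y ?l \<rho>' \<cdot> (act Y (Suc a) (collapse a (sdim \<tau>)) \<cdot> (\<eta> \<cdot> common))"
      using base_map_pt[OF x_hom[OF join(1)] W] q_x[OF join(1)] by simp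
    also have "act Y (Suc a) (collapse a (sdim \<tau>)) \<cdot> (\<eta> \<cdot> common) =
        act Y (Suc a + m) (id_join a \<tau>) \<cdot> glued_base"
      using Y.act_act[OF collapse_ops id_join_ops[OF t] eta_common W] id_join_collapse[OF t]
      unfolding glued_base_def by simp
    also have "act Y ?l \<rho>' \<cdot> (act Y (Suc a + m) (id_join a \<tau>) \<cdot> glued_base) =
        act Y (Suc a + m) \<rho> \<cdot> glued_base"
      using Y.act_act[OF id_join_ops[OF t] r' bd(2) W] join(3) by simp
    finally show ?thesis .
  qed
qed

end

context higher_morphisms
begin

text \<open>
  The object \<open>Q\<close> that represents the fillers of the glued point on \<open>\<Lambda>\<^bsup>a+1+m\<^esup>\<^bsub>a+1+i\<^esub>\<close> relative to \<open>f\<close>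
  also represents the fillers of \<open>x\<close> in \<open>P\<close>: the top simplex of a filler, together with the point
  of \<open>D\<close> underlying \<open>x\<close>, is a point of \<open>P\<^sub>m\<close>, because the glued point prescribes what is required on
  \<open>\<partial>\<Delta>\<^sup>a \<star> \<Delta>\<^sup>m\<close> and in \<open>Y\<close>.
\<close>

lemma covering_horn:
  assumes cov: "covering K (horn (Suc a + m) (Suc a + i)) (simplex (Suc a + m)) (Suc a + m)"
    and m: "0 < m" and i: "i \<le> m" and T: "is_terminal C T"
  shows "simplicial_map.covering C P (const_sobj C T) (to_terminal C T P) K (horn m i) (simplex m) m"
proof -
  interpret t: simplicial_map C P "const_sobj C T" "to_terminal C T P"
    by (rule P.simplicial_map_to_terminal[OF T])
  have TO: "T \<in> Ob C" using T unfolding is_terminal_def by blast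
  let ?N = "Suc a + m"
  let ?H = "horn ?N (Suc a + i)"
  note HS = horn_subset[of ?N "Suc a + i"] and hS = horn_subset[of m i]
  show ?thesis
    unfolding t.covering_def
  proof (intro ballI allI impI)
    fix W x y0 assume W: "W \<in> Ob C" and xy: "(x, y0) \<in> t.pts (horn m i) m W"
    note xy' = t.ptsD[OF xy]
    interpret h: higher_morphisms_horn C X Y f a P D \<xi> \<eta> p q m i W x
      by unfold_locales (use m i W xy'(1) in auto)
    obtain Q c x' where e: "extension ?H (simplex ?N) ?N W h.glued h.glued_base Q c x'" and cK: "c \<in> K Q W"
      using coveringD[OF cov W h.glued_pts] .
    note d = extensionD[OF e]
    define t where "t = x' [0..<Suc ?N]"
    have t: "t \<in> Hom C Q (lev X ?N)" "f ?N \<cdot> t = h.glued_base \<cdot> c"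
      using pts_simplex[OF d(3,1)] unfolding t_def by auto
    have x't: "x' \<rho> = act X ?N \<rho> \<cdot> t" if "\<rho> \<in> simplex ?N" for \<rho>
      unfolding t_def by (rule X.hom_points_simplex[OF ptsD(1)[OF d(3)] that])
    have bc: "h.common \<cdot> c \<in> Hom C Q D" by (rule comp_hom[OF d(2) h.common_hom d(1) W]) simp
    have "act X ?N \<rho> \<cdot> t = \<xi> (map (min (Suc a)) \<rho>) \<cdot> (h.common \<cdot> c)" if r: "\<rho> \<in> faces ?N {..a}" for \<rho>
    proof -
      have rH: "\<rho> \<in> ?H" using r unfolding horn_eq_faces faces_def by fastforce
      have "act X ?N \<rho> \<cdot> t = h.glued \<rho> \<cdot> c" using x't[of \<rho>] d(4)[OF rH] rH HS by auto
      also have "\<dots> = \<xi> (map (min (Suc a)) \<rho>) \<cdot> (h.common \<cdot> c)"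
        using r assoc[OF d(2) h.common_hom base_hom(2)[OF map_min_faces[OF r]]] d(1) W
        unfolding h.glued_def by simp
      finally show ?thesis .
    qed
    moreover have "f ?N \<cdot> t = act Y (Suc a) (collapse a m) \<cdot> (\<eta> \<cdot> (h.common \<cdot> c))"
      using t(2) Y.act_pre[OF collapse_ops h.eta_common d(2) W d(1)] assoc[OF d(2) h.common_hom base_hom(1)] d(1) W
      unfolding h.glued_base_def by simp
    ultimately obtain u0 where u0: "u0 \<in> Hom C Q (lev P m)" "p m \<cdot> u0 = t" "q m \<cdot> u0 = h.common \<cdot> c"
      using univ[OF d(1) t(1) bc] by blast
    \<comment> \<open>\<open>u0\<close> is the top simplex of the universal filler of \<open>x\<close>.\<close>
    have "t.extension (horn m i) (simplex m) m W x y0 Q c (\<lambda>\<tau>. act P m \<tau> \<cdot> u0)"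
    proof (rule t.extensionI[OF d(1,2)])
      have "y0 \<cdot> c \<in> Hom C Q T"
        using comp_hom[OF d(2) xy'(2)] d(1) W TO by (simp add: const_sobj_def)
      then have "to_terminal C T P m \<cdot> u0 = y0 \<cdot> c"
        using terminal_eq[OF T d(1)] t.map_pt[OF u0(1) d(1)] by (simp add: const_sobj_def)
      then show "(\<lambda>\<tau>. act P m \<tau> \<cdot> u0, y0 \<cdot> c) \<in> t.pts (simplex m) m Q"
        using t.pts_act[OF u0(1) d(1) subset_refl] by simp
      fix \<tau> assume s: "\<tau> \<in> horn m i"
      note so = h.horn_ops[OF s] and xs = h.x_hom[OF s]
      let ?I = "[0..<Suc (Suc a + sdim \<tau>)]"
      show "act P m \<tau> \<cdot> u0 = x \<tau> \<cdot> c"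
      proof (rule P_eqI[OF _ _ d(1)])
        show "act P m \<tau> \<cdot> u0 \<in> Hom C Q (lev P (sdim \<tau>))" by (rule P.act_pt[OF so u0(1) d(1)])
        show "x \<tau> \<cdot> c \<in> Hom C Q (lev P (sdim \<tau>))" by (rule comp_hom[OF d(2) xs d(1) W]) simp
        have I: "op_comp (id_join a \<tau>) ?I = id_join a \<tau>" by (rule op_comp_id_right[OF id_join_ops[OF so]])
        have "id_join a \<tau> \<in> ?H" using h.join_horn_subset[OF s id_simplex] I by simp
        moreover have "h.glued (id_join a \<tau>) = p (sdim \<tau>) \<cdot> x \<tau>"
          using h.glued_join[OF s id_simplex] I X.act_id[OF p_pt[OF xs W] W] by simp
        ultimately have "act X ?N (id_join a \<tau>) \<cdot> t = p (sdim \<tau>) \<cdot> x \<tau> \<cdot> c"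
          using x't[of "id_join a \<tau>"] d(4)[of "id_join a \<tau>"] HS by auto
        then show "p (sdim \<tau>) \<cdot> (act P m \<tau> \<cdot> u0) = p (sdim \<tau>) \<cdot> (x \<tau> \<cdot> c)"
          using p_act_pt[OF so u0(1) d(1)] u0(2) p_pre[OF xs d(2) W d(1)] by simp
        show "q (sdim \<tau>) \<cdot> (act P m \<tau> \<cdot> u0) = q (sdim \<tau>) \<cdot> (x \<tau> \<cdot> c)"
          using q_act_pt[OF so u0(1) d(1)] u0(3) q_pre[OF xs d(2) W d(1)] h.q_x[OF s] by simp
      qed
    next
      fix U u z
      assume U: "U \<in> Ob C" and u: "u \<in> Hom C U W" and z: "(z, y0 \<cdot> u) \<in> t.pts (simplex m) m U"
        and zx: "\<And>\<tau>. \<tau> \<in> horn m i \<Longrightarrow> z \<tau> = x \<tau> \<cdot> u"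
      let ?w = "z [0..<Suc m]"
      have w: "?w \<in> Hom C U (lev P m)" by (rule t.pts_simplex(1)[OF z U])
      have zw: "z \<tau> = act P m \<tau> \<cdot> ?w" if "\<tau> \<in> simplex m" for \<tau>
        by (rule P.hom_points_simplex[OF t.ptsD(1)[OF z] that])
      have xu: "act P m \<tau> \<cdot> ?w = x \<tau> \<cdot> u" if "\<tau> \<in> horn m i" for \<tau>
        using zw[of \<tau>] zx[OF that] that hS by auto
      note pw = p_pt[OF w U]
      have qw: "q m \<cdot> ?w = h.common \<cdot> u"
        using q_act_pt[OF h.horn_ops w U] xu q_pre[OF h.x_hom u W U] h.q_x vertex_in_horn[OF m i] by metis
      have base: "f ?N \<cdot> (p m \<cdot> ?w) = h.glued_base \<cdot> u"
        using base_map_pt[OF w U] qw Y.act_pre[OF collapse_ops h.eta_common u W U]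
          assoc[OF u h.common_hom base_hom(1)] U W
        unfolding h.glued_base_def by simp
      \<comment> \<open>Conversely, a filler \<open>z\<close> of \<open>x\<close> over \<open>U\<close> yields a filler of the glued point.\<close>
      have agree: "act X ?N \<rho> \<cdot> (p m \<cdot> ?w) = h.glued \<rho> \<cdot> u" if "\<rho> \<in> ?H" for \<rho>
        using that
      proof (cases rule: h.big_horn_cases)
        case boundary
        then show ?thesis
          using boundary_pt[OF _ w U] qw assoc[OF u h.common_hom base_hom(2)[OF map_min_faces]] U W
          unfolding h.glued_def by simp
      next
        case (join \<tau> \<rho>')
        note so = h.horn_ops[OF join(1)] and ro = simplex_ops[OF join(2)] and xs = h.x_hom[OF join(1)]
        have "act X ?N \<rho> \<cdot> (p m \<cdot> ?w) = act X (Suc a + sdim \<tau>) \<rho>' \<cdot> (p (sdim \<tau>) \<cdot> (act P m \<tau> \<cdot> ?w))"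
          using X.act_act[OF id_join_ops[OF so] ro pw U] p_act_pt[OF so w U] join(3) by simp
        also have "\<dots> = h.glued \<rho> \<cdot> u"
          using xu[OF join(1)] p_pre[OF xs u W U] X.act_pre[OF ro p_pt[OF xs W] u W U]
            h.glued_join[OF join(1,2)] join(3) by simp
        finally show ?thesis .
      qed
      have "(\<lambda>\<rho>. act X ?N \<rho> \<cdot> (p m \<cdot> ?w), h.glued_base \<cdot> u) \<in> pts (simplex ?N) ?N U"
        using pts_act[OF pw U subset_refl] base by simp
      then obtain v where v: "v \<in> Hom C U Q" "c \<cdot> v = u"
        "\<forall>\<rho> \<in> simplex ?N. x' \<rho> \<cdot> v = act X ?N \<rho> \<cdot> (p m \<cdot> ?w)"
        using d(5)[OF U u _ agree] by blast
      have tv: "t \<cdot> v = p m \<cdot> ?w"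
        using bspec[OF v(3) id_simplex] X.act_id[OF pw U] unfolding t_def by simp
      have "u0 \<cdot> v = ?w"
      proof (rule P_eqI[OF _ w U])
        show "u0 \<cdot> v \<in> Hom C U (lev P m)" by (rule comp_hom[OF v(1) u0(1) U d(1)]) simp
        show "p m \<cdot> (u0 \<cdot> v) = p m \<cdot> ?w" using p_pre[OF u0(1) v(1) d(1) U] u0(2) tv by simp
        show "q m \<cdot> (u0 \<cdot> v) = q m \<cdot> ?w"
          using q_pre[OF u0(1) v(1) d(1) U] u0(3) qw assoc[OF v(1) d(2) h.common_hom] v(2) U d(1) W by simp
      qed
      then have "act P m \<tau> \<cdot> u0 \<cdot> v = z \<tau>" if "\<tau> \<in> simplex m" for \<tau>
        using P.act_pre[OF simplex_ops[OF that] u0(1) v(1) d(1) U] zw[OF that] by simp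
      then show "\<exists>v. v \<in> Hom C U Q \<and> c \<cdot> v = u \<and> (\<forall>\<tau> \<in> simplex m. act P m \<tau> \<cdot> u0 \<cdot> v = z \<tau>)"
        using v(1,2) by blast
    next
      fix U v w
      assume U: "U \<in> Ob C" and v: "v \<in> Hom C U Q" and w: "w \<in> Hom C U Q" and cc: "c \<cdot> v = c \<cdot> w"
        and eq: "\<And>\<tau>. \<tau> \<in> simplex m \<Longrightarrow> act P m \<tau> \<cdot> u0 \<cdot> v = act P m \<tau> \<cdot> u0 \<cdot> w"
      have "u0 \<cdot> v = u0 \<cdot> w" using eq[OF id_simplex] P.act_id[OF u0(1) d(1)] by simp
      then have "t \<cdot> v = t \<cdot> w" using p_pre[OF u0(1) v d(1) U] p_pre[OF u0(1) w d(1) U] u0(2) by simp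
      then have "x' \<rho> \<cdot> v = x' \<rho> \<cdot> w" if "\<rho> \<in> simplex ?N" for \<rho>
        using x't[OF that] X.act_pre[OF simplex_ops[OF that] t(1) v d(1) U]
          X.act_pre[OF simplex_ops[OF that] t(1) w d(1) U] by simp
      then show "v = w"
        using extension_eqI[OF e HS subset_refl U W h.glued_pts v w cc] by blast
    qed
    then show "\<exists>Q c x'. t.extension (horn m i) (simplex m) m W x y0 Q c x' \<and> c \<in> K Q W"
      using cK by blast
  qed
qed

end

section \<open>Higher morphism spaces of a stack\<close>

theorem theorem3p6:
  fixes C :: "('o, 'm) cat"
    and Cov :: "'o \<Rightarrow> 'o \<Rightarrow> 'm set"
    and X Y :: "('o, 'm) sobj"
    and f :: "nat \<Rightarrow> 'm"
    and n :: enat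
    and k :: nat
  assumes "category_with_covers C Cov"
    and "0 < k" and "enat k \<le> n"
    and "n_stack C Cov n X Y f"
  shows "(\<exists>P. is_higher_morphism_space C k X Y f P) \<and>
         (\<forall>P. is_higher_morphism_space C k X Y f P \<longrightarrow> lie_groupoid C Cov (n - enat k) P)"
proof -
  interpret C: category_with_covers C Cov by (rule assms(1))
  interpret K: cover_class C Cov by (rule C.cover_class_Cov)
  have st: "lie_groupoid C Cov \<infinity> X" "lie_groupoid C Cov \<infinity> Y" "f \<in> simplicial_maps C X Y"
    using assms(4) unfolding n_stack_def by auto
  interpret f: simplicial_map C X Y f
    using st unfolding lie_groupoid_def by unfold_locales auto
  interpret f: simplicial_map_covers C X Y f Cov by unfold_locales
  obtain a where k: "k = Suc a" using assms(2) by (cases k) auto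
  have kl: "k + l = Suc a + l" for l using k by simp
  let ?F = "\<lambda>l. faces (Suc a + l) {..a}"
  have horns: "f.covering Cov (horn r i) (simplex r) r" if "0 < r" "i \<le> r" for r i
    by (rule C.n_stack_covering(1)[OF assms(4) that])
  have sub: "{..a} \<subseteq> {..Suc a + l}" "{..a} \<noteq> {}" "{..a} \<noteq> {..Suc a + l}" for l
    by auto
  have rep: "\<exists>L \<xi> \<eta>. is_rel_hom C (?F l) (Suc a + l) X Y f L \<xi> \<eta>" for l
    using f.representable_faces[of "a + l" "{..a}"] horns C.coface_cover[OF st(2)] sub(1,3)[of l] by simp
  have covF: "f.covering Cov (?F l) (simplex (Suc a + l)) (Suc a + l)" for l
    by (rule f.covering_faces[OF horns sub])
  \<comment> \<open>The natural map \<open>X\<^bsub>k+l\<^esub> \<rightarrow> B\<^sub>l\<close> is a cover, so it has a pullback along any map.\<close>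
  have lw: "\<exists>P p q. is_pullback C (lev (join_power a X) l) (lev (const_sobj C (lev B 0)) l) (lev B l)
      (\<phi> l) (act B 0 (replicate (Suc l) 0)) P p q"
    if B: "is_rel_join_power C a (simplex_boundary a) X Y f B \<xi> \<eta>"
      and r: "\<And>l. is_rel_restriction C (?F l) (Suc a + l) X f (lev B l) (\<xi> l) (\<eta> l) (\<phi> l)" for B \<xi> \<eta> \<phi> l
  proof -
    note b = is_rel_join_powerD[OF B]
    interpret B: simplicial_obj C B by unfold_locales (rule b(1))
    have "\<phi> l \<in> Cov (lev X (Suc a + l)) (lev B l)"
      by (rule f.restriction_of_covering[OF b(2) r covF faces_subset])
    then show ?thesis
      using C.A2_exists[OF f.X.lev_Ob B.lev_Ob B.lev_Ob _ B.act_hom[OF replicate_ops]]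
      by (simp add: join_power_def const_sobj_def)
  qed
  show ?thesis
  proof (intro conjI allI impI)
    obtain B \<xi> \<eta> where B: "is_rel_join_power C a (simplex_boundary a) X Y f B \<xi> \<eta>"
      using f.rel_join_power_exists[OF rep] by blast
    have "\<forall>l. \<exists>r. is_rel_restriction C (?F l) (Suc a + l) X f (lev B l) (\<xi> l) (\<eta> l) r"
      using f.restriction_exists[OF is_rel_join_powerD(2)[OF B] faces_subset] by blast
    then obtain \<phi> where r: "\<And>l. is_rel_restriction C (?F l) (Suc a + l) X f (lev B l) (\<xi> l) (\<eta> l) (\<phi> l)"
      by metis
    interpret B: simplicial_obj C B by unfold_locales (rule is_rel_join_powerD(1)[OF B])
    obtain P p q where "is_pullback (sCat C) (join_power a X) (const_sobj C (lev B 0)) B \<phi>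
        (\<lambda>l. act B 0 (replicate (Suc l) 0)) P p q"
      using C.levelwise_pullback_exists[OF f.restriction_simplicial_map[OF B r]
          B.degeneracies_simplicial_map lw[OF B r]] by blast
    then show "\<exists>P. is_higher_morphism_space C k X Y f P"
      using B r unfolding is_higher_morphism_space_def kl join_boundary_eq_faces k diff_Suc_1 by blast
  next
    fix P assume "is_higher_morphism_space C k X Y f P"
    then obtain B \<xi> \<eta> \<phi> p q where B: "is_rel_join_power C a (simplex_boundary a) X Y f B \<xi> \<eta>"
      and r: "\<And>l. is_rel_restriction C (?F l) (Suc a + l) X f (lev B l) (\<xi> l) (\<eta> l) (\<phi> l)"
      and pb: "is_pullback (sCat C) (join_power a X) (const_sobj C (lev B 0)) B \<phi>
        (\<lambda>l. act B 0 (replicate (Suc l) 0)) P p q"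
      unfolding is_higher_morphism_space_def kl join_boundary_eq_faces k diff_Suc_1 by blast
    interpret P: higher_morphisms C X Y f a P "lev B 0" "\<xi> 0" "\<eta> 0" p q
      using C.sCat_pullback_levelwise[OF pb lw[OF B r]]
      by (intro f.higher_morphisms_of_pullback[OF B r pb]) (simp add: join_power_def const_sobj_def)
    obtain T where T: "is_terminal C T" using C.A1 by blast
    show "lie_groupoid C Cov (n - enat k) P"
    proof (rule C.lie_groupoid_of_covering[OF P.P_simplicial T])
      fix m i :: nat assume m: "0 < m" and i: "i \<le> m"
      then have N: "0 < Suc a + m" "Suc a + i \<le> Suc a + m" by auto
      show "simplicial_map.covering C P (const_sobj C T) (to_terminal C T P) Cov (horn m i) (simplex m) m"
        by (rule P.covering_horn[OF C.n_stack_covering(1)[OF assms(4) N] m i T])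
      assume "n - enat k < enat m"
      then have "n < enat (Suc a + m)" using assms(3) k by (cases n) auto
      then show "simplicial_map.covering C P (const_sobj C T) (to_terminal C T P)
          (\<lambda>A B. {g. is_iso C A B g}) (horn m i) (simplex m) m"
        by (rule P.covering_horn[OF C.n_stack_covering(2)[OF assms(4) N] m i T])
    qed
  qed
qed

end
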